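(* Let $\mathscr A=\operatorname{span}_{\mathbb C}\{\widehat p_\mu\mid \mu \text{ a partition}\}\subset\widehat\Lambda$. Then $\mathscr A$ is a commutative subalgebra of $(\widehat\Lambda,\times)$. More precisely, there exist nonnegative integers $d_{\mu\nu}^{\lambda}$ (indexed by partitions $\lambda,\mu,\nu$), independent of the ambient degree, such that for all partitions $\mu,\nu$ $$\widehat p_\mu\times\widehat p_\nu=\sum_\lambda d_{\mu\nu}^{\lambda}\,\widehat p_\lambda .$$ For given $\mu,\nu$ only finitely many terms occur, and $$\max(|\mu|,|\nu|)\leq|\lambda|\leq|\mu|+|\nu|\qquad\text{whenever } d_{\mu\nu}^{\lambda}\neq0 .$$
   Context: $\Lambda=\bigoplus_n\Lambda_n$ is the algebra of symmetric functions over $\mathbb C$, graded by degree, with Schur functions $s_\lambda$ and power sums $p_\mu=\prod_i p_{\mu_i}$. The class product $\times$ on $\Lambda_n$ is the bilinear product determined by $s_\lambda\times s_\mu=\delta_{\lambda\mu}\frac{1}{f^\lambda}s_\lambda$ for $\lambda,\mu\vdash n$, where $f^\lambda$ is the number of standard Young tableaux of shape $\lambda$ (it is the product transported from the center of $\mathbb C\mathfrak S_n$ by the Frobenius characteristic). The degree completion is $\widehat\Lambda=\prod_{n\ge0}\Lambda_n$, and $\times$ is extended componentwise: $(\sum_nF_n)\times(\sum_nG_n)=\sum_n F_n\times G_n$ with $F_n,G_n\in\Lambda_n$. For a partition $\mu$ of size $m$ (parts equal to $1$ are allowed and retained), $$\widehat p_\mu=\frac{m!\,p_\mu}{(1-p_1)^{m+1}}=\sum_{n\ge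 m}(n)_m\,p_\mu\,p_1^{\,n-m}\in\widehat\Lambda,\qquad (n)_m=n(n-1)\cdots(n-m+1).$$ *)

theory Defs
  imports
    "HOL-Library.Multiset"
    "HOL-Library.FuncSet"
    "HOL-Computational_Algebra.Formal_Power_Series"
begin

section \<open>Formal power series in countably many variables\<close>

text \<open>
  The monomial \<open>x\<^sub>a x\<^sub>b x\<^sub>c \<cdots>\<close> in the variables \<open>x\<^sub>0, x\<^sub>1, x\<^sub>2, \<dots>\<close> is the multiset \<open>{#a, b, c, \<dots>#}\<close>
  of variable indices: multiplication of monomials is union, the degree is \<open>size\<close>, and a
  permutation of the variables acts by \<open>image_mset\<close>.
\<close>

typedef mser = "UNIV :: (nat multiset \<Rightarrow> complex) set"
  morphisms mcoeff Abs_mser ..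

setup_lifting type_definition_mser

lemma mser_eqI: "(\<And>M. mcoeff F M = mcoeff G M) \<Longrightarrow> F = G"
  by transfer auto

definition msplits :: "nat multiset \<Rightarrow> (nat multiset \<times> nat multiset) set" where
  "msplits M = {(A, B). A + B = M}"

lemma finite_msplits [simp]: "finite (msplits M)"
proof -
  have "{A. A \<subseteq># M} \<subseteq> mset ` {xs. set xs \<subseteq> set_mset M \<and> length xs \<le> size M}"
  proof
    fix A assume "A \<in> {A. A \<subseteq># M}"
    moreover obtain xs where "A = mset xs" by (metis ex_mset)
    ultimately show "A \<in> mset ` {xs. set xs \<subseteq> set_mset M \<and> length xs \<le> size M}"
      by (fastforce dest: set_mset_mono size_mset_mono)
  qed
  then have fin: "finite {A. A \<subseteq># M}"
    using finite_surj[OF finite_lists_length_le] by blast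
  have "msplits M \<subseteq> {A. A \<subseteq># M} \<times> {A. A \<subseteq># M}"
    by (auto simp: msplits_def)
  with fin show ?thesis by (meson finite_SigmaI finite_subset)
qed

instantiation mser :: comm_ring_1
begin

lift_definition zero_mser :: mser is "\<lambda>M. 0" .
lift_definition one_mser :: mser is "\<lambda>M. if M = {#} then 1 else 0" .
lift_definition plus_mser :: "mser \<Rightarrow> mser \<Rightarrow> mser" is "\<lambda>f g M. f M + g M" .
lift_definition minus_mser :: "mser \<Rightarrow> mser \<Rightarrow> mser" is "\<lambda>f g M. f M - g M" .
lift_definition uminus_mser :: "mser \<Rightarrow> mser" is "\<lambda>f M. - f M" .
lift_definition times_mser :: "mser \<Rightarrow> mser \<Rightarrow> mser" is
  "\<lambda>f g M. \<Sum>(A, B)\<in>msplits M. f A * g B" .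

instance
proof
  fix F G H :: mser
  show "F * G * H = F * (G * H)"
  proof (transfer, rule ext)
    fix f g h :: "nat multiset \<Rightarrow> complex" and M
    have "(\<Sum>(A, B)\<in>msplits M. (\<Sum>(C, D)\<in>msplits A. f C * g D) * h B) =
        (\<Sum>(p, q)\<in>(SIGMA p:msplits M. msplits (fst p)). f (fst q) * g (snd q) * h (snd p))"
      by (subst sum.Sigma[symmetric]) (auto simp: case_prod_beta sum_distrib_right)
    also have "\<dots> = (\<Sum>(p, q)\<in>(SIGMA p:msplits M. msplits (snd p)). f (fst p) * g (fst q) * h (snd q))"
      by (rule sum.reindex_bij_witness[of _
            "\<lambda>(p, q). ((fst p + fst q, snd q), (fst p, fst q))"
            "\<lambda>(p, q). ((fst q, snd q + snd p), (snd q, snd p))"])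
         (auto simp: msplits_def add.assoc)
    also have "\<dots> = (\<Sum>(A, B)\<in>msplits M. f A * (\<Sum>(C, D)\<in>msplits B. g C * h D))"
      by (subst sum.Sigma[symmetric]) (auto simp: case_prod_beta sum_distrib_left mult.assoc)
    finally show "(\<Sum>(A, B)\<in>msplits M. (\<Sum>(C, D)\<in>msplits A. f C * g D) * h B) =
        (\<Sum>(A, B)\<in>msplits M. f A * (\<Sum>(C, D)\<in>msplits B. g C * h D))" .
  qed
  show "F * G = G * F"
  proof (transfer, rule ext)
    fix f g :: "nat multiset \<Rightarrow> complex" and M
    show "(\<Sum>(A, B)\<in>msplits M. f A * g B) = (\<Sum>(A, B)\<in>msplits M. g A * f B)"
      by (rule sum.reindex_bij_witness[of _ prod.swap prod.swap])
         (auto simp: msplits_def add.commute mult.commute)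
  qed
  show "1 * F = F"
  proof (transfer, rule ext)
    fix f :: "nat multiset \<Rightarrow> complex" and M
    have "(\<Sum>x\<in>msplits M. (if fst x = {#} then 1 else 0) * f (snd x)) = (\<Sum>x\<in>{({#} :: nat multiset, M)}. f (snd x))"
      by (rule sum.mono_neutral_cong_right, simp) (auto simp: msplits_def)
    then have "(\<Sum>x\<in>msplits M. (if fst x = {#} then 1 else 0) * f (snd x)) = f M" by simp
    then show "(\<Sum>(A, B)\<in>msplits M. (if A = {#} then 1 else 0) * f B) = f M" by (simp add: case_prod_beta)
  qed
  show "(F + G) * H = F * H + G * H"
    by transfer (auto simp: distrib_right sum.distrib case_prod_beta)
  show "(0::mser) \<noteq> 1"
    by transfer (auto simp: fun_eq_iff)
qed (transfer, auto simp: algebra_simps)+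

end

lemma mcoeff_simps [simp]:
  "mcoeff 0 M = 0" "mcoeff (F + G) M = mcoeff F M + mcoeff G M"
  "mcoeff (F - G) M = mcoeff F M - mcoeff G M" "mcoeff (- F) M = - mcoeff F M"
  by (transfer, simp)+

lemma mcoeff_one: "mcoeff 1 M = (if M = {#} then 1 else 0)"
  by transfer simp

lemma mcoeff_mult: "mcoeff (F * G) M = (\<Sum>(A, B)\<in>msplits M. mcoeff F A * mcoeff G B)"
  by transfer simp

lemma mcoeff_sum [simp]: "mcoeff (sum f S) M = (\<Sum>a\<in>S. mcoeff (f a) M)"
  by (induction S rule: infinite_finite_induct) auto

lift_definition msmult :: "complex \<Rightarrow> mser \<Rightarrow> mser" is "\<lambda>c f M. c * f M" .

lemma mcoeff_msmult [simp]: "mcoeff (msmult c F) M = c * mcoeff F M"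
  by transfer simp

interpretation mser: vector_space msmult
  by unfold_locales (auto intro!: mser_eqI simp: algebra_simps)


section \<open>Symmetric functions\<close>

definition Lambda :: "nat \<Rightarrow> mser set" where
  "Lambda n = {F. (\<forall>\<sigma> M. bij \<sigma> \<longrightarrow> mcoeff F (image_mset \<sigma> M) = mcoeff F M) \<and>
                  (\<forall>M. mcoeff F M \<noteq> 0 \<longrightarrow> size M = n)}"

definition is_partition :: "nat list \<Rightarrow> bool" where
  "is_partition \<kappa> \<longleftrightarrow> sorted_wrt (\<ge>) \<kappa> \<and> 0 \<notin> set \<kappa>"

definition partitions_of :: "nat \<Rightarrow> nat list set" where
  "partitions_of n = {\<kappa>. is_partition \<kappa> \<and> sum_list \<kappa> = n}"

text \<open>The power sum \<open>p\<^sub>k = \<Sum>\<^sub>i x\<^sub>i\<^sup>k\<close>, meaningful for \<open>k > 0\<close> only.\<close>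

lift_definition psum :: "nat \<Rightarrow> mser" is
  "\<lambda>k M. if \<exists>i. M = replicate_mset k i then 1 else 0" .

definition psums :: "nat list \<Rightarrow> mser" where
  "psums \<mu> = prod_list (map psum \<mu>)"

text \<open>
  Tableaux are functions on the cells \<open>(row, column)\<close>, counted from 0 in English notation; they are
  \<open>undefined\<close> outside the diagram, so that distinct functions are distinct tableaux.
\<close>

definition diagram :: "nat list \<Rightarrow> (nat \<times> nat) set" where
  "diagram \<kappa> = {(i, j). i < length \<kappa> \<and> j < \<kappa> ! i}"

definition ssyt :: "nat list \<Rightarrow> (nat \<times> nat \<Rightarrow> nat) set" where
  "ssyt \<kappa> = {T \<in> extensional (diagram \<kappa>).
     (\<forall>i j j'. (i, j) \<in> diagram \<kappa> \<and> (i, j') \<in> diagram \<kappa> \<and> j < j' \<longrightarrow> T (i, j) \<le> T (i, j')) \<and>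
     (\<forall>i i' j. (i, j) \<in> diagram \<kappa> \<and> (i', j) \<in> diagram \<kappa> \<and> i < i' \<longrightarrow> T (i, j) < T (i', j))}"

definition syt :: "nat list \<Rightarrow> (nat \<times> nat \<Rightarrow> nat) set" where
  "syt \<kappa> = {T \<in> extensional (diagram \<kappa>). bij_betw T (diagram \<kappa>) {1..sum_list \<kappa>} \<and>
     (\<forall>i j j'. (i, j) \<in> diagram \<kappa> \<and> (i, j') \<in> diagram \<kappa> \<and> j < j' \<longrightarrow> T (i, j) < T (i, j')) \<and>
     (\<forall>i i' j. (i, j) \<in> diagram \<kappa> \<and> (i', j) \<in> diagram \<kappa> \<and> i < i' \<longrightarrow> T (i, j) < T (i', j))}"

definition num_syt :: "nat list \<Rightarrow> nat" where
  "num_syt \<kappa> = card (syt \<kappa>)"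

definition content :: "nat list \<Rightarrow> (nat \<times> nat \<Rightarrow> nat) \<Rightarrow> nat multiset" where
  "content \<kappa> T = image_mset T (mset_set (diagram \<kappa>))"

lift_definition schur :: "nat list \<Rightarrow> mser" is
  "\<lambda>\<kappa> M. of_nat (card {T \<in> ssyt \<kappa>. content \<kappa> T = M})" .

lemma finite_diagram [simp]: "finite (diagram \<kappa>)"
  by (rule finite_subset[of _ "SIGMA i:{..<length \<kappa>}. {..<\<kappa> ! i}"]) (auto simp: diagram_def)

lemma finite_ssyt_content: "finite {T \<in> ssyt \<kappa>. content \<kappa> T = M}"
proof (rule finite_subset)
  show "{T \<in> ssyt \<kappa>. content \<kappa> T = M} \<subseteq> diagram \<kappa> \<rightarrow>\<^sub>E set_mset M"
    by (auto simp: ssyt_def content_def PiE_def)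
qed (auto intro: finite_PiE)

lemma finite_partitions_of [simp]: "finite (partitions_of n)"
proof (rule finite_subset)
  have "length \<kappa> \<le> sum_list \<kappa>" if "0 \<notin> set \<kappa>" for \<kappa> :: "nat list"
    using that by (induction \<kappa>) auto
  then show "partitions_of n \<subseteq> {xs. set xs \<subseteq> {..n} \<and> length xs \<le> n}"
    using member_le_sum_list by (fastforce simp: partitions_of_def is_partition_def)
qed (simp add: finite_lists_length_le)

definition top_content :: "nat list \<Rightarrow> nat multiset" where
  "top_content \<kappa> = image_mset fst (mset_set (diagram \<kappa>))"

lemma mcoeff_schur: "mcoeff (schur \<kappa>) M = of_nat (card {T \<in> ssyt \<kappa>. content \<kappa> T = M})"
  by transfer simp

lemma mcoeff_schur_top: "mcoeff (schur \<kappa>) (top_content \<kappa>) \<noteq> 0"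
proof -
  define T where "T = restrict fst (diagram \<kappa>)"
  have "content \<kappa> T = top_content \<kappa>"
    unfolding content_def top_content_def T_def by (rule image_mset_cong) simp
  moreover have "T \<in> ssyt \<kappa>"
    by (auto simp: T_def ssyt_def)
  ultimately have "{T \<in> ssyt \<kappa>. content \<kappa> T = top_content \<kappa>} \<noteq> {}" by blast
  then show ?thesis
    using finite_ssyt_content[of \<kappa> "top_content \<kappa>"] by (simp add: mcoeff_schur del: Collect_empty_eq)
qed

lemma card_diagram_rows:
  "card {x \<in> diagram \<kappa>. fst x < k} = sum_list (take k \<kappa>)"
proof -
  have "{x \<in> diagram \<kappa>. fst x < k} = (SIGMA i:{..<min k (length \<kappa>)}. {..<\<kappa> ! i})"
    by (auto simp: diagram_def)
  then have "card {x \<in> diagram \<kappa>. fst x < k} = (\<Sum>i<min k (length \<kappa>). \<kappa> ! i)"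
    by simp
  also have "\<dots> = sum_list (take k \<kappa>)"
    by (simp add: sum_list_sum_nth atLeast0LessThan min.commute)
  finally show ?thesis .
qed

lemma diagram_upper:
  assumes "is_partition \<kappa>" "(i, j) \<in> diagram \<kappa>" "i' \<le> i"
  shows "(i', j) \<in> diagram \<kappa>"
proof (cases "i' = i")
  case False
  with assms have "\<kappa> ! i \<le> \<kappa> ! i'"
    by (auto simp: is_partition_def diagram_def sorted_wrt_iff_nth_less)
  with assms show ?thesis by (auto simp: diagram_def)
qed (use assms in simp)

lemma schur_dominance:
  assumes "is_partition \<kappa>" "mcoeff (schur \<kappa>) (top_content \<rho>) \<noteq> 0"
  shows "sum_list (take k \<rho>) \<le> sum_list (take k \<kappa>)"
proof -
  from assms(2) obtain T where T: "T \<in> ssyt \<kappa>" "content \<kappa> T = top_content \<rho>"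
    by (metis (mono_tags, lifting) card.empty empty_Collect_eq mcoeff_schur of_nat_0)
  have row: "i \<le> T (i, j)" if "(i, j) \<in> diagram \<kappa>" for i j
    using that
  proof (induction i)
    case (Suc i)
    then have "(i, j) \<in> diagram \<kappa>" using diagram_upper[OF assms(1)] by force
    then have "T (i, j) < T (Suc i, j)" using T(1) Suc.prems by (auto simp: ssyt_def)
    then show ?case using Suc.IH \<open>(i, j) \<in> diagram \<kappa>\<close> by linarith
  qed simp
  have filt: "size (filter_mset (\<lambda>v. v < k) (image_mset g (mset_set (diagram \<tau>)))) =
      card {x \<in> diagram \<tau>. g x < k}" for g \<tau>
    by (simp add: filter_mset_image_mset filter_mset_mset_set)
  have "sum_list (take k \<rho>) = size (filter_mset (\<lambda>v. v < k) (top_content \<rho>))"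
    by (simp add: top_content_def filt card_diagram_rows)
  also have "\<dots> = card {x \<in> diagram \<kappa>. T x < k}"
    unfolding T(2)[symmetric] by (simp add: content_def filt)
  also have "\<dots> \<le> card {x \<in> diagram \<kappa>. fst x < k}"
    using row by (intro card_mono) (auto, force)
  also have "\<dots> = sum_list (take k \<kappa>)" by (rule card_diagram_rows)
  finally show ?thesis .
qed

lemma partition_eqI:
  assumes "is_partition \<kappa>" "is_partition \<rho>" "\<And>k. sum_list (take k \<kappa>) = sum_list (take k \<rho>)"
  shows "\<kappa> = \<rho>"
proof -
  have nth: "sum_list (take (Suc k) \<tau>) = sum_list (take k \<tau>) + (if k < length \<tau> then \<tau> ! k else 0)"
    for k and \<tau> :: "nat list"
    by (cases "k < length \<tau>") (simp_all add: take_Suc_conv_app_nth)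
  have eq: "(if k < length \<kappa> then \<kappa> ! k else 0) = (if k < length \<rho> then \<rho> ! k else 0)" for k
    using assms(3)[of "Suc k"] unfolding nth assms(3)[of k] by simp
  have "\<kappa> ! k \<noteq> 0" if "k < length \<kappa>" for k
    using assms(1) nth_mem[OF that] by (metis is_partition_def)
  moreover have "\<rho> ! k \<noteq> 0" if "k < length \<rho>" for k
    using assms(2) nth_mem[OF that] by (metis is_partition_def)
  ultimately have "k < length \<kappa> \<longleftrightarrow> k < length \<rho>" for k
    using eq[of k] by metis
  then have "length \<kappa> = length \<rho>"
    by (meson linorder_neqE_nat less_irrefl)
  then show ?thesis using eq by (intro nth_equalityI) metis+
qed

lemma schur_combination_eq_0:
  assumes "(\<Sum>\<kappa>\<in>partitions_of n. msmult (c \<kappa>) (schur \<kappa>)) = 0" "\<kappa> \<in> partitions_of n"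
  shows "c \<kappa> = 0"
proof (rule ccontr)
  assume "c \<kappa> \<noteq> 0"
  define S where "S = {\<kappa> \<in> partitions_of n. c \<kappa> \<noteq> 0}"
  define g where "g \<tau> = (\<Sum>k\<le>n. sum_list (take k \<tau>))" for \<tau> :: "nat list"
  have "finite S" "S \<noteq> {}" using assms(2) \<open>c \<kappa> \<noteq> 0\<close> by (auto simp: S_def)
  then obtain \<rho> where \<rho>: "\<rho> \<in> S" and max: "\<And>\<tau>. \<tau> \<in> S \<Longrightarrow> g \<tau> \<le> g \<rho>"
    using Max_in[of "g ` S"] Max_ge[of "g ` S"] by (metis (no_types, lifting) empty_is_image finite_imageI imageE imageI)
  have zero: "c \<tau> * mcoeff (schur \<tau>) (top_content \<rho>) = 0" if "\<tau> \<in> partitions_of n - {\<rho>}" for \<tau>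
  proof (rule ccontr)
    assume "c \<tau> * mcoeff (schur \<tau>) (top_content \<rho>) \<noteq> 0"
    then have \<tau>: "\<tau> \<in> S" and nz: "mcoeff (schur \<tau>) (top_content \<rho>) \<noteq> 0"
      using that by (auto simp: S_def)
    have P: "is_partition \<tau>" "is_partition \<rho>" "sum_list \<tau> = n" "sum_list \<rho> = n"
      using \<tau> \<rho> by (auto simp: S_def partitions_of_def)
    have le: "sum_list (take k \<rho>) \<le> sum_list (take k \<tau>)" for k
      using schur_dominance P(1) nz by blast
    have len: "length \<xi> \<le> sum_list \<xi>" if "is_partition \<xi>" for \<xi>
      using that by (induction \<xi>) (auto simp: is_partition_def)
    have "sum_list (take k \<tau>) = sum_list (take k \<rho>)" for k
    proof (cases "k \<le> n")
      case True
      have "g \<rho> = g \<tau>"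
        using max[OF \<tau>] le by (auto simp: g_def intro!: antisym sum_mono)
      then show ?thesis
        using sum_mono_inv[of "\<lambda>k. sum_list (take k \<rho>)" "{..n}" "\<lambda>k. sum_list (take k \<tau>)" k] le True
        by (simp add: g_def)
    next
      case False
      then show ?thesis using len[OF P(1)] len[OF P(2)] P(3,4) by simp
    qed
    then have "\<tau> = \<rho>" using partition_eqI P by blast
    then show False using that by simp
  qed
  have "0 = mcoeff (\<Sum>\<kappa>\<in>partitions_of n. msmult (c \<kappa>) (schur \<kappa>)) (top_content \<rho>)"
    using assms(1) by simp
  also have "\<dots> = (\<Sum>\<tau>\<in>partitions_of n. c \<tau> * mcoeff (schur \<tau>) (top_content \<rho>))" by simp
  also have "\<dots> = (\<Sum>\<tau>\<in>{\<rho>}. c \<tau> * mcoeff (schur \<tau>) (top_content \<rho>))"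
    using \<rho> zero by (intro sum.mono_neutral_right) (auto simp: S_def)
  finally show False using mcoeff_schur_top[of \<rho>] \<rho> by (simp add: S_def)
qed

lemma inj_on_schur: "inj_on schur (partitions_of n)"
proof (rule inj_onI, rule ccontr)
  fix \<kappa> \<rho> assume *: "\<kappa> \<in> partitions_of n" "\<rho> \<in> partitions_of n" "schur \<kappa> = schur \<rho>" "\<kappa> \<noteq> \<rho>"
  define c where "c \<tau> = (if \<tau> = \<kappa> then 1 else if \<tau> = \<rho> then -1 else 0 :: complex)" for \<tau>
  have "(\<Sum>\<tau>\<in>partitions_of n. msmult (c \<tau>) (schur \<tau>)) = (\<Sum>\<tau>\<in>{\<kappa>, \<rho>}. msmult (c \<tau>) (schur \<tau>))"
    using * by (intro sum.mono_neutral_right) (auto simp: c_def)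
  also have "\<dots> = 0" using * by (auto simp: c_def)
  finally have "c \<kappa> = 0" using schur_combination_eq_0 *(1) by blast
  then show False by (simp add: c_def)
qed

lemma independent_schur: "\<not> mser.dependent (schur ` partitions_of n)"
proof
  assume "mser.dependent (schur ` partitions_of n)"
  then obtain u v where u: "v \<in> schur ` partitions_of n" "u v \<noteq> 0"
      "(\<Sum>v\<in>schur ` partitions_of n. msmult (u v) v) = 0"
    by (auto simp: mser.dependent_finite)
  then have "(\<Sum>\<kappa>\<in>partitions_of n. msmult (u (schur \<kappa>)) (schur \<kappa>)) = 0"
    by (simp add: sum.reindex[OF inj_on_schur])
  then show False using u schur_combination_eq_0[of "\<lambda>\<kappa>. u (schur \<kappa>)" n] by auto
qed

text \<open>
  The bilinear extension of \<open>s\<^sub>\<kappa> \<times> s\<^sub>\<rho> = \<delta>\<^sub>\<kappa>\<^sub>\<rho> s\<^sub>\<kappa> / f\<^sup>\<kappa>\<close> from the Schur basis to \<open>\<Lambda>\<^sub>n\<close>;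
  \<open>mser.representation B F s\<close> is the coefficient of \<open>s\<close> in the expansion of \<open>F\<close> in the basis \<open>B\<close>.
\<close>

definition class_prod :: "nat \<Rightarrow> mser \<Rightarrow> mser \<Rightarrow> mser" where
  "class_prod n F G =
     (let c = mser.representation (schur ` partitions_of n)
      in \<Sum>\<kappa>\<in>partitions_of n.
           msmult (c F (schur \<kappa>) * c G (schur \<kappa>) / of_nat (num_syt \<kappa>)) (schur \<kappa>))"

lemma class_prod_schur:
  assumes "\<kappa> \<in> partitions_of n" "\<rho> \<in> partitions_of n"
  shows "class_prod n (schur \<kappa>) (schur \<rho>) =
    (if \<kappa> = \<rho> then msmult (1 / of_nat (num_syt \<kappa>)) (schur \<kappa>) else 0)"
proof -
  have rep: "mser.representation (schur ` partitions_of n) (schur \<tau>) (schur \<tau>') =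
      (if \<tau>' = \<tau> then 1 else 0)" if "\<tau> \<in> partitions_of n" "\<tau>' \<in> partitions_of n" for \<tau> \<tau>'
    using that inj_on_schur[of n]
    by (auto simp: mser.representation_basis[OF independent_schur] inj_on_eq_iff)
  have "class_prod n (schur \<kappa>) (schur \<rho>) = (\<Sum>\<tau>\<in>partitions_of n.
      if \<tau> = \<kappa> then (if \<kappa> = \<rho> then msmult (1 / of_nat (num_syt \<kappa>)) (schur \<kappa>) else 0) else 0)"
    unfolding class_prod_def Let_def using assms by (intro sum.cong) (auto simp: rep)
  then show ?thesis using assms by (simp add: sum.delta)
qed


section \<open>The degree completion\<close>

text \<open>
  An element of \<open>\<Prod>\<^sub>n \<Lambda>\<^sub>n\<close> is the sequence of its homogeneous components, written as the coefficients
  of a formal power series in an auxiliary variable that records the degree. The ordinary product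
  of the completion is thereby the Cauchy product, and \<open>F \<in> \<Lambda>\<^sub>k\<close> is embedded as
  \<open>fps_const F * fps_X ^ k\<close>.
\<close>

definition Lambda_hat :: "mser fps set" where
  "Lambda_hat = {F. \<forall>n. fps_nth F n \<in> Lambda n}"

definition class_prod_hat :: "mser fps \<Rightarrow> mser fps \<Rightarrow> mser fps" (infixl "\<otimes>\<^sub>c" 70) where
  "F \<otimes>\<^sub>c G = Abs_fps (\<lambda>n. class_prod n (fps_nth F n) (fps_nth G n))"

definition hat_smult :: "complex \<Rightarrow> mser fps \<Rightarrow> mser fps" where
  "hat_smult c F = Abs_fps (\<lambda>n. msmult c (fps_nth F n))"

interpretation hat: vector_space hat_smult
  by unfold_locales (auto simp: fps_eq_iff hat_smult_def mser.scale_right_distrib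
      mser.scale_left_distrib)

text \<open>Algebras are unital, so a subalgebra contains the unit element of \<open>(Lambda_hat, \<otimes>\<^sub>c)\<close>.\<close>

definition is_comm_subalgebra :: "mser fps set \<Rightarrow> bool" where
  "is_comm_subalgebra A \<longleftrightarrow>
     A \<subseteq> Lambda_hat \<and> hat.subspace A \<and>
     (\<exists>e\<in>A. \<forall>F\<in>Lambda_hat. e \<otimes>\<^sub>c F = F \<and> F \<otimes>\<^sub>c e = F) \<and>
     (\<forall>F\<in>A. \<forall>G\<in>A. F \<otimes>\<^sub>c G \<in> A) \<and>
     (\<forall>F\<in>A. \<forall>G\<in>A. F \<otimes>\<^sub>c G = G \<otimes>\<^sub>c F)"

text \<open>The product over \<open>i\<close> is the falling factorial \<open>(n)\<^sub>m\<close> with \<open>m = |\<mu>|\<close>.\<close>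

definition p_hat :: "nat list \<Rightarrow> mser fps" where
  "p_hat \<mu> = Abs_fps (\<lambda>n. if sum_list \<mu> \<le> n
     then of_nat (\<Prod>i<sum_list \<mu>. n - i) * psums \<mu> * psum 1 ^ (n - sum_list \<mu>) else 0)"

text \<open>This is \<open>p_hat \<mu> = m! p\<^sub>\<mu> / (1 - p\<^sub>1)\<^bsup>m+1\<^esup>\<close> in the ring \<open>\<Prod>\<^sub>n \<Lambda>\<^sub>n\<close>.\<close>

lemma p_hat_mult:
  fixes \<mu> :: "nat list"
  defines "m \<equiv> sum_list \<mu>"
  shows "p_hat \<mu> * (1 - fps_const (psum 1) * fps_X) ^ (m + 1) =
    of_nat (fact m) * (fps_const (psums \<mu>) * fps_X ^ m)"
proof -
  define a where "a = psum 1"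
  define c where "c = 1 - fps_const a * fps_X"
  define G where "G j = Abs_fps (\<lambda>k. of_nat ((j + k) choose j) * a ^ k)" for j
  have nth_c: "fps_nth (H * c) n = fps_nth H n - (if n = 0 then 0 else a * fps_nth H (n - 1))" for H n
  proof -
    have "H * c = H - fps_const a * (fps_X * H)"
      unfolding c_def right_diff_distrib by (simp only: mult_1_left mult_1_right mult.assoc mult.left_commute mult.commute)
    then show ?thesis by simp
  qed
  have G0: "G 0 * c = 1"
  proof (rule fps_ext)
    fix n show "fps_nth (G 0 * c) n = fps_nth 1 n"
      unfolding nth_c by (cases n) (simp_all add: G_def)
  qed
  have GS: "G (Suc j) * c = G j" for j
  proof (rule fps_ext)
    fix n show "fps_nth (G (Suc j) * c) n = fps_nth (G j) n"
    proof (cases n)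
      case (Suc k)
      have "Suc j + Suc k choose Suc j = (Suc j + k choose Suc j) + (j + Suc k choose j)"
        by simp
      then show ?thesis
        using Suc by (simp only: nth_c G_def fps_nth_Abs_fps of_nat_add) (simp add: distrib_right distrib_left mult.left_commute)
    qed (simp only: nth_c, simp add: G_def binomial_eq_0)
  qed
  have G: "G j * c ^ (j + 1) = 1" for j
  proof (induction j)
    case (Suc j)
    have "G (Suc j) * c ^ (Suc j + 1) = G (Suc j) * c * c ^ (j + 1)"
      by (simp add: mult.assoc)
    then show ?case using Suc by (simp only: GS)
  qed (simp add: G0)
  have ff: "(\<Prod>i<m. n - i) = fact m * (n choose m)" if "m \<le> n" for n :: nat
  proof -
    have "fact n = fact (n - m) * (\<Prod>i<m. n - i)"
      using that
    proof (induction m)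
      case (Suc m)
      then have "fact (n - m) = fact (n - Suc m) * (n - m)"
        by (metis Suc_diff_Suc Suc_le_lessD fact_Suc mult.commute of_nat_id)
      then show ?case using Suc by (simp add: mult_ac)
    qed simp
    then have "fact (n - m) * (\<Prod>i<m. n - i) = fact (n - m) * (fact m * (n choose m))"
      using binomial_fact_lemma[OF that] by (simp add: mult_ac)
    then show ?thesis by simp
  qed
  have "p_hat \<mu> = of_nat (fact m) * (fps_const (psums \<mu>) * fps_X ^ m) * G m"
  proof (rule fps_ext)
    fix n
    have "fps_nth (of_nat (fact m) * (fps_const (psums \<mu>) * fps_X ^ m) * G m) n
       = fps_nth (fps_const (of_nat (fact m) * psums \<mu>) * (fps_X ^ m * G m)) n"
      by (simp only: fps_of_nat[symmetric] fps_const_mult[symmetric] mult.assoc)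
    also have "\<dots> = (if n < m then 0 else of_nat (fact m) * psums \<mu> * (of_nat (n choose m) * a ^ (n - m)))"
      by (simp add: fps_X_power_mult_nth G_def)
    also have "\<dots> = fps_nth (p_hat \<mu>) n"
      by (simp add: p_hat_def m_def[symmetric] ff a_def mult.assoc mult.left_commute not_less)
    finally show "fps_nth (p_hat \<mu>) n =
        fps_nth (of_nat (fact m) * (fps_const (psums \<mu>) * fps_X ^ m) * G m) n" by simp
  qed
  then show ?thesis
    using G[of m] by (simp only: mult.assoc a_def[symmetric] c_def[symmetric] mult_1_right)
qed

definition p_hat_span :: "mser fps set" where
  "p_hat_span = hat.span (p_hat ` {\<mu>. is_partition \<mu>})"

end

theory Submission
  imports Defs "HOL-Library.Poly_Mapping" "HOL-Combinatorics.Permutations"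
begin

text \<open>
  The class product on \<open>\<Lambda>\<^sub>n\<close> is multiplication in the centre of the group algebra of \<open>S\<^sub>n\<close>, seen through the
  Frobenius map that sends a permutation to the power sum of its cycle type (\<open>frobenius_mult\<close>). Under
  this map the component of \<open>p_hat \<mu>\<close> in degree \<open>n\<close> is the image of a sum over all injections of the
  cells of \<open>\<mu>\<close> into \<open>{..<n}\<close>, where an injection contributes the permutation that rotates the image of
  each row (\<open>frobenius_cycle_sum\<close>). The number of injections is the falling factorial in \<open>p_hat\<close>.

  Two such sums are multiplied by looking at how the images of a pair of injections overlap. A pair of
  injections is a partial bijection \<open>\<pi>\<close> between the cells of \<open>\<mu>\<close> and those of \<open>\<nu>\<close>, together with an
  injection of the set that is obtained by gluing the two diagrams along \<open>\<pi>\<close>. The product of the two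
  permutations is the image of a permutation of the glued set that depends on \<open>\<pi>\<close> alone
  (\<open>injection_sum_mult\<close>). So the product is a sum over all \<open>\<pi>\<close> of sums over injections, and
  \<open>d\<^sup>\<kappa>\<^sub>\<mu>\<^sub>\<nu>\<close> is the number of those \<open>\<pi>\<close> whose glued permutation has cycle type \<open>\<kappa>\<close>. It is a nonnegative
  integer that is independent of \<open>n\<close>, and the bounds on \<open>|\<kappa>|\<close> are the bounds on the size of the glued set.

  The class product is defined by Schur functions, that is by semistandard tableaux, so the larger part
  of the proof identifies it with the product of the centre. Interlacing sequences satisfy a
  commutation relation (\<open>up_down_commute\<close>), which yields the Cauchy identity; together with Burnside's
  lemma it gives \<open>\<Sum>\<^sub>w p\<^sub>w(x) p\<^sub>w(y) = n! \<Sum>\<^sub>\<kappa> s\<^sub>\<kappa>(x) s\<^sub>\<kappa>(y)\<close> (\<open>cauchy_kernel\<close>). Hence the Schur functions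
  are a basis of \<open>\<Lambda>\<^sub>n\<close>, and the coefficients \<open>\<chi>\<^sup>\<kappa>(w)\<close> of \<open>p\<^sub>w\<close> in this basis are orthogonal class functions
  that span all class functions. What remains is that these characters are idempotents up to scalars.
  The sums of Young symmetrizers over all numberings of a diagram are central and have product zero for
  different shapes, and they are triangular with respect to the characters; by orthogonality they are
  proportional to the characters (\<open>young_proportional\<close>). The scalars are found from the expansion of the
  unit element, whose coefficients are the numbers \<open>f\<^sup>\<kappa>\<close> of standard tableaux.
\<close>

section \<open>Adding and removing horizontal strips\<close>

text \<open>
  Partitions appear here as weakly decreasing sequences of row lengths, padded with zeros, so that
  conditions on neighbouring rows need no case distinction at the end of the partition.
\<close>

definition partition_seqs :: "(nat \<Rightarrow> nat) set" where
  "partition_seqs = {f. antimono f \<and> (\<exists>n. \<forall>i\<ge>n. f i = 0)}"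

definition weight :: "(nat \<Rightarrow> nat) \<Rightarrow> nat" where
  "weight f = sum f {i. f i \<noteq> 0}"

text \<open>
  For partitions this says that the difference of the two diagrams is a horizontal strip.
\<close>

definition interlaces :: "(nat \<Rightarrow> nat) \<Rightarrow> (nat \<Rightarrow> nat) \<Rightarrow> bool" (infix "\<preceq>" 50) where
  "f \<preceq> g \<longleftrightarrow> (\<forall>i. f i \<le> g i \<and> g (Suc i) \<le> f i)"

lemma interlacesD: "f \<preceq> g \<Longrightarrow> f i \<le> g i" "f \<preceq> g \<Longrightarrow> g (Suc i) \<le> f i"
  by (simp_all add: interlaces_def)

lemma weight_eq:
  assumes "\<And>i. i \<ge> n \<Longrightarrow> f i = 0" shows "weight f = (\<Sum>i<n. f i)"
proof -
  have "{i. f i \<noteq> 0} \<subseteq> {..<n}" using assms by (metis (mono_tags) lessThan_iff linorder_not_le mem_Collect_eq subsetI)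
  then show ?thesis unfolding weight_def by (intro sum.mono_neutral_left) auto
qed

lemma partition_seqs_common_bound:
  assumes "f \<in> partition_seqs" "g \<in> partition_seqs"
  obtains n where "\<And>i. i \<ge> n \<Longrightarrow> f i = 0" "\<And>i. i \<ge> n \<Longrightarrow> g i = 0"
proof -
  obtain n m where "\<forall>i\<ge>n. f i = 0" "\<forall>i\<ge>m. g i = 0" using assms by (auto simp: partition_seqs_def)
  then show ?thesis by (intro that[of "max n m"]) auto
qed

lemma partition_seqs_above:
  assumes "f \<in> partition_seqs" "f \<preceq> h" shows "h \<in> partition_seqs"
proof -
  obtain n where n: "\<forall>i\<ge>n. f i = 0" using assms by (auto simp: partition_seqs_def)
  have "h i = 0" if i: "i \<ge> Suc n" for i
  proof -
    obtain j where j: "i = Suc j" "j \<ge> n" using i by (cases i) auto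
    have "h (Suc j) \<le> f j" using assms(2) by (simp add: interlaces_def)
    moreover have "f j = 0" using n j by simp
    ultimately show ?thesis using j by simp
  qed
  moreover have "h (Suc i) \<le> h i" for i
    using assms(2) unfolding interlaces_def by (meson order_trans)
  ultimately show ?thesis unfolding partition_seqs_def by (blast intro: decseq_SucI)
qed

lemma partition_seqs_below:
  assumes "h \<in> partition_seqs" "f \<preceq> h" shows "f \<in> partition_seqs"
proof -
  obtain n where n: "\<forall>i\<ge>n. h i = 0" using assms by (auto simp: partition_seqs_def)
  have "f i = 0" if "i \<ge> n" for i
    using that assms(2) n by (metis interlaces_def le_zero_eq)
  moreover have "f (Suc i) \<le> f i" for i
    using assms(2) unfolding interlaces_def by (meson order_trans)
  ultimately show ?thesis unfolding partition_seqs_def by (blast intro: decseq_SucI)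
qed

lemma weight_mono: "h \<in> partition_seqs \<Longrightarrow> f \<preceq> h \<Longrightarrow> weight f \<le> weight h"
proof -
  assume h: "h \<in> partition_seqs" "f \<preceq> h"
  then obtain n where n: "\<And>i. i \<ge> n \<Longrightarrow> f i = 0" "\<And>i. i \<ge> n \<Longrightarrow> h i = 0"
    using partition_seqs_common_bound partition_seqs_below by metis
  then show ?thesis using h by (simp add: weight_eq[of n] sum_mono interlaces_def)
qed

definition strips_above :: "(nat \<Rightarrow> nat) \<Rightarrow> nat \<Rightarrow> (nat \<Rightarrow> nat) set" where
  "strips_above f a = {h. f \<preceq> h \<and> weight h = weight f + a}"

definition strips_below :: "(nat \<Rightarrow> nat) \<Rightarrow> nat \<Rightarrow> (nat \<Rightarrow> nat) set" where
  "strips_below h b = {g. g \<preceq> h \<and> weight h = weight g + b}"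

lemma finite_partition_seqs_weight: "finite {f \<in> partition_seqs. weight f = n}"
proof (rule finite_subset)
  show "{f \<in> partition_seqs. weight f = n} \<subseteq>
    {f. \<forall>i. (i \<in> {..<n} \<longrightarrow> f i \<in> {..n}) \<and> (i \<notin> {..<n} \<longrightarrow> f i = 0)}"
  proof (intro subsetI CollectI allI conjI impI)
    fix f i assume "f \<in> {f \<in> partition_seqs. weight f = n}"
    then have f: "antimono f" "f \<in> partition_seqs" and n: "n = weight f" by (auto simp: partition_seqs_def)
    then obtain m where m: "\<And>i. i \<ge> m \<Longrightarrow> f i = 0" by (auto simp: partition_seqs_def)
    have w: "weight f = (\<Sum>i<m. f i)" by (rule weight_eq[OF m])
    show "f i \<in> {..n}"
    proof (cases "i < m")
      case True then show ?thesis unfolding n w by (simp add: member_le_sum)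
    qed (use m in simp)
    assume i: "i \<notin> {..<n}"
    show "f i = 0"
    proof (rule ccontr)
      assume nz: "f i \<noteq> 0"
      then have "i < m" using m[of i] by linarith
      have "1 \<le> f k" if "k \<le> i" for k
        using antimonoD[OF f(1) that] nz by linarith
      then have "(\<Sum>k\<le>i. 1) \<le> (\<Sum>k\<le>i. f k)" by (intro sum_mono) simp
      also have "\<dots> \<le> (\<Sum>k<m. f k)" using \<open>i < m\<close> by (intro sum_mono2) auto
      finally show False using i by (simp add: n w)
    qed
  qed
  show "finite {f. \<forall>i. (i \<in> {..<n} \<longrightarrow> f i \<in> {..n}) \<and> (i \<notin> {..<n} \<longrightarrow> f i = (0::nat))}"
    by (rule finite_set_of_finite_funs) auto
qed

lemma finite_strips_above: "f \<in> partition_seqs \<Longrightarrow> finite (strips_above f a)"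
  by (rule finite_subset[OF _ finite_partition_seqs_weight[of "weight f + a"]]) (auto simp: strips_above_def partition_seqs_above)

lemma finite_strips_below: "h \<in> partition_seqs \<Longrightarrow> finite (strips_below h a)"
  by (rule finite_subset[OF _ finite_partition_seqs_weight[of "weight h - a"]]) (auto simp: strips_below_def partition_seqs_below)

text \<open>
  An entry \<open>h (Suc j)\<close> of a sequence with \<open>f \<preceq> h\<close> and \<open>g \<preceq> h\<close>, and an entry \<open>e j\<close> of a sequence
  with \<open>e \<preceq> f\<close> and \<open>e \<preceq> g\<close>, are confined to one and the same interval, from
  \<open>max (f (Suc j)) (g (Suc j))\<close> to \<open>min (f j) (g j)\<close>. Reflecting each of these intervals turns the
  sequences \<open>e\<close> into the sequences \<open>h\<close>. The entry \<open>h 0\<close> alone has no upper bound; its excess \<open>k\<close> over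
  \<open>max (f 0) (g 0)\<close> is the additional parameter.
\<close>

definition reflect_up :: "(nat \<Rightarrow> nat) \<Rightarrow> (nat \<Rightarrow> nat) \<Rightarrow> nat \<Rightarrow> (nat \<Rightarrow> nat) \<Rightarrow> nat \<Rightarrow> nat" where
  "reflect_up f g k e i = (case i of 0 \<Rightarrow> max (f 0) (g 0) + k
     | Suc j \<Rightarrow> max (f (Suc j)) (g (Suc j)) + min (f j) (g j) - e j)"

definition reflect_down :: "(nat \<Rightarrow> nat) \<Rightarrow> (nat \<Rightarrow> nat) \<Rightarrow> (nat \<Rightarrow> nat) \<Rightarrow> nat \<Rightarrow> nat" where
  "reflect_down f g h j = max (f (Suc j)) (g (Suc j)) + min (f j) (g j) - h (Suc j)"

text \<open>
  The weights are controlled because the endpoints of the intervals add up to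
  \<open>max (f i) (g i) + min (f i) (g i) = f i + g i\<close>, summed over all rows.
\<close>

lemma weight_reflect:
  assumes "f \<in> partition_seqs" "g \<in> partition_seqs" "h \<in> partition_seqs" "e \<in> partition_seqs"
    and h0: "h 0 = max (f 0) (g 0) + k"
    and hs: "\<And>j. h (Suc j) + e j = max (f (Suc j)) (g (Suc j)) + min (f j) (g j)"
  shows "weight h + weight e = weight f + weight g + k"
proof -
  obtain n1 where n1: "\<And>i. i \<ge> n1 \<Longrightarrow> f i = 0" "\<And>i. i \<ge> n1 \<Longrightarrow> g i = 0"
    using partition_seqs_common_bound assms by metis
  obtain n2 where n2: "\<And>i. i \<ge> n2 \<Longrightarrow> h i = 0" "\<And>i. i \<ge> n2 \<Longrightarrow> e i = 0"
    using partition_seqs_common_bound assms by metis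
  define n where "n = max n1 n2"
  have w: "weight f = (\<Sum>i<Suc n. f i)" "weight g = (\<Sum>i<Suc n. g i)" "weight h = (\<Sum>i<Suc n. h i)" "weight e = (\<Sum>i<n. e i)"
    by (rule weight_eq; use n1 n2 in \<open>simp add: n_def\<close>)+
  have z: "f n = 0" "g n = 0" using n1 by (auto simp: n_def)
  have "weight h + weight e = h 0 + (\<Sum>i<n. h (Suc i) + e i)"
    unfolding w sum.lessThan_Suc_shift by (simp add: sum.distrib)
  also have "\<dots> = k + (\<Sum>i<Suc n. max (f i) (g i)) + (\<Sum>i<n. min (f i) (g i))"
    unfolding hs sum.lessThan_Suc_shift by (simp add: sum.distrib h0)
  also have "(\<Sum>i<n. min (f i) (g i)) = (\<Sum>i<Suc n. min (f i) (g i))" using z by simp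
  also have "k + (\<Sum>i<Suc n. max (f i) (g i)) + (\<Sum>i<Suc n. min (f i) (g i)) =
      k + (\<Sum>i<Suc n. max (f i) (g i) + min (f i) (g i))" by (simp add: sum.distrib)
  also have "(\<Sum>i<Suc n. max (f i) (g i) + min (f i) (g i)) = (\<Sum>i<Suc n. f i + g i)"
    by (intro sum.cong refl) (auto simp: max_def min_def)
  finally show ?thesis by (simp add: w sum.distrib)
qed

lemma reflect_up_props:
  assumes "f \<in> partition_seqs" "g \<in> partition_seqs" "e \<preceq> f" "e \<preceq> g"
  shows "f \<preceq> reflect_up f g k e" "g \<preceq> reflect_up f g k e"
    "weight (reflect_up f g k e) + weight e = weight f + weight g + k"
    "reflect_down f g (reflect_up f g k e) = e"
    "reflect_up f g k e 0 = max (f 0) (g 0) + k"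
proof -
  \<comment> \<open>the bounds that keep the truncated subtraction in \<open>reflect_up\<close> honest\<close>
  have e: "max (f (Suc j)) (g (Suc j)) \<le> e j" "e j \<le> min (f j) (g j)" for j
    using assms by (auto simp: interlaces_def)
  have *: "max (f i) (g i) \<le> reflect_up f g k e i" "reflect_up f g k e (Suc i) \<le> min (f i) (g i)" for i
    subgoal
    proof (cases i)
      case 0 then show ?thesis by (simp add: reflect_up_def)
    next
      case (Suc j) show ?thesis using e(2)[of j] unfolding Suc reflect_up_def nat.case by linarith
    qed
    subgoal using e[of i] unfolding reflect_up_def nat.case by linarith
    done
  show f: "f \<preceq> reflect_up f g k e" "g \<preceq> reflect_up f g k e" using * by (auto simp: interlaces_def)
  show "reflect_up f g k e 0 = max (f 0) (g 0) + k" by (simp add: reflect_up_def)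
  then show "weight (reflect_up f g k e) + weight e = weight f + weight g + k"
  proof (rule weight_reflect[OF assms(1,2) partition_seqs_above[OF assms(1) f(1)] partition_seqs_below[OF assms(1,3)]])
    fix j show "reflect_up f g k e (Suc j) + e j = max (f (Suc j)) (g (Suc j)) + min (f j) (g j)"
      using e[of j] unfolding reflect_up_def nat.case by linarith
  qed
  show "reflect_down f g (reflect_up f g k e) = e"
  proof
    fix j show "reflect_down f g (reflect_up f g k e) j = e j"
      using e[of j] unfolding reflect_up_def reflect_down_def nat.case by linarith
  qed
qed

lemma reflect_down_props:
  assumes "f \<in> partition_seqs" "g \<in> partition_seqs" "f \<preceq> h" "g \<preceq> h"
  shows "reflect_down f g h \<preceq> f" "reflect_down f g h \<preceq> g"
    "reflect_up f g (h 0 - max (f 0) (g 0)) (reflect_down f g h) = h"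
proof -
  have h: "max (f j) (g j) \<le> h j" "h (Suc j) \<le> min (f j) (g j)" for j
    using assms by (auto simp: interlaces_def)
  have *: "max (f (Suc j)) (g (Suc j)) \<le> reflect_down f g h j" "reflect_down f g h j \<le> min (f j) (g j)" for j
    using h[of "Suc j"] h(2)[of j] by (auto simp: reflect_down_def)
  then show "reflect_down f g h \<preceq> f" "reflect_down f g h \<preceq> g" by (auto simp: interlaces_def)
  show "reflect_up f g (h 0 - max (f 0) (g 0)) (reflect_down f g h) = h"
  proof
    fix i show "reflect_up f g (h 0 - max (f 0) (g 0)) (reflect_down f g h) i = h i"
    proof (cases i)
      case 0 then show ?thesis using h(1)[of 0] by (simp add: reflect_up_def)
    next
      case (Suc j) then show ?thesis
        using h(1)[of "Suc j"] h(2)[of j] unfolding Suc reflect_up_def reflect_down_def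
        by (simp only: nat.case)
    qed
  qed
qed

text \<open>
  The commutation relation between adding and removing horizontal strips: removing a strip of
  size \<open>b\<close> after adding one of size \<open>a\<close> amounts to first removing \<open>b - k\<close> and then adding \<open>a - k\<close>
  boxes, for all \<open>k\<close>. It is the local form of the Robinson-Schensted-Knuth correspondence, with the
  reflection of intervals as the bijection.
\<close>

lemma up_down_commute:
  fixes F :: "(nat \<Rightarrow> nat) \<Rightarrow> nat"
  assumes f: "f \<in> partition_seqs"
  shows "(\<Sum>h\<in>strips_above f a. \<Sum>g\<in>strips_below h b. F g) =
    (\<Sum>k\<le>min a b. \<Sum>e\<in>strips_below f (b - k). \<Sum>g\<in>strips_above e (a - k). F g)"
proof -
  let ?L = "SIGMA h:strips_above f a. strips_below h b"
  let ?R = "SIGMA k:{..min a b}. SIGMA e:strips_below f (b - k). strips_above e (a - k)"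
  have fin_b: "finite (strips_below f c)" for c by (rule finite_strips_below[OF f])
  have fin_a: "finite (strips_above e c)" if "e \<in> strips_below f d" for c d e
    using that by (intro finite_strips_above) (auto simp: strips_below_def intro: partition_seqs_below[OF f])
  have fin: "finite (SIGMA e:strips_below f (b - k). strips_above e (a - k))" for k
    using fin_b fin_a by (intro finite_SigmaI)
  have "(\<Sum>h\<in>strips_above f a. \<Sum>g\<in>strips_below h b. F g) = (\<Sum>(h, g)\<in>?L. F g)"
    using finite_strips_above[OF f, of a] finite_strips_below partition_seqs_above[OF f]
    by (subst sum.Sigma) (auto simp: strips_above_def)
  also have "\<dots> = (\<Sum>(k, e, g)\<in>?R. F g)"
  proof (rule sum.reindex_bij_witness[of _ "\<lambda>(k, e, g). (reflect_up f g k e, g)"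
        "\<lambda>(h, g). (h 0 - max (f 0) (g 0), reflect_down f g h, g)"])
    fix x assume "x \<in> ?L"
    then obtain h g where x: "x = (h, g)" and hg: "f \<preceq> h" "g \<preceq> h" "weight h = weight f + a" "weight h = weight g + b"
      by (auto simp: strips_above_def strips_below_def)
    have g: "g \<in> partition_seqs" using partition_seqs_below partition_seqs_above f hg by blast
    note d = reflect_down_props[OF f g hg(1,2)]
    show "(case case x of (h, g) \<Rightarrow> (h 0 - max (f 0) (g 0), reflect_down f g h, g) of
          (k, e, g) \<Rightarrow> (reflect_up f g k e, g)) = x" by (simp add: x d)
    have "weight h + weight (reflect_down f g h) = weight f + weight g + (h 0 - max (f 0) (g 0))"
      using reflect_up_props(3)[OF f g d(1,2), of "h 0 - max (f 0) (g 0)"] by (simp add: d(3))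
    then show "(case x of (h, g) \<Rightarrow> (h 0 - max (f 0) (g 0), reflect_down f g h, g)) \<in> ?R"
      using d hg weight_mono[OF f d(1)] weight_mono[OF g d(2)]
      by (auto simp: x strips_above_def strips_below_def)
    show "(case case x of (h, g) \<Rightarrow> (h 0 - max (f 0) (g 0), reflect_down f g h, g) of
          (k, e, g) \<Rightarrow> F g) = (case x of (h, g) \<Rightarrow> F g)" by (simp add: x)
  next
    fix y assume "y \<in> ?R"
    then obtain k e g where y: "y = (k, e, g)" and k: "k \<le> a" "k \<le> b"
      and e: "e \<preceq> f" "e \<preceq> g" "weight f = weight e + (b - k)" "weight g = weight e + (a - k)"
      by (auto simp: strips_above_def strips_below_def)
    have g: "g \<in> partition_seqs" using partition_seqs_below partition_seqs_above f e by blast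
    note u = reflect_up_props[OF f g e(1,2), of k]
    show "(case case y of (k, e, g) \<Rightarrow> (reflect_up f g k e, g) of
          (h, g) \<Rightarrow> (h 0 - max (f 0) (g 0), reflect_down f g h, g)) = y" by (simp add: y u)
    show "(case y of (k, e, g) \<Rightarrow> (reflect_up f g k e, g)) \<in> ?L"
      using u(1-3) e k by (auto simp: y strips_above_def strips_below_def)
  qed
  also have "\<dots> = (\<Sum>k\<le>min a b. \<Sum>(e, g)\<in>(SIGMA e:strips_below f (b - k). strips_above e (a - k)). F g)"
    using fin by (subst sum.Sigma) auto
  also have "\<dots> = (\<Sum>k\<le>min a b. \<Sum>e\<in>strips_below f (b - k). \<Sum>g\<in>strips_above e (a - k). F g)"
    using fin_b fin_a by (intro sum.cong refl, subst sum.Sigma) auto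
  finally show ?thesis .
qed

section \<open>Kostka numbers and the Cauchy identity\<close>

definition row_length :: "nat list \<Rightarrow> nat \<Rightarrow> nat" where
  "row_length \<kappa> i = (if i < length \<kappa> then \<kappa> ! i else 0)"

lemma mem_diagram_iff: "(i, j) \<in> diagram \<kappa> \<longleftrightarrow> j < row_length \<kappa> i"
  by (auto simp: diagram_def row_length_def)

lemma row_length_in_partition_seqs: "is_partition \<kappa> \<Longrightarrow> row_length \<kappa> \<in> partition_seqs"
  unfolding partition_seqs_def row_length_def is_partition_def sorted_wrt_iff_nth_less
  by (auto intro!: decseq_SucI exI[of _ "length \<kappa>"])

lemma weight_row_length: "weight (row_length \<kappa>) = sum_list \<kappa>"
proof -
  have "weight (row_length \<kappa>) = (\<Sum>i<length \<kappa>. row_length \<kappa> i)" by (rule weight_eq) (simp add: row_length_def)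
  also have "\<dots> = sum_list \<kappa>" by (simp add: row_length_def sum_list_sum_nth atLeast0LessThan)
  finally show ?thesis .
qed

lemma card_diagram: "card (diagram \<kappa>) = sum_list \<kappa>"
proof -
  have "{x \<in> diagram \<kappa>. fst x < length \<kappa>} = diagram \<kappa>" by (auto simp: diagram_def)
  then show ?thesis using card_diagram_rows[of \<kappa> "length \<kappa>"] by simp
qed

lemma row_length_inj:
  assumes "is_partition \<kappa>" "is_partition \<rho>" "row_length \<kappa> = row_length \<rho>" shows "\<kappa> = \<rho>"
proof (rule partition_eqI[OF assms(1,2)])
  fix k
  have "sum_list (take k \<tau>) = (\<Sum>i<k. row_length \<tau> i)" for \<tau>
    by (induction k) (auto simp: row_length_def take_Suc_conv_app_nth)
  then show "sum_list (take k \<kappa>) = sum_list (take k \<rho>)" using assms(3) by simp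
qed

lemma row_length_surj:
  assumes "f \<in> partition_seqs" obtains \<kappa> where "is_partition \<kappa>" "row_length \<kappa> = f"
proof
  define n where "n = (LEAST n. f n = 0)"
  obtain m where "\<forall>i\<ge>m. f i = 0" and anti: "antimono f" using assms by (auto simp: partition_seqs_def)
  then have "f m = 0" by simp
  then have z: "f n = 0" unfolding n_def by (rule LeastI)
  then have zz: "f i = 0" if "i \<ge> n" for i using antimonoD[OF anti that] by simp
  have nz: "f i \<noteq> 0" if "i < n" for i using not_less_Least[of i "\<lambda>n. f n = 0"] that by (simp add: n_def)
  have "0 \<notin> set (map f [0..<n])" using nz by fastforce
  moreover have "sorted_wrt (\<ge>) (map f [0..<n])"
    using antimonoD[OF anti] by (auto simp: sorted_wrt_iff_nth_less)
  ultimately show "is_partition (map f [0..<n])" by (simp add: is_partition_def)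
  show "row_length (map f [0..<n]) = f" using zz by (auto simp: row_length_def)
qed

definition list_of_seq :: "(nat \<Rightarrow> nat) \<Rightarrow> nat list" where
  "list_of_seq = inv_into {\<kappa>. is_partition \<kappa>} row_length"

lemma list_of_seq_row_length [simp]: "is_partition \<kappa> \<Longrightarrow> list_of_seq (row_length \<kappa>) = \<kappa>"
  unfolding list_of_seq_def by (intro inv_into_f_f) (auto intro: inj_onI row_length_inj)

lemma is_partition_list_of_seq: "f \<in> partition_seqs \<Longrightarrow> is_partition (list_of_seq f)"
  by (metis list_of_seq_row_length row_length_surj)

lemma row_length_list_of_seq: "f \<in> partition_seqs \<Longrightarrow> row_length (list_of_seq f) = f"
  by (metis list_of_seq_row_length row_length_surj)

lemma sum_partition_seqs_eq_sum_partitions: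
  "(\<Sum>f | f \<in> partition_seqs \<and> weight f = n. F (list_of_seq f)) = (\<Sum>\<kappa>\<in>partitions_of n. F \<kappa>)"
  by (rule sum.reindex_bij_witness[of _ row_length list_of_seq])
    (auto simp: partitions_of_def row_length_in_partition_seqs weight_row_length is_partition_list_of_seq row_length_list_of_seq simp flip: weight_row_length)

definition kostka :: "nat list \<Rightarrow> nat multiset \<Rightarrow> nat" where
  "kostka \<kappa> M = card {T \<in> ssyt \<kappa>. content \<kappa> T = M}"

lemma filter_less_add_replicate:
  fixes M :: "nat multiset"
  assumes "\<And>x. x \<in># M \<Longrightarrow> x < r"
  shows "filter_mset (\<lambda>v. v < r) (M + replicate_mset a r) = M"
proof (rule multiset_eqI)
  fix x show "count (filter_mset (\<lambda>v. v < r) (M + replicate_mset a r)) x = count M x"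
  proof (cases "x < r")
    case False
    then have "x \<notin># M" using assms by blast
    then show ?thesis using False by (simp add: not_in_iff)
  qed simp
qed

lemma diagram_inj: "is_partition \<kappa> \<Longrightarrow> is_partition \<rho> \<Longrightarrow> diagram \<kappa> = diagram \<rho> \<Longrightarrow> \<kappa> = \<rho>"
proof (rule row_length_inj)
  assume "diagram \<kappa> = diagram \<rho>"
  then have "j < row_length \<kappa> i \<longleftrightarrow> j < row_length \<rho> i" for i j using mem_diagram_iff by metis
  then show "row_length \<kappa> = row_length \<rho>" by (meson ext linorder_neqE_nat nat_less_le)
qed

text \<open>
  Since rows increase weakly, the entries below \<open>r\<close> form a subdiagram; since columns increase
  strictly, the remaining cells, which all hold \<open>r\<close>, contain no two cells of one column.
\<close>

lemma ssyt_less_shape: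
  assumes \<kappa>: "is_partition \<kappa>" and T: "T \<in> ssyt \<kappa>" and le: "\<And>x. x \<in> diagram \<kappa> \<Longrightarrow> T x \<le> r"
  obtains \<mu> where "is_partition \<mu>" "row_length \<mu> \<preceq> row_length \<kappa>" "{x \<in> diagram \<kappa>. T x < r} = diagram \<mu>"
proof -
  have row: "T (i, j) \<le> T (i, j')" if "j \<le> j'" "j' < row_length \<kappa> i" for i j j'
    using T that by (cases "j = j'") (auto simp: ssyt_def mem_diagram_iff)
  have col: "T (i, j) < T (Suc i, j)" if "j < row_length \<kappa> (Suc i)" for i j
  proof -
    have "(Suc i, j) \<in> diagram \<kappa>" using that by (simp add: mem_diagram_iff)
    moreover from this have "(i, j) \<in> diagram \<kappa>" by (rule diagram_upper[OF \<kappa>]) simp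
    ultimately show ?thesis using T by (auto simp: ssyt_def)
  qed
  have anti: "row_length \<kappa> (Suc i) \<le> row_length \<kappa> i" for i
    using row_length_in_partition_seqs[OF \<kappa>] by (auto simp: partition_seqs_def antimono_def)
  define f where "f i = card {j. j < row_length \<kappa> i \<and> T (i, j) < r}" for i
  have seg: "{j. j < row_length \<kappa> i \<and> T (i, j) < r} = {..<f i}" for i
  proof -
    let ?S = "{j. j < row_length \<kappa> i \<and> T (i, j) < r}"
    have down: "j \<in> ?S" if "j' \<in> ?S" "j \<le> j'" for j j'
      using that row[of j j' i] by auto
    show ?thesis
    proof (cases "?S = {}")
      case True then show ?thesis by (simp only: f_def card.empty lessThan_0)
    next
      case False
      have "finite ?S" by simp
      have "?S = {..Max ?S}"
      proof
        show "?S \<subseteq> {..Max ?S}" using Max_ge[OF \<open>finite ?S\<close>] by blast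
        show "{..Max ?S} \<subseteq> ?S" using down[OF Max_in[OF \<open>finite ?S\<close> False]] by blast
      qed
      moreover from this have "f i = Suc (Max ?S)" unfolding f_def by (metis card_atMost)
      ultimately show ?thesis by (simp add: lessThan_Suc_atMost)
    qed
  qed
  have mem: "j < f i \<longleftrightarrow> j < row_length \<kappa> i \<and> T (i, j) < r" for i j
    using seg[of i] by blast
  have "f \<preceq> row_length \<kappa>"
    unfolding interlaces_def
  proof (intro allI conjI)
    fix i
    show "f i \<le> row_length \<kappa> i" using mem by (meson leI less_le_not_le)
    show "row_length \<kappa> (Suc i) \<le> f i"
    proof (rule ccontr)
      assume "\<not> ?thesis"
      then have "f i < row_length \<kappa> (Suc i)" by simp
      moreover from this have "T (i, f i) < r"
        using col[of "f i" i] le[of "(Suc i, f i)"] by (auto simp: mem_diagram_iff)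
      ultimately show False using mem[of "f i" i] anti[of i] by auto
    qed
  qed
  moreover from this have "f \<in> partition_seqs" using partition_seqs_below row_length_in_partition_seqs[OF \<kappa>] by blast
  then obtain \<mu> where \<mu>: "is_partition \<mu>" "row_length \<mu> = f" using row_length_surj by blast
  moreover have "{x \<in> diagram \<kappa>. T x < r} = diagram \<mu>"
    using mem by (auto simp: mem_diagram_iff \<mu>)
  ultimately show ?thesis using that by metis
qed

text \<open>
  A tableau is determined by its entries below the largest letter \<open>r\<close>, because every other cell
  holds \<open>r\<close>; conversely a horizontal strip filled with \<open>r\<close> may be added to any tableau.
\<close>

lemma card_ssyt_with_shape:
  assumes \<kappa>: "is_partition \<kappa>" and \<mu>: "is_partition \<mu>" "row_length \<mu> \<preceq> row_length \<kappa>" "sum_list \<kappa> = sum_list \<mu> + a"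
    and M: "\<And>x. x \<in># M \<Longrightarrow> x < r"
  shows "card {T \<in> ssyt \<kappa>. content \<kappa> T = M + replicate_mset a r \<and> {x \<in> diagram \<kappa>. T x < r} = diagram \<mu>}
     = kostka \<mu> M"
  unfolding kostka_def
proof (rule bij_betw_same_card[of "\<lambda>T. restrict T (diagram \<mu>)"],
    rule bij_betw_byWitness[where f' = "\<lambda>U x. if x \<in> diagram \<mu> then U x else if x \<in> diagram \<kappa> then r else undefined"])
  let ?S = "{T \<in> ssyt \<kappa>. content \<kappa> T = M + replicate_mset a r \<and> {x \<in> diagram \<kappa>. T x < r} = diagram \<mu>}"
  let ?U = "{T \<in> ssyt \<mu>. content \<mu> T = M}"
  let ?ext = "\<lambda>U x. if x \<in> diagram \<mu> then U x else if x \<in> diagram \<kappa> then r else undefined"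
  have sub: "diagram \<mu> \<subseteq> diagram \<kappa>"
    using interlacesD(1)[OF \<mu>(2)] by (auto simp: mem_diagram_iff) (meson less_le_trans)
  have fin: "finite (diagram \<tau>)" for \<tau> by simp
  have split: "mset_set (diagram \<kappa>) = mset_set (diagram \<mu>) + mset_set (diagram \<kappa> - diagram \<mu>)"
    using sub fin by (metis Diff_partition finite_Diff Diff_disjoint mset_set_Union)
  have filt: "filter_mset (\<lambda>v. v < r) (M + replicate_mset a r) = M"
    by (rule filter_less_add_replicate[OF M])
  have content_restrict: "content \<mu> (restrict T (diagram \<mu>)) = filter_mset (\<lambda>v. v < r) (content \<kappa> T)"
    if "{x \<in> diagram \<kappa>. T x < r} = diagram \<mu>" for T
  proof -
    have "filter_mset (\<lambda>v. v < r) (content \<kappa> T) = image_mset T (mset_set {x \<in> diagram \<kappa>. T x < r})"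
      by (simp add: content_def filter_mset_image_mset filter_mset_mset_set)
    then show ?thesis unfolding that content_def by (auto intro!: image_mset_cong)
  qed
  show "\<forall>T\<in>?S. ?ext (restrict T (diagram \<mu>)) = T"
  proof
    fix T assume T: "T \<in> ?S"
    have "T x = r" if "x \<in> diagram \<kappa>" "x \<notin> diagram \<mu>" for x
    proof -
      have "T x \<in># content \<kappa> T" using that fin by (simp add: content_def)
      then have "T x \<le> r" using T M by (auto intro: less_imp_le split: if_splits)
      then show ?thesis using T that by force
    qed
    then show "?ext (restrict T (diagram \<mu>)) = T"
      using T by (auto simp: fun_eq_iff ssyt_def extensional_def)
  qed
  show "\<forall>U\<in>?U. restrict (?ext U) (diagram \<mu>) = U"
    by (auto simp: fun_eq_iff ssyt_def extensional_def)
  show "(\<lambda>T. restrict T (diagram \<mu>)) ` ?S \<subseteq> ?U"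
  proof (intro image_subsetI CollectI conjI)
    fix T assume T: "T \<in> ?S"
    then have "\<forall>i j j'. (i, j) \<in> diagram \<kappa> \<and> (i, j') \<in> diagram \<kappa> \<and> j < j' \<longrightarrow> T (i, j) \<le> T (i, j')"
      and "\<forall>i i' j. (i, j) \<in> diagram \<kappa> \<and> (i', j) \<in> diagram \<kappa> \<and> i < i' \<longrightarrow> T (i, j) < T (i', j)"
      by (simp_all add: ssyt_def)
    then show "restrict T (diagram \<mu>) \<in> ssyt \<mu>"
      using subsetD[OF sub] unfolding ssyt_def by simp
    show "content \<mu> (restrict T (diagram \<mu>)) = M"
      using T content_restrict[of T] filt by simp
  qed
  show "?ext ` ?U \<subseteq> ?S"
  proof (intro image_subsetI CollectI conjI)
    fix U assume U: "U \<in> ?U"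
    have Ur: "U x < r" if "x \<in> diagram \<mu>" for x
    proof -
      have "U x \<in># content \<mu> U" using that fin by (simp add: content_def)
      then show ?thesis using U M by auto
    qed
    have "image_mset (?ext U) (mset_set (diagram \<mu>)) = content \<mu> U"
      unfolding content_def by (auto intro!: image_mset_cong)
    moreover have "image_mset (?ext U) (mset_set (diagram \<kappa> - diagram \<mu>)) =
        image_mset (\<lambda>_. r) (mset_set (diagram \<kappa> - diagram \<mu>))"
      by (intro image_mset_cong) auto
    moreover have "card (diagram \<kappa> - diagram \<mu>) = a"
      using sub fin \<mu>(3) by (simp add: card_Diff_subset card_diagram)
    ultimately show "content \<kappa> (?ext U) = M + replicate_mset a r"
      using U by (simp add: content_def[of \<kappa>] split image_mset_const_eq)
    show "{x \<in> diagram \<kappa>. ?ext U x < r} = diagram \<mu>"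
      using Ur sub by auto
    have up: "(i, j) \<in> diagram \<mu>" if "(i', j) \<in> diagram \<kappa>" "i < i'" for i i' j
    proof -
      have "(Suc i, j) \<in> diagram \<kappa>" using that(2) by (intro diagram_upper[OF \<kappa> that(1)]) simp
      then show ?thesis using interlacesD(2)[OF \<mu>(2), of i] by (simp add: mem_diagram_iff)
    qed
    have left: "(i, j) \<in> diagram \<mu>" if "(i, j') \<in> diagram \<mu>" "j < j'" for i j j'
      using that by (auto simp: mem_diagram_iff)
    have row: "\<forall>i j j'. (i, j) \<in> diagram \<mu> \<and> (i, j') \<in> diagram \<mu> \<and> j < j' \<longrightarrow> U (i, j) \<le> U (i, j')"
     and col: "\<forall>i i' j. (i, j) \<in> diagram \<mu> \<and> (i', j) \<in> diagram \<mu> \<and> i < i' \<longrightarrow> U (i, j) < U (i', j)"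
      using U by (simp_all add: ssyt_def)
    show "?ext U \<in> ssyt \<kappa>"
      unfolding ssyt_def
    proof (intro CollectI conjI allI impI)
      show "?ext U \<in> extensional (diagram \<kappa>)" using sub by (auto simp: extensional_def)
    next
      fix i j j' assume *: "(i, j) \<in> diagram \<kappa> \<and> (i, j') \<in> diagram \<kappa> \<and> j < j'"
      show "?ext U (i, j) \<le> ?ext U (i, j')"
        using * row left[of i j' j] Ur[of "(i, j)"] by (cases "(i, j') \<in> diagram \<mu>") (auto intro: less_imp_le)
    next
      fix i i' j assume *: "(i, j) \<in> diagram \<kappa> \<and> (i', j) \<in> diagram \<kappa> \<and> i < i'"
      then have "(i, j) \<in> diagram \<mu>" using up by blast
      then show "?ext U (i, j) < ?ext U (i', j)"
        using * col Ur[of "(i, j)"] by (cases "(i', j) \<in> diagram \<mu>") auto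
    qed
  qed
qed

lemma kostka_rec:
  assumes \<kappa>: "is_partition \<kappa>" and M: "\<And>x. x \<in># M \<Longrightarrow> x < r"
  shows "kostka \<kappa> (M + replicate_mset a r) =
    (\<Sum>\<mu> | is_partition \<mu> \<and> row_length \<mu> \<preceq> row_length \<kappa> \<and> sum_list \<kappa> = sum_list \<mu> + a. kostka \<mu> M)"
proof -
  let ?I = "{\<mu>. is_partition \<mu> \<and> row_length \<mu> \<preceq> row_length \<kappa> \<and> sum_list \<kappa> = sum_list \<mu> + a}"
  let ?S = "\<lambda>\<mu>. {T \<in> ssyt \<kappa>. content \<kappa> T = M + replicate_mset a r \<and> {x \<in> diagram \<kappa>. T x < r} = diagram \<mu>}"
  have "{T \<in> ssyt \<kappa>. content \<kappa> T = M + replicate_mset a r} = (\<Union>\<mu>\<in>?I. ?S \<mu>)"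
  proof
    show "{T \<in> ssyt \<kappa>. content \<kappa> T = M + replicate_mset a r} \<subseteq> (\<Union>\<mu>\<in>?I. ?S \<mu>)"
    proof
      fix T assume "T \<in> {T \<in> ssyt \<kappa>. content \<kappa> T = M + replicate_mset a r}"
      then have T: "T \<in> ssyt \<kappa>" "content \<kappa> T = M + replicate_mset a r" by auto
      have "T x \<le> r" if "x \<in> diagram \<kappa>" for x
      proof -
        have "T x \<in># content \<kappa> T" using that by (simp add: content_def)
        then show ?thesis using T(2) M by (auto intro: less_imp_le split: if_splits)
      qed
      then obtain \<mu> where \<mu>: "is_partition \<mu>" "row_length \<mu> \<preceq> row_length \<kappa>" "{x \<in> diagram \<kappa>. T x < r} = diagram \<mu>"
        using ssyt_less_shape[OF \<kappa> T(1)] by metis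
      have "sum_list \<mu> = size (filter_mset (\<lambda>v. v < r) (content \<kappa> T))"
        by (simp add: content_def filter_mset_image_mset filter_mset_mset_set \<mu>(3) card_diagram)
      also have "filter_mset (\<lambda>v. v < r) (content \<kappa> T) = M"
        unfolding T(2) by (rule filter_less_add_replicate[OF M])
      finally have "sum_list \<mu> = size M" .
      moreover have "sum_list \<kappa> = size (content \<kappa> T)" by (simp add: content_def card_diagram)
      ultimately have "sum_list \<kappa> = sum_list \<mu> + a" unfolding T(2) by simp
      then show "T \<in> (\<Union>\<mu>\<in>?I. ?S \<mu>)" using \<mu> T by blast
    qed
  qed blast
  then have "kostka \<kappa> (M + replicate_mset a r) = card (\<Union>\<mu>\<in>?I. ?S \<mu>)"
    by (simp add: kostka_def)
  also have "\<dots> = (\<Sum>\<mu>\<in>?I. card (?S \<mu>))"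
  proof (rule card_UN_disjoint)
    show "finite ?I"
      by (rule finite_subset[OF _ finite_partitions_of[of "sum_list \<kappa> - a"]]) (auto simp: partitions_of_def)
    show "\<forall>\<mu>\<in>?I. finite (?S \<mu>)"
      by (intro ballI finite_subset[OF _ finite_ssyt_content[of \<kappa> "M + replicate_mset a r"]]) auto
    show "\<forall>\<mu>\<in>?I. \<forall>\<nu>\<in>?I. \<mu> \<noteq> \<nu> \<longrightarrow> ?S \<mu> \<inter> ?S \<nu> = {}"
      using diagram_inj by blast
  qed
  also have "\<dots> = (\<Sum>\<mu>\<in>?I. kostka \<mu> M)"
    by (intro sum.cong refl card_ssyt_with_shape \<kappa> M) auto
  finally show ?thesis .
qed

lemma kostka_empty: "is_partition \<kappa> \<Longrightarrow> kostka \<kappa> {#} = (if \<kappa> = [] then 1 else 0)"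
proof (cases "\<kappa> = []")
  case True
  have "{T \<in> ssyt []. content [] T = {#}} = {\<lambda>_. undefined}"
    by (auto simp: ssyt_def content_def diagram_def)
  then show ?thesis using True by (simp add: kostka_def)
next
  case False
  assume "is_partition \<kappa>"
  then have "sum_list \<kappa> \<noteq> 0" using False by (cases \<kappa>) (auto simp: is_partition_def)
  then have "{T \<in> ssyt \<kappa>. content \<kappa> T = {#}} = {}"
    by (auto simp: content_def mset_set_empty_iff card_diagram[symmetric])
  then have "kostka \<kappa> {#} = card ({} :: (nat \<times> nat \<Rightarrow> nat) set)" unfolding kostka_def by (rule arg_cong)
  then show ?thesis using False by simp
qed

definition kostka_seq :: "(nat \<Rightarrow> nat) \<Rightarrow> nat multiset \<Rightarrow> nat" where "kostka_seq f = kostka (list_of_seq f)"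

lemma kostka_seq_rec:
  assumes f: "f \<in> partition_seqs" and M: "\<And>x. x \<in># M \<Longrightarrow> x < r"
  shows "kostka_seq f (M + replicate_mset a r) = (\<Sum>g\<in>strips_below f a. kostka_seq g M)"
proof -
  have "kostka_seq f (M + replicate_mset a r) =
    (\<Sum>\<mu> | is_partition \<mu> \<and> row_length \<mu> \<preceq> f \<and> weight f = sum_list \<mu> + a. kostka \<mu> M)"
    unfolding kostka_seq_def using kostka_rec[OF is_partition_list_of_seq[OF f] M, where a = a]
    by (simp add: row_length_list_of_seq f flip: weight_row_length)
  also have "\<dots> = (\<Sum>g\<in>strips_below f a. kostka_seq g M)"
    by (rule sum.reindex_bij_witness[of _ list_of_seq row_length])
      (auto simp: strips_below_def kostka_seq_def weight_row_length is_partition_list_of_seq row_length_list_of_seq partition_seqs_below[OF f] simp flip: weight_row_length)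
  finally show ?thesis .
qed

lemma zero_in_partition_seqs: "(\<lambda>_. 0) \<in> partition_seqs" by (auto simp: partition_seqs_def antimono_def)

lemma kostka_seq_empty: assumes "f \<in> partition_seqs" shows "kostka_seq f {#} = (if f = (\<lambda>_. 0) then 1 else 0)"
proof -
  have e: "row_length [] = (\<lambda>_. 0)" "is_partition []" by (auto simp: row_length_def is_partition_def)
  have "list_of_seq f = [] \<longleftrightarrow> f = (\<lambda>_. 0)" using assms e by (metis list_of_seq_row_length row_length_list_of_seq)
  then show ?thesis unfolding kostka_seq_def using kostka_empty[OF is_partition_list_of_seq[OF assms]] by simp
qed

lemma split_top_letter:
  fixes N :: "nat multiset"
  assumes "\<And>x. x \<in># N \<Longrightarrow> x < Suc s"
  obtains N' b where "N = N' + replicate_mset b s" "\<And>x. x \<in># N' \<Longrightarrow> x < s"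
proof
  show "N = filter_mset (\<lambda>x. x < s) N + replicate_mset (count N s) s"
  proof (rule multiset_eqI)
    fix x
    have "count N x = 0" if "\<not> x < s" "x \<noteq> s"
      using assms[of x] that by (metis less_SucE not_in_iff)
    then show "count N x = count (filter_mset (\<lambda>x. x < s) N + replicate_mset (count N s) s) x"
      by auto
  qed
qed auto

lemma finite_submset: "finite {\<gamma>. \<gamma> \<subseteq># (N :: nat multiset)}"
proof -
  have "{\<gamma>. \<gamma> \<subseteq># N} = fst ` msplits N"
    by (auto simp: msplits_def image_iff mset_subset_eq_exists_conv)
  then show ?thesis by simp
qed

lemma sum_submset_replicate:
  fixes F :: "nat multiset \<Rightarrow> nat"
  assumes N: "\<And>x. x \<in># N \<Longrightarrow> x < s"
  shows "(\<Sum>\<gamma> | \<gamma> \<subseteq># N + replicate_mset b s \<and> size \<gamma> = a. F (N + replicate_mset b s - \<gamma>)) =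
    (\<Sum>k\<le>min a b. \<Sum>\<gamma> | \<gamma> \<subseteq># N \<and> size \<gamma> = a - k. F (N - \<gamma> + replicate_mset (b - k) s))"
proof -
  have fin: "finite {\<gamma>. \<gamma> \<subseteq># N \<and> size \<gamma> = c}" for c
    by (rule finite_subset[OF _ finite_submset[of N]]) auto
  have sN: "count N s = 0" using N by (meson less_irrefl not_in_iff)
  have "(\<Sum>\<gamma> | \<gamma> \<subseteq># N + replicate_mset b s \<and> size \<gamma> = a. F (N + replicate_mset b s - \<gamma>)) =
    (\<Sum>(k, \<gamma>)\<in>(SIGMA k:{..min a b}. {\<gamma>. \<gamma> \<subseteq># N \<and> size \<gamma> = a - k}). F (N - \<gamma> + replicate_mset (b - k) s))"
  proof (rule sum.reindex_bij_witness[of _ "\<lambda>(k, \<gamma>). \<gamma> + replicate_mset k s"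
        "\<lambda>\<gamma>. (count \<gamma> s, filter_mset (\<lambda>x. x \<noteq> s) \<gamma>)"])
    fix \<gamma> assume "\<gamma> \<in> {\<gamma>. \<gamma> \<subseteq># N + replicate_mset b s \<and> size \<gamma> = a}"
    then have \<gamma>: "\<gamma> \<subseteq># N + replicate_mset b s" "size \<gamma> = a" by auto
    have le: "count \<gamma> x \<le> count N x + (if x = s then b else 0)" for x
      using \<gamma>(1) by (auto simp: subseteq_mset_def dest!: spec[of _ x])
    show eq: "(case (count \<gamma> s, filter_mset (\<lambda>x. x \<noteq> s) \<gamma>) of (k, \<gamma>) \<Rightarrow> \<gamma> + replicate_mset k s) = \<gamma>"
      by (auto intro!: multiset_eqI)
    have "size (filter_mset (\<lambda>x. x \<noteq> s) \<gamma>) + count \<gamma> s = a"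
      using arg_cong[OF eq, of size] \<gamma>(2) by simp
    moreover have "filter_mset (\<lambda>x. x \<noteq> s) \<gamma> \<subseteq># N"
      unfolding subseteq_mset_def
    proof
      fix x show "count (filter_mset (\<lambda>x. x \<noteq> s) \<gamma>) x \<le> count N x"
        using le[of x] by (cases "x = s") simp_all
    qed
    ultimately show "(count \<gamma> s, filter_mset (\<lambda>x. x \<noteq> s) \<gamma>) \<in> (SIGMA k:{..min a b}. {\<gamma>. \<gamma> \<subseteq># N \<and> size \<gamma> = a - k})"
      using le[of s] sN by auto
    have "N - filter_mset (\<lambda>x. x \<noteq> s) \<gamma> + replicate_mset (b - count \<gamma> s) s = N + replicate_mset b s - \<gamma>"
      using sN by (auto intro!: multiset_eqI)
    then show "(case (count \<gamma> s, filter_mset (\<lambda>x. x \<noteq> s) \<gamma>) of (k, \<gamma>) \<Rightarrow> F (N - \<gamma> + replicate_mset (b - k) s)) =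
        F (N + replicate_mset b s - \<gamma>)" by simp
  next
    fix y assume "y \<in> (SIGMA k:{..min a b}. {\<gamma>. \<gamma> \<subseteq># N \<and> size \<gamma> = a - k})"
    then obtain k \<gamma> where y: "y = (k, \<gamma>)" "k \<le> a" "k \<le> b" "\<gamma> \<subseteq># N" "size \<gamma> = a - k" by auto
    have "count \<gamma> s = 0" using y(4) sN by (metis le_zero_eq mset_subset_eq_count)
    then show "(count (case y of (k, \<gamma>) \<Rightarrow> \<gamma> + replicate_mset k s) s,
        filter_mset (\<lambda>x. x \<noteq> s) (case y of (k, \<gamma>) \<Rightarrow> \<gamma> + replicate_mset k s)) = y"
      by (auto simp: y(1) intro!: multiset_eqI)
    show "(case y of (k, \<gamma>) \<Rightarrow> \<gamma> + replicate_mset k s) \<in> {\<gamma>. \<gamma> \<subseteq># N + replicate_mset b s \<and> size \<gamma> = a}"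
      using y by (auto intro!: subset_mset.add_mono) (auto simp: subseteq_mset_def)
  qed
  also have "\<dots> = (\<Sum>k\<le>min a b. \<Sum>\<gamma> | \<gamma> \<subseteq># N \<and> size \<gamma> = a - k. F (N - \<gamma> + replicate_mset (b - k) s))"
    using fin by (subst sum.Sigma) auto
  finally show ?thesis .
qed

text \<open>
  Induction on the largest letter \<open>s\<close> of \<open>N\<close>: peeling it off removes a strip of size \<open>b\<close>, which
  \<open>up_down_commute\<close> moves past the added strip of size \<open>a\<close>. The index \<open>k\<close> becomes the multiplicity
  of \<open>s\<close> in the submultiset \<open>\<gamma>\<close>.
\<close>

lemma strips_above_kostka_seq:
  assumes "f \<in> partition_seqs" "\<And>x. x \<in># N \<Longrightarrow> x < s"
  shows "(\<Sum>h\<in>strips_above f a. kostka_seq h N) = (\<Sum>\<gamma> | \<gamma> \<subseteq># N \<and> size \<gamma> = a. kostka_seq f (N - \<gamma>))"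
  using assms
proof (induction s arbitrary: f a N)
  case 0
  then have N: "N = {#}" by (metis multiset_nonemptyE not_less_zero)
  have weight0: "weight (\<lambda>_. 0) = 0" by (simp add: weight_def)
  have i0: "f \<preceq> (\<lambda>_. 0) \<longleftrightarrow> f = (\<lambda>_. 0)" by (auto simp: interlaces_def)
  have "(\<Sum>h\<in>strips_above f a. kostka_seq h N) = (\<Sum>h\<in>strips_above f a. if h = (\<lambda>_. 0) then 1 else 0)"
    using partition_seqs_above[OF 0(1)] by (intro sum.cong refl) (auto simp: N kostka_seq_empty strips_above_def)
  also have "\<dots> = (if (\<lambda>_. 0) \<in> strips_above f a then 1 else 0)"
    by (simp add: sum.delta[OF finite_strips_above[OF 0(1)]])
  also have "\<dots> = (if f = (\<lambda>_. 0) \<and> a = 0 then 1 else 0)"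
    using i0 weight0 by (auto simp: strips_above_def)
  also have "\<dots> = (\<Sum>\<gamma> | \<gamma> \<subseteq># N \<and> size \<gamma> = a. kostka_seq f (N - \<gamma>))"
  proof -
    have "{\<gamma>. \<gamma> \<subseteq># N \<and> size \<gamma> = a} = (if a = 0 then {{#}} else {})" by (auto simp: N)
    then show ?thesis using 0(1) by (simp add: N kostka_seq_empty)
  qed
  finally show ?case .
next
  case (Suc s)
  obtain N' b where N: "N = N' + replicate_mset b s" and N': "\<And>x. x \<in># N' \<Longrightarrow> x < s"
    using split_top_letter Suc.prems(2) by metis
  have sub: "\<And>x. x \<in># N' - \<gamma> \<Longrightarrow> x < s" for \<gamma> using N' by (meson in_diffD)
  have "(\<Sum>h\<in>strips_above f a. kostka_seq h N) = (\<Sum>h\<in>strips_above f a. \<Sum>g\<in>strips_below h b. kostka_seq g N')"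
    unfolding N using kostka_seq_rec N' partition_seqs_above[OF Suc.prems(1)]
    by (intro sum.cong refl) (auto simp: strips_above_def)
  also have "\<dots> = (\<Sum>k\<le>min a b. \<Sum>e\<in>strips_below f (b - k). \<Sum>g\<in>strips_above e (a - k). kostka_seq g N')"
    by (rule up_down_commute[OF Suc.prems(1)])
  also have "\<dots> = (\<Sum>k\<le>min a b. \<Sum>e\<in>strips_below f (b - k). \<Sum>\<gamma> | \<gamma> \<subseteq># N' \<and> size \<gamma> = a - k. kostka_seq e (N' - \<gamma>))"
    using partition_seqs_below[OF Suc.prems(1)] N' by (intro sum.cong refl Suc.IH) (auto simp: strips_below_def)
  also have "\<dots> = (\<Sum>k\<le>min a b. \<Sum>\<gamma> | \<gamma> \<subseteq># N' \<and> size \<gamma> = a - k. \<Sum>e\<in>strips_below f (b - k). kostka_seq e (N' - \<gamma>))"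
    by (rule sum.cong[OF refl], rule sum.swap)
  also have "\<dots> = (\<Sum>k\<le>min a b. \<Sum>\<gamma> | \<gamma> \<subseteq># N' \<and> size \<gamma> = a - k. kostka_seq f (N' - \<gamma> + replicate_mset (b - k) s))"
    by (intro sum.cong refl) (rule kostka_seq_rec[OF Suc.prems(1) sub, symmetric])
  also have "\<dots> = (\<Sum>\<gamma> | \<gamma> \<subseteq># N \<and> size \<gamma> = a. kostka_seq f (N - \<gamma>))"
    unfolding N by (rule sum_submset_replicate[OF N', symmetric])
  finally show ?case .
qed

text \<open>
  The matrices of natural numbers with row sums \<open>M\<close> and column sums \<open>N\<close>.
\<close>

definition pairings :: "nat multiset \<Rightarrow> nat multiset \<Rightarrow> (nat \<times> nat) multiset set" where
  "pairings M N = {Q. image_mset fst Q = M \<and> image_mset snd Q = N}"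

lemma finite_pairings: "finite (pairings M N)"
proof (rule finite_subset)
  let ?X = "set_mset M \<times> set_mset N"
  show "pairings M N \<subseteq> mset ` {xs. set xs \<subseteq> ?X \<and> length xs \<le> size M}"
  proof
    fix Q assume Q: "Q \<in> pairings M N"
    obtain xs where xs: "Q = mset xs" by (metis ex_mset)
    have "M = mset (map fst xs)" "N = mset (map snd xs)" using Q xs by (auto simp: pairings_def)
    then have "set xs \<subseteq> ?X" "length xs \<le> size M" by (auto simp: mem_Times_iff intro: rev_image_eqI)
    then show "Q \<in> mset ` {xs. set xs \<subseteq> ?X \<and> length xs \<le> size M}" using xs by blast
  qed
qed (intro finite_imageI finite_lists_length_le, simp)

lemma card_pairings_rec:
  assumes M: "\<And>x. x \<in># M \<Longrightarrow> x < s"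
  shows "card (pairings (M + replicate_mset a s) N) =
    (\<Sum>\<gamma> | \<gamma> \<subseteq># N \<and> size \<gamma> = a. card (pairings M (N - \<gamma>)))"
proof -
  let ?I = "{\<gamma>. \<gamma> \<subseteq># N \<and> size \<gamma> = a}"
  have fin: "finite ?I" by (rule finite_subset[OF _ finite_submset[of N]]) auto
  have "card (pairings (M + replicate_mset a s) N) = card (SIGMA \<gamma>:?I. pairings M (N - \<gamma>))"
  proof (rule bij_betw_same_card[of "\<lambda>Q. (image_mset snd (filter_mset (\<lambda>p. fst p = s) Q), filter_mset (\<lambda>p. fst p \<noteq> s) Q)"],
      rule bij_betw_byWitness[where f' = "\<lambda>(\<gamma>, Q). Q + image_mset (Pair s) \<gamma>"])
    let ?f = "\<lambda>Q :: (nat \<times> nat) multiset. (image_mset snd (filter_mset (\<lambda>p. fst p = s) Q), filter_mset (\<lambda>p. fst p \<noteq> s) Q)"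
    let ?g = "\<lambda>(\<gamma>, Q). Q + image_mset (Pair s) \<gamma>"
    have recover: "image_mset (Pair s) (image_mset snd (filter_mset (\<lambda>p. fst p = s) Q)) = filter_mset (\<lambda>p. fst p = s) Q" for Q
    proof -
      have "image_mset (Pair s) (image_mset snd (filter_mset (\<lambda>p. fst p = s) Q)) =
        image_mset id (filter_mset (\<lambda>p. fst p = s) Q)"
        unfolding image_mset.compositionality by (intro image_mset_cong) auto
      then show ?thesis by simp
    qed
    show "\<forall>Q\<in>pairings (M + replicate_mset a s) N. ?g (?f Q) = Q"
      by (simp add: recover)
    show "\<forall>y\<in>(SIGMA \<gamma>:?I. pairings M (N - \<gamma>)). ?f (?g y) = y"
    proof
      fix y assume "y \<in> (SIGMA \<gamma>:?I. pairings M (N - \<gamma>))"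
      then obtain \<gamma> Q where y: "y = (\<gamma>, Q)" "image_mset fst Q = M" by (auto simp: pairings_def)
      have ns: "fst p \<noteq> s" if "p \<in># Q" for p using that M y(2) by (metis imageI less_irrefl set_image_mset)
      then have "filter_mset (\<lambda>p. fst p = s) Q = {#}" "filter_mset (\<lambda>p. fst p \<noteq> s) Q = Q"
        by (auto simp: filter_mset_eq_conv)
      then show "?f (?g y) = y" by (simp add: y filter_mset_image_mset image_mset.compositionality comp_def)
    qed
    show "?f ` pairings (M + replicate_mset a s) N \<subseteq> (SIGMA \<gamma>:?I. pairings M (N - \<gamma>))"
    proof (intro image_subsetI)
      fix Q assume "Q \<in> pairings (M + replicate_mset a s) N"
      then have Q: "image_mset fst Q = M + replicate_mset a s" "image_mset snd Q = N"
        by (auto simp: pairings_def)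
      have decomp: "Q = filter_mset (\<lambda>p. fst p = s) Q + filter_mset (\<lambda>p. fst p \<noteq> s) Q"
        by (rule multiset_partition)
      have sM: "s \<notin># M" using M by blast
      have "image_mset fst (filter_mset (\<lambda>p. fst p \<noteq> s) Q) = filter_mset (\<lambda>x. x \<noteq> s) (image_mset fst Q)"
        by (simp add: filter_mset_image_mset)
      also have "\<dots> = M" using sM unfolding Q by (intro multiset_eqI) (auto simp: not_in_iff)
      finally have 1: "image_mset fst (filter_mset (\<lambda>p. fst p \<noteq> s) Q) = M" .
      have "size (filter_mset (\<lambda>p. fst p = s) Q) = a"
        using arg_cong[OF decomp, of size, unfolded size_union] arg_cong[OF Q(1), of size]
          arg_cong[OF 1, of size] by (simp only: size_union size_image_mset size_replicate_mset)
      moreover have "N = image_mset snd (filter_mset (\<lambda>p. fst p = s) Q) + image_mset snd (filter_mset (\<lambda>p. fst p \<noteq> s) Q)"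
        using Q(2) by (metis decomp image_mset_union)
      ultimately show "?f Q \<in> (SIGMA \<gamma>:?I. pairings M (N - \<gamma>))"
        using 1 by (auto simp: pairings_def)
    qed
    show "?g ` (SIGMA \<gamma>:?I. pairings M (N - \<gamma>)) \<subseteq> pairings (M + replicate_mset a s) N"
      by (auto simp: pairings_def image_mset.compositionality comp_def image_mset_const_eq)
  qed
  also have "\<dots> = (\<Sum>\<gamma>\<in>?I. card (pairings M (N - \<gamma>)))"
    using fin finite_pairings by (simp add: card_SigmaI)
  finally show ?thesis .
qed

lemma kostka_seq_zero_unless: "f \<in> partition_seqs \<Longrightarrow> kostka_seq f M \<noteq> 0 \<Longrightarrow> size M = weight f"
proof -
  assume f: "f \<in> partition_seqs" "kostka_seq f M \<noteq> 0"
  then obtain T where "content (list_of_seq f) T = M"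
    unfolding kostka_seq_def kostka_def by (metis (mono_tags, lifting) card.empty empty_Collect_eq)
  then have "size M = sum_list (list_of_seq f)" by (auto simp: content_def card_diagram)
  then show ?thesis using f(1) by (metis row_length_list_of_seq weight_row_length)
qed

text \<open>
  Peeling the largest letter off \<open>M\<close> removes a row of the matrix on one side, and on the other side
  turns a sum over shapes into the situation of \<open>strips_above_kostka_seq\<close>.
\<close>

lemma kostka_seq_cauchy:
  assumes "\<And>x. x \<in># M \<Longrightarrow> x < s" "size M = n"
  shows "(\<Sum>f | f \<in> partition_seqs \<and> weight f = n. kostka_seq f M * kostka_seq f N) = card (pairings M N)"
  using assms
proof (induction s arbitrary: M N n)
  case 0
  then have M: "M = {#}" by (metis multiset_nonemptyE not_less_zero)
  have w: "f = (\<lambda>_. 0)" if f: "f \<in> partition_seqs" "weight f = 0" for f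
  proof -
    obtain m where m: "\<And>i. i \<ge> m \<Longrightarrow> f i = 0" using f by (auto simp: partition_seqs_def)
    have "(\<Sum>i<m. f i) = 0" using weight_eq[OF m] f(2) by simp
    then have "\<forall>i<m. f i = 0" by simp
    then have "f i = 0" for i using m[of i] not_le by blast
    then show ?thesis by blast
  qed
  have "weight (\<lambda>_. 0) = 0" by (simp add: weight_def)
  moreover have "n = 0" using 0(2) M by simp
  ultimately have "f \<in> partition_seqs \<and> weight f = n \<longleftrightarrow> f = (\<lambda>_. 0)" for f
    using w zero_in_partition_seqs by metis
  then have "{f. f \<in> partition_seqs \<and> weight f = n} = {\<lambda>_. 0}" by simp
  then have "(\<Sum>f | f \<in> partition_seqs \<and> weight f = n. kostka_seq f M * kostka_seq f N) = kostka_seq (\<lambda>_. 0) N"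
    by (simp add: M kostka_seq_empty zero_in_partition_seqs)
  also have "\<dots> = (if N = {#} then 1 else 0)"
    using kostka_seq_zero_unless[OF zero_in_partition_seqs, of N] kostka_seq_empty[OF zero_in_partition_seqs] \<open>weight (\<lambda>_. 0) = 0\<close> by auto
  also have "pairings M N = (if N = {#} then {{#}} else {})" by (auto simp: pairings_def M)
  then have "(if N = {#} then 1 else 0) = card (pairings M N)" by simp
  finally show ?case .
next
  case (Suc s)
  obtain M' a where M: "M = M' + replicate_mset a s" and M': "\<And>x. x \<in># M' \<Longrightarrow> x < s"
    using split_top_letter Suc.prems(1) by metis
  obtain t where t: "\<And>x. x \<in># N \<Longrightarrow> x < t"
    using finite_nat_set_iff_bounded[of "set_mset N"] by auto
  have n: "n = size M' + a" using Suc.prems(2) M by simp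
  let ?P = "\<lambda>n. {f. f \<in> partition_seqs \<and> weight f = n}"
  have finP: "finite (?P n)" for n using finite_partition_seqs_weight[of n] by (simp add: Collect_conj_eq)
  have "(\<Sum>h\<in>?P n. kostka_seq h M * kostka_seq h N) = (\<Sum>h\<in>?P n. \<Sum>f\<in>strips_below h a. kostka_seq f M' * kostka_seq h N)"
    unfolding M using kostka_seq_rec M' by (intro sum.cong refl) (auto simp: sum_distrib_right)
  also have "\<dots> = (\<Sum>(h, f)\<in>(SIGMA h:?P n. strips_below h a). kostka_seq f M' * kostka_seq h N)"
    by (rule sum.Sigma) (auto simp: finP[simplified] finite_strips_below)
  also have "\<dots> = (\<Sum>(f, h)\<in>(SIGMA f:?P (size M'). strips_above f a). kostka_seq f M' * kostka_seq h N)"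
    by (rule sum.reindex_bij_witness[of _ prod.swap prod.swap])
      (auto simp: n strips_above_def strips_below_def intro: partition_seqs_above partition_seqs_below)
  also have "\<dots> = (\<Sum>f\<in>?P (size M'). kostka_seq f M' * (\<Sum>h\<in>strips_above f a. kostka_seq h N))"
    unfolding sum_distrib_left by (rule sum.Sigma[symmetric]) (auto simp: finP[simplified] finite_strips_above)
  also have "\<dots> = (\<Sum>f\<in>?P (size M'). kostka_seq f M' * (\<Sum>\<gamma> | \<gamma> \<subseteq># N \<and> size \<gamma> = a. kostka_seq f (N - \<gamma>)))"
    using strips_above_kostka_seq t by (intro sum.cong refl arg_cong2[of _ _ _ _ "(*)"]) auto
  also have "\<dots> = (\<Sum>\<gamma> | \<gamma> \<subseteq># N \<and> size \<gamma> = a. \<Sum>f\<in>?P (size M'). kostka_seq f M' * kostka_seq f (N - \<gamma>))"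
    unfolding sum_distrib_left by (rule sum.swap)
  also have "\<dots> = (\<Sum>\<gamma> | \<gamma> \<subseteq># N \<and> size \<gamma> = a. card (pairings M' (N - \<gamma>)))"
    by (intro sum.cong refl Suc.IH M') auto
  also have "\<dots> = card (pairings M N)" unfolding M by (rule card_pairings_rec[OF M', symmetric])
  finally show ?case .
qed

text \<open>
  The Cauchy identity \<open>\<Sum>\<^sub>\<kappa> s\<^sub>\<kappa>(x) s\<^sub>\<kappa>(y) = \<Prod> 1 / (1 - x\<^sub>i y\<^sub>j)\<close>, read off at the monomials \<open>M\<close> and \<open>N\<close>.
\<close>

theorem kostka_cauchy:
  assumes "size M = n"
  shows "(\<Sum>\<kappa>\<in>partitions_of n. kostka \<kappa> M * kostka \<kappa> N) = card (pairings M N)"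
proof -
  obtain t where "\<And>x. x \<in># M \<Longrightarrow> x < t"
    using finite_nat_set_iff_bounded[of "set_mset M"] by auto
  from kostka_seq_cauchy[OF this assms, of N] show ?thesis
    unfolding kostka_seq_def using sum_partition_seqs_eq_sum_partitions[where n = n and F = "\<lambda>\<kappa>. kostka \<kappa> M * kostka \<kappa> N"] by simp
qed

section \<open>Fillings fixed by a permutation\<close>

definition fillings :: "'a set \<Rightarrow> ('a \<Rightarrow> 'a) \<Rightarrow> 'b multiset \<Rightarrow> ('a \<Rightarrow> 'b) set" where
  "fillings X w M = {T \<in> extensional X. image_mset T (mset_set X) = M \<and> (\<forall>x\<in>X. T (w x) = T x)}"

lemma finite_fillings: "finite X \<Longrightarrow> finite (fillings X w M)"
proof (rule finite_subset)
  assume "finite X"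
  then show "fillings X w M \<subseteq> X \<rightarrow>\<^sub>E set_mset M" by (auto simp: fillings_def PiE_def)
  show "finite (X \<rightarrow>\<^sub>E set_mset M)" using \<open>finite X\<close> by (intro finite_PiE) auto
qed

text \<open>
  This series is the power sum indexed by the cycle type of \<open>w\<close>, because a filling fixed by \<open>w\<close>
  assigns one variable to each cycle. Working with fixed fillings makes the invariance under
  conjugation evident and lets Burnside's counting argument apply.
\<close>

lift_definition fix_series :: "'a set \<Rightarrow> ('a \<Rightarrow> 'a) \<Rightarrow> mser" is
  "\<lambda>X w M. of_nat (card (fillings X w M))" .

lemma mcoeff_fix_series: "mcoeff (fix_series X w) M = of_nat (card (fillings X w M))"
  by transfer simp

text \<open>
  Conjugate permutations have the same series; this includes changes of the underlying set.
\<close>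

lemma fix_series_transport:
  assumes \<phi>: "bij_betw \<phi> X Y" and comm: "\<And>x. x \<in> X \<Longrightarrow> \<phi> (w x) = w' (\<phi> x)" and w: "\<And>x. x \<in> X \<Longrightarrow> w x \<in> X"
  shows "fix_series X w = fix_series Y w'"
proof (rule mser_eqI)
  fix M :: "nat multiset"
  define \<psi> where "\<psi> = inv_into X \<phi>"
  have \<psi>: "bij_betw \<psi> Y X" unfolding \<psi>_def by (rule bij_betw_inv_into[OF \<phi>])
  have \<psi>\<phi>: "\<psi> (\<phi> x) = x" if "x \<in> X" for x using that \<phi> by (simp add: \<psi>_def bij_betw_inv_into_left)
  have \<phi>\<psi>: "\<phi> (\<psi> y) = y" if "y \<in> Y" for y using that \<phi> by (simp add: \<psi>_def bij_betw_inv_into_right)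
  have \<phi>Y: "\<phi> x \<in> Y" if "x \<in> X" for x using that \<phi> by (auto simp: bij_betw_def)
  have \<psi>X: "\<psi> y \<in> X" if "y \<in> Y" for y using that \<psi> by (auto simp: bij_betw_def)
  have w': "w' y \<in> Y" and comm': "\<psi> (w' y) = w (\<psi> y)" if "y \<in> Y" for y
    using comm[OF \<psi>X[OF that]] \<phi>\<psi>[OF that] \<phi>Y[OF w[OF \<psi>X[OF that]]] \<psi>\<phi>[OF w[OF \<psi>X[OF that]]] by auto
  have ms: "mset_set Y = image_mset \<phi> (mset_set X)" "mset_set X = image_mset \<psi> (mset_set Y)"
    using \<phi> \<psi> by (auto simp: bij_betw_def image_mset_mset_set)
  have "bij_betw (\<lambda>T. restrict (T \<circ> \<phi>) X) (fillings Y w' M) (fillings X w M)"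
  proof (rule bij_betw_byWitness[where f' = "\<lambda>T. restrict (T \<circ> \<psi>) Y"])
    show "\<forall>T\<in>fillings Y w' M. restrict (restrict (T \<circ> \<phi>) X \<circ> \<psi>) Y = T"
      using \<phi>\<psi> \<psi>X by (auto simp: fillings_def fun_eq_iff extensional_def)
    show "\<forall>T\<in>fillings X w M. restrict (restrict (T \<circ> \<psi>) Y \<circ> \<phi>) X = T"
      using \<psi>\<phi> \<phi>Y by (auto simp: fillings_def fun_eq_iff extensional_def)
    show "(\<lambda>T. restrict (T \<circ> \<phi>) X) ` fillings Y w' M \<subseteq> fillings X w M"
    proof (intro image_subsetI)
      fix T assume T: "T \<in> fillings Y w' M"
      have "image_mset (restrict (T \<circ> \<phi>) X) (mset_set X) = image_mset (T \<circ> \<phi>) (mset_set X)"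
        by (intro image_mset_cong) (cases "finite X"; simp)
      also have "\<dots> = M" using T by (simp add: ms(1) fillings_def image_mset.compositionality)
      finally show "restrict (T \<circ> \<phi>) X \<in> fillings X w M"
        using T w comm \<phi>Y by (auto simp: fillings_def)
    qed
    show "(\<lambda>T. restrict (T \<circ> \<psi>) Y) ` fillings X w M \<subseteq> fillings Y w' M"
    proof (intro image_subsetI)
      fix T assume T: "T \<in> fillings X w M"
      have "image_mset (restrict (T \<circ> \<psi>) Y) (mset_set Y) = image_mset (T \<circ> \<psi>) (mset_set Y)"
        by (intro image_mset_cong) (cases "finite Y"; simp)
      also have "\<dots> = M" using T by (simp add: ms(2) fillings_def image_mset.compositionality)
      finally show "restrict (T \<circ> \<psi>) Y \<in> fillings Y w' M"
        using T w' comm' \<psi>X by (auto simp: fillings_def)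
    qed
  qed
  then show "mcoeff (fix_series X w) M = mcoeff (fix_series Y w') M"
    unfolding mcoeff_fix_series by (metis bij_betw_same_card)
qed

lemma fix_series_disjoint_Un:
  assumes fin: "finite X" "finite Y" and disj: "X \<inter> Y = {}"
    and wX: "\<And>x. x \<in> X \<Longrightarrow> w x \<in> X" and wY: "\<And>x. x \<in> Y \<Longrightarrow> w x \<in> Y"
  shows "fix_series (X \<union> Y) w = fix_series X w * fix_series Y w"
proof (rule mser_eqI)
  fix M :: "nat multiset"
  have nY: "x \<notin> Y" if "x \<in> X" for x using disj that by blast
  have nX: "x \<notin> X" if "x \<in> Y" for x using disj that by blast
  have ms: "mset_set (X \<union> Y) = mset_set X + mset_set Y" using fin disj by (rule mset_set_Union)
  let ?R = "SIGMA p:msplits M. fillings X w (fst p) \<times> fillings Y w (snd p)"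
  let ?f = "\<lambda>T. ((image_mset T (mset_set X), image_mset T (mset_set Y)), (restrict T X, restrict T Y))"
  let ?g = "\<lambda>(p, (T1, T2)) x. if x \<in> X then T1 x else T2 x"
  have "bij_betw ?f (fillings (X \<union> Y) w M) ?R"
  proof (rule bij_betw_byWitness[where f' = ?g])
    show "\<forall>T\<in>fillings (X \<union> Y) w M. ?g (?f T) = T"
      by (auto simp: fillings_def fun_eq_iff extensional_def)
    show "\<forall>y\<in>?R. ?f (?g y) = y"
    proof
      fix y assume "y \<in> ?R"
      then obtain A B T1 T2 where y: "y = ((A, B), (T1, T2))"
        and T: "T1 \<in> fillings X w A" "T2 \<in> fillings Y w B" by auto
      have "image_mset (?g y) (mset_set X) = image_mset T1 (mset_set X)"
        using fin by (intro image_mset_cong) (auto simp: y)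
      moreover have "image_mset (?g y) (mset_set Y) = image_mset T2 (mset_set Y)"
        using fin nX by (intro image_mset_cong) (auto simp: y)
      moreover have "restrict (?g y) X = T1" "restrict (?g y) Y = T2"
        using T nX by (auto simp: y fillings_def fun_eq_iff extensional_def)
      ultimately show "?f (?g y) = y" using T by (simp add: y fillings_def)
    qed
    show "?f ` fillings (X \<union> Y) w M \<subseteq> ?R"
    proof (intro image_subsetI)
      fix T assume T: "T \<in> fillings (X \<union> Y) w M"
      have "image_mset (restrict T X) (mset_set X) = image_mset T (mset_set X)"
        "image_mset (restrict T Y) (mset_set Y) = image_mset T (mset_set Y)"
        using fin by (auto intro!: image_mset_cong)
      then show "?f T \<in> ?R"
        using T wX wY by (auto simp: fillings_def msplits_def ms)
    qed
    show "?g ` ?R \<subseteq> fillings (X \<union> Y) w M"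
    proof (intro image_subsetI)
      fix y assume "y \<in> ?R"
      then obtain A B T1 T2 where y: "y = ((A, B), (T1, T2))" "A + B = M"
        and T: "T1 \<in> fillings X w A" "T2 \<in> fillings Y w B" by (auto simp: msplits_def)
      have "image_mset (?g y) (mset_set X) = image_mset T1 (mset_set X)"
        using fin by (intro image_mset_cong) (auto simp: y)
      moreover have "image_mset (?g y) (mset_set Y) = image_mset T2 (mset_set Y)"
        using fin nX by (intro image_mset_cong) (auto simp: y)
      ultimately have "image_mset (?g y) (mset_set (X \<union> Y)) = M"
        using T y(2) by (simp add: ms fillings_def)
      then show "?g y \<in> fillings (X \<union> Y) w M"
        using T wX wY nX by (auto simp: fillings_def y(1) extensional_def)
    qed
  qed
  then have "card (fillings (X \<union> Y) w M) = card ?R" by (rule bij_betw_same_card)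
  also have "\<dots> = (\<Sum>p\<in>msplits M. card (fillings X w (fst p)) * card (fillings Y w (snd p)))"
    using fin by (subst card_SigmaI) (auto simp: finite_fillings card_cartesian_product)
  finally show "mcoeff (fix_series (X \<union> Y) w) M = mcoeff (fix_series X w * fix_series Y w) M"
    by (simp add: mcoeff_mult mcoeff_fix_series case_prod_beta)
qed

lemma fix_series_empty: "fix_series {} w = 1"
proof (rule mser_eqI)
  fix M :: "nat multiset"
  have "fillings {} w M = (if M = {#} then {\<lambda>_. undefined} else {})"
    by (auto simp: fillings_def)
  then show "mcoeff (fix_series {} w) M = mcoeff 1 M"
    by (simp add: mcoeff_fix_series mcoeff_one)
qed

text \<open>
  The standard permutation with cycle lengths \<open>xs\<close> rotates every row of the diagram of \<open>xs\<close>.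
\<close>

definition row_rotation :: "nat list \<Rightarrow> nat \<times> nat \<Rightarrow> nat \<times> nat" where
  "row_rotation xs c = (fst c, Suc (snd c) mod xs ! fst c)"

lemma row_rotation_in: "c \<in> diagram xs \<Longrightarrow> row_rotation xs c \<in> diagram xs"
  by (cases c) (auto simp: row_rotation_def diagram_def)

lemma fix_series_cycle:
  assumes "k > 0"
  shows "fix_series {..<k} (\<lambda>j. Suc j mod k) = psum k"
proof (rule mser_eqI)
  fix M :: "nat multiset"
  have const: "T j = T 0" if T: "T \<in> fillings {..<k} (\<lambda>j. Suc j mod k) M" and j: "j < k"
    for T :: "nat \<Rightarrow> nat" and j
    using j
  proof (induction j)
    case (Suc j)
    have "\<forall>x\<in>{..<k}. T (Suc x mod k) = T x" using T by (simp add: fillings_def)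
    then have "T (Suc j mod k) = T j" using Suc.prems by (meson Suc_lessD lessThan_iff)
    then show ?case using Suc by simp
  qed simp
  have eq: "fillings {..<k} (\<lambda>j. Suc j mod k) M = {restrict (\<lambda>_. i) {..<k} | i. M = replicate_mset k i}"
  proof (intro set_eqI iffI)
    fix T assume T: "T \<in> fillings {..<k} (\<lambda>j. Suc j mod k) M"
    have "T \<in> extensional {..<k}" "image_mset T (mset_set {..<k}) = M" using T by (auto simp: fillings_def)
    moreover have "image_mset T (mset_set {..<k}) = image_mset (\<lambda>_. T 0) (mset_set {..<k})"
      by (intro image_mset_cong const[OF T]) simp
    moreover have "T = restrict (\<lambda>_. T 0) {..<k}"
    proof (rule extensionalityI)
      show "T \<in> extensional {..<k}" by fact
      show "T x = restrict (\<lambda>_. T 0) {..<k} x" if "x \<in> {..<k}" for x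
        using that const[OF T, of x] by (metis lessThan_iff restrict_apply')
    qed simp
    ultimately have T0: "T = restrict (\<lambda>_. T 0) {..<k}" "M = image_mset (\<lambda>_. T 0) (mset_set {..<k})" by auto
    then have "M = replicate_mset k (T 0)" by (simp add: image_mset_const_eq)
    then show "T \<in> {restrict (\<lambda>_. i) {..<k} | i. M = replicate_mset k i}" using T0(1) by blast
  next
    fix T assume "T \<in> {restrict (\<lambda>_. i) {..<k} | i. M = replicate_mset k i}"
    then obtain i where T: "T = restrict (\<lambda>_. i) {..<k}" "M = replicate_mset k i" by blast
    have "image_mset T (mset_set {..<k}) = image_mset (\<lambda>_. i) (mset_set {..<k})"
      unfolding T by (intro image_mset_cong) auto
    then show "T \<in> fillings {..<k} (\<lambda>j. Suc j mod k) M"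
      using T assms by (auto simp: fillings_def image_mset_const_eq)
  qed
  have "card {restrict (\<lambda>_. i) {..<k} | i. M = replicate_mset k i} = (if \<exists>i. M = replicate_mset k i then 1 else 0)"
  proof (cases "\<exists>i. M = replicate_mset k i")
    case True
    then obtain i where i: "M = replicate_mset k i" by blast
    have "j = i" if "replicate_mset k i = replicate_mset k j" for j
      using arg_cong[OF that, of set_mset] assms by simp
    then have "{restrict (\<lambda>_. j) {..<k} | j. M = replicate_mset k j} = {restrict (\<lambda>_. i) {..<k}}"
      unfolding i by auto
    then show ?thesis using True by simp
  qed auto
  then show "mcoeff (fix_series {..<k} (\<lambda>j. Suc j mod k)) M = mcoeff (psum k) M"
    unfolding mcoeff_fix_series eq by transfer auto
qed

lemma diagram_Cons: "diagram (x # xs) = (Pair 0 ` {..<x}) \<union> (apfst Suc ` diagram xs)"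
proof (rule set_eqI)
  fix c show "c \<in> diagram (x # xs) \<longleftrightarrow> c \<in> (Pair 0 ` {..<x}) \<union> (apfst Suc ` diagram xs)"
  proof (cases c)
    case (Pair i j)
    then show ?thesis by (cases i) (auto simp: diagram_def image_iff)
  qed
qed

lemma fix_series_row_rotation:
  "(\<And>x. x \<in> set xs \<Longrightarrow> 0 < x) \<Longrightarrow> fix_series (diagram xs) (row_rotation xs) = psums xs"
proof (induction xs)
  case Nil
  then show ?case by (simp add: diagram_def fix_series_empty psums_def)
next
  case (Cons x xs)
  have "fix_series (diagram (x # xs)) (row_rotation (x # xs)) =
    fix_series (Pair 0 ` {..<x}) (row_rotation (x # xs)) * fix_series (apfst Suc ` diagram xs) (row_rotation (x # xs))"
    unfolding diagram_Cons
  proof (intro fix_series_disjoint_Un)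
    fix c :: "nat \<times> nat" assume "c \<in> Pair 0 ` {..<x}"
    then show "row_rotation (x # xs) c \<in> Pair 0 ` {..<x}"
      using Cons.prems by (auto simp: row_rotation_def)
  next
    fix c :: "nat \<times> nat" assume "c \<in> apfst Suc ` diagram xs"
    then show "row_rotation (x # xs) c \<in> apfst Suc ` diagram xs"
      by (auto simp: row_rotation_def diagram_def image_iff)
  qed auto
  also have "fix_series (Pair 0 ` {..<x}) (row_rotation (x # xs)) = fix_series {..<x} (\<lambda>j. Suc j mod x)"
    using Cons.prems by (intro fix_series_transport[symmetric, of "Pair 0"])
      (auto simp: bij_betw_def inj_on_def row_rotation_def)
  also have "\<dots> = psum x" using Cons.prems by (intro fix_series_cycle) simp
  also have "fix_series (apfst Suc ` diagram xs) (row_rotation (x # xs)) = fix_series (diagram xs) (row_rotation xs)"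
    by (intro fix_series_transport[symmetric, of "apfst Suc"] row_rotation_in)
      (auto simp: bij_betw_def inj_on_def row_rotation_def)
  also have "\<dots> = psums xs" using Cons by simp
  finally show ?case by (simp add: psums_def)
qed

section \<open>Cycle types\<close>

text \<open>
  The bijection \<open>\<phi>\<close> carries the standard permutation to \<open>w\<close>, so that \<open>xs\<close> lists the cycle lengths
  of \<open>w\<close>.
\<close>

definition rotation_model :: "nat list \<Rightarrow> (nat \<times> nat \<Rightarrow> 'a) \<Rightarrow> 'a set \<Rightarrow> ('a \<Rightarrow> 'a) \<Rightarrow> bool" where
  "rotation_model xs \<phi> X w \<longleftrightarrow> bij_betw \<phi> (diagram xs) X \<and> (\<forall>c\<in>diagram xs. \<phi> (row_rotation xs c) = w (\<phi> c))"

lemma cycle_through: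
  assumes fin: "finite X" and w: "bij_betw w X X" and a: "a \<in> X"
  obtains k where "0 < k" "(w ^^ k) a = a" "inj_on (\<lambda>n. (w ^^ n) a) {..<k}" "\<And>n. (w ^^ n) a \<in> X"
proof -
  have wn: "bij_betw (w ^^ n) X X" for n by (rule bij_betw_funpow[OF w])
  then have inX: "(w ^^ n) a \<in> X" for n using a by (auto simp: bij_betw_def)
  have cancel: "(w ^^ (j - i)) a = a" if "i < j" "(w ^^ i) a = (w ^^ j) a" for i j
  proof -
    have "(w ^^ j) a = (w ^^ i) ((w ^^ (j - i)) a)"
      using that(1) by (metis comp_apply funpow_add le_add_diff_inverse less_imp_le)
    then show ?thesis
      using wn[of i] that(2) a inX[of "j - i"] by (auto simp: bij_betw_def inj_on_def)
  qed
  have "\<not> inj_on (\<lambda>n. (w ^^ n) a) UNIV"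
  proof
    assume "inj_on (\<lambda>n. (w ^^ n) a) UNIV"
    moreover have "finite (range (\<lambda>n. (w ^^ n) a))" using inX fin by (auto intro: finite_subset)
    ultimately show False using finite_imageD infinite_UNIV_nat by blast
  qed
  then obtain i j where "i \<noteq> j" "(w ^^ i) a = (w ^^ j) a" by (auto simp: inj_on_def)
  then obtain i j where "i < j" "(w ^^ i) a = (w ^^ j) a" by (metis linorder_neqE_nat)
  then have ex: "0 < j - i \<and> (w ^^ (j - i)) a = a" using cancel by simp
  define k where "k = (LEAST k. 0 < k \<and> (w ^^ k) a = a)"
  have k: "0 < k \<and> (w ^^ k) a = a" unfolding k_def by (rule LeastI[of "\<lambda>k. 0 < k \<and> (w ^^ k) a = a", OF ex])
  have least: "\<not> (0 < m \<and> (w ^^ m) a = a)" if "m < k" for m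
    using that unfolding k_def by (rule not_less_Least)
  have "inj_on (\<lambda>n. (w ^^ n) a) {..<k}"
  proof (rule linorder_inj_onI)
    fix i j assume "i < j" "i \<in> {..<k}" "j \<in> {..<k}"
    then show "(w ^^ i) a \<noteq> (w ^^ j) a" using cancel[of i j] least[of "j - i"] by auto
  qed auto
  then show thesis using that k inX by blast
qed

text \<open>
  The cycle through a point becomes the first row; the other rows come from the complement of that
  cycle, by induction.
\<close>

lemma rotation_model_exists:
  assumes "finite X" "bij_betw w X X"
  shows "\<exists>xs \<phi>. (\<forall>x\<in>set xs. 0 < x) \<and> rotation_model xs \<phi> X w"
  using assms
proof (induction "card X" arbitrary: X rule: less_induct)
  case less
  show ?case
  proof (cases "X = {}")
    case True
    then show ?thesis
      by (intro exI[of _ "[]"] exI[of _ "\<lambda>_. undefined"])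
        (auto simp: rotation_model_def diagram_def bij_betw_def)
  next
    case False
    then obtain a where a: "a \<in> X" by blast
    obtain k where k: "0 < k" "(w ^^ k) a = a" and inj: "inj_on (\<lambda>n. (w ^^ n) a) {..<k}"
      and inX: "\<And>n. (w ^^ n) a \<in> X"
      using cycle_through[OF less.prems a] by metis
    define C where "C = (\<lambda>n. (w ^^ n) a) ` {..<k}"
    have step: "w ((w ^^ n) a) = (w ^^ (Suc n mod k)) a" if "n < k" for n
      using that k by (cases "Suc n = k") auto
    have C: "C \<subseteq> X" "a \<in> C" using inX k by (auto simp: C_def image_iff intro: bexI[of _ 0])
    have "w ` C \<subseteq> C" using step k by (auto simp: C_def)
    moreover have "inj_on w C" using less.prems(2) C inj_on_subset by (auto simp: bij_betw_def)
    moreover have "finite C" by (simp add: C_def)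
    ultimately have wO: "bij_betw w C C" by (metis bij_betw_def endo_inj_surj)
    have "bij_betw w (X - C) (X - C)"
      using less.prems(2) wO C by (intro bij_betw_DiffI) auto
    moreover have "card (X - C) < card X"
      using less.prems(1) C a by (intro psubset_card_mono) auto
    ultimately obtain xs \<phi> where xs: "\<forall>x\<in>set xs. 0 < x" and \<phi>: "rotation_model xs \<phi> (X - C) w"
      using less.hyps less.prems(1) by (metis finite_Diff)
    define \<psi> where "\<psi> c = (case c of (0, j) \<Rightarrow> (w ^^ j) a | (Suc i, j) \<Rightarrow> \<phi> (i, j))" for c :: "nat \<times> nat"
    have \<phi>bij: "bij_betw \<phi> (diagram xs) (X - C)" and \<phi>c: "\<And>c. c \<in> diagram xs \<Longrightarrow> \<phi> (row_rotation xs c) = w (\<phi> c)"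
      using \<phi> by (auto simp: rotation_model_def)
    have "bij_betw \<psi> (Pair 0 ` {..<k}) C"
      using inj by (auto simp: bij_betw_def inj_on_def C_def \<psi>_def image_iff)
    moreover have "bij_betw \<psi> (apfst Suc ` diagram xs) (X - C)"
    proof -
      have e: "\<psi> (apfst Suc c) = \<phi> c" for c by (cases c) (simp add: \<psi>_def)
      show ?thesis using \<phi>bij unfolding bij_betw_def inj_on_def by (auto simp: e image_image)
    qed
    ultimately have "bij_betw \<psi> (diagram (k # xs)) (C \<union> (X - C))"
      unfolding diagram_Cons by (rule bij_betw_combine) auto
    moreover have "C \<union> (X - C) = X" using C by blast
    moreover have "\<psi> (row_rotation (k # xs) c) = w (\<psi> c)" if c: "c \<in> diagram (k # xs)" for c
    proof -
      obtain i j where ij: "c = (i, j)" by (cases c)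
      show ?thesis
      proof (cases i)
        case 0
        then show ?thesis using c ij step[of j] by (simp add: row_rotation_def \<psi>_def diagram_def)
      next
        case (Suc i')
        then have "(i', j) \<in> diagram xs" using c ij by (simp add: diagram_def)
        from \<phi>c[OF this] show ?thesis using Suc ij by (simp add: row_rotation_def \<psi>_def)
      qed
    qed
    ultimately have "rotation_model (k # xs) \<psi> X w" by (simp add: rotation_model_def)
    then show ?thesis using xs k by (metis set_ConsD)
  qed
qed

lemma rotation_model_permute:
  assumes "mset xs = mset ys"
  obtains \<phi> where "rotation_model xs \<phi> (diagram ys) (row_rotation ys)"
proof -
  obtain p where p: "p permutes {..<length ys}" "permute_list p ys = xs"
    using mset_eq_permutation[OF assms] by metis
  have len: "length xs = length ys" using assms by (rule mset_eq_length)
  have nth: "xs ! i = ys ! p i" if "i < length ys" for i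
    using permute_list_nth[OF p(1) that] p(2) by simp
  have plt: "p i < length ys \<longleftrightarrow> i < length ys" for i using permutes_in_image[OF p(1), of i] by simp
  have "bij_betw (apfst p) (diagram xs) (diagram ys)"
  proof (rule bij_betw_byWitness[where f' = "apfst (inv p)"])
    have ip: "inv p (p i) = i" "p (inv p i) = i" for i using permutes_inverses[OF p(1)] by auto
    have ilt: "inv p i < length ys \<longleftrightarrow> i < length ys" for i using plt[of "inv p i"] ip by simp
    show "\<forall>a\<in>diagram xs. apfst (inv p) (apfst p a) = a" "\<forall>a\<in>diagram ys. apfst p (apfst (inv p) a) = a"
      using ip by auto
    show "apfst p ` diagram xs \<subseteq> diagram ys"
    proof (intro image_subsetI)
      fix c assume "c \<in> diagram xs"
      then have "fst c < length ys" "snd c < xs ! fst c" by (auto simp: diagram_def len)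
      then show "apfst p c \<in> diagram ys"
        using nth[of "fst c"] plt[of "fst c"] by (cases c) (simp add: diagram_def)
    qed
    show "apfst (inv p) ` diagram ys \<subseteq> diagram xs"
    proof (intro image_subsetI)
      fix c assume "c \<in> diagram ys"
      then have "fst c < length ys" "snd c < ys ! fst c" by (auto simp: diagram_def)
      then show "apfst (inv p) c \<in> diagram xs"
        using nth[of "inv p (fst c)"] ilt[of "fst c"] ip by (cases c) (simp add: diagram_def len)
    qed
  qed
  moreover have "\<forall>c\<in>diagram xs. apfst p (row_rotation xs c) = row_rotation ys (apfst p c)"
    using nth by (auto simp: diagram_def row_rotation_def len)
  ultimately show thesis using that by (simp add: rotation_model_def)
qed

lemma cycle_type_exists:
  assumes "finite X" "bij_betw w X X"
  shows "\<exists>\<kappa>. \<kappa> \<in> partitions_of (card X) \<and> (\<exists>\<phi>. rotation_model \<kappa> \<phi> X w)"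
proof -
  obtain xs \<phi> where xs: "\<forall>x\<in>set xs. 0 < x" and \<phi>: "rotation_model xs \<phi> X w"
    using rotation_model_exists[OF assms] by blast
  define \<kappa> where "\<kappa> = rev (sort xs)"
  have "mset \<kappa> = mset xs" by (simp add: \<kappa>_def)
  then obtain \<psi> where \<psi>: "rotation_model \<kappa> \<psi> (diagram xs) (row_rotation xs)"
    using rotation_model_permute by metis
  have "bij_betw \<psi> (diagram \<kappa>) (diagram xs)" "bij_betw \<phi> (diagram xs) X"
    using \<phi> \<psi> by (auto simp: rotation_model_def)
  moreover from this have "\<psi> c \<in> diagram xs" if "c \<in> diagram \<kappa>" for c
    using that by (auto simp: bij_betw_def)
  ultimately have "rotation_model \<kappa> (\<phi> \<circ> \<psi>) X w"
    using \<phi> \<psi> by (auto simp: rotation_model_def intro: bij_betw_trans)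
  moreover have "is_partition \<kappa>"
    using xs by (auto simp: is_partition_def \<kappa>_def sorted_wrt_rev)
  moreover have "sum_list \<kappa> = card X"
    using calculation(1) unfolding card_diagram[symmetric] rotation_model_def by (auto intro: bij_betw_same_card)
  ultimately show ?thesis by (auto simp: partitions_of_def)
qed

lemma fix_series_eq_psums:
  assumes "is_partition \<kappa>" "rotation_model \<kappa> \<phi> X w"
  shows "fix_series X w = psums \<kappa>"
proof -
  have "fix_series (diagram \<kappa>) (row_rotation \<kappa>) = fix_series X w"
    using assms(2) row_rotation_in by (intro fix_series_transport[of \<phi>]) (auto simp: rotation_model_def)
  moreover have "fix_series (diagram \<kappa>) (row_rotation \<kappa>) = psums \<kappa>"
    using assms(1) by (intro fix_series_row_rotation) (auto simp: is_partition_def intro: gr0I)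
  ultimately show ?thesis by simp
qed

section \<open>Counting pairs of fixed fillings\<close>

text \<open>
  The fillings with content \<open>Q\<close> form a single orbit of the permutations of \<open>X\<close>, and Burnside's lemma
  counts one orbit. Concretely, the permutations that fix \<open>T\<close> are as numerous as those that carry a
  chosen filling \<open>T0\<close> to \<open>T\<close>, and every permutation carries \<open>T0\<close> to exactly one filling.
\<close>

lemma sum_card_fillings:
  assumes fin: "finite X" and Q: "size Q = card X"
  shows "(\<Sum>w | w permutes X. card (fillings X w Q)) = fact (card X)"
proof -
  define E where "E = {T \<in> extensional X. image_mset T (mset_set X) = Q}"
  have finE: "finite E"
    by (rule finite_subset[OF _ finite_fillings[OF fin, of id Q]]) (auto simp: E_def fillings_def)
  have finP: "finite {w. w permutes X}" using fin by (rule finite_permutations)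
  \<comment> \<open>any filling with content \<open>Q\<close> serves as the base point of the orbit\<close>
  obtain T0 where T0: "T0 \<in> E"
  proof -
    obtain qs where qs: "Q = mset qs" by (metis ex_mset)
    then obtain h where h: "bij_betw h X {..<length qs}"
      using Q fin by (metis card_lessThan finite_lessThan finite_same_card_bij size_mset)
    have "image_mset (restrict (\<lambda>x. qs ! h x) X) (mset_set X) = image_mset ((!) qs) (image_mset h (mset_set X))"
      unfolding image_mset.compositionality using fin by (intro image_mset_cong) auto
    also have "image_mset h (mset_set X) = mset_set {..<length qs}"
      using h by (simp add: bij_betw_def image_mset_mset_set)
    also have "image_mset ((!) qs) (mset_set {..<length qs}) = Q"
      unfolding qs by (metis map_nth mset_map mset_upt atLeast0LessThan)
    finally have "restrict (\<lambda>x. qs ! h x) X \<in> E" by (simp only: E_def mem_Collect_eq restrict_extensional)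
    then show thesis by (rule that)
  qed
  have stab: "card {w. w permutes X \<and> (\<forall>x\<in>X. T (w x) = T x)} = card {w. w permutes X \<and> (\<forall>x\<in>X. T0 (w x) = T x)}"
    if T: "T \<in> E" for T
  proof -
    have "image_mset T (mset_set X) = image_mset T0 (mset_set X)" using T T0 by (simp add: E_def)
    then obtain p where p: "p permutes X" "\<forall>x\<in>X. T x = T0 (p x)"
      using image_mset_eq_implies_permutes[OF fin] by blast
    have inX: "w x \<in> X" if "w permutes X" "x \<in> X" for w x using that by (simp add: permutes_in_image)
    note ip = permutes_inverses[OF p(1)]
    have "bij_betw (\<lambda>w. p \<circ> w) {w. w permutes X \<and> (\<forall>x\<in>X. T (w x) = T x)} {w. w permutes X \<and> (\<forall>x\<in>X. T0 (w x) = T x)}"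
      by (rule bij_betw_byWitness[where f' = "\<lambda>w. inv p \<circ> w"])
        (use p inX ip permutes_inv[OF p(1)] in \<open>auto simp: fun_eq_iff intro: permutes_compose\<close>)
    then show ?thesis by (rule bij_betw_same_card)
  qed
  have "(\<Sum>w | w permutes X. card (fillings X w Q)) = card (SIGMA w:{w. w permutes X}. fillings X w Q)"
    using finP finite_fillings[OF fin] by (subst card_SigmaI) auto
  also have "\<dots> = card (SIGMA T:E. {w. w permutes X \<and> (\<forall>x\<in>X. T (w x) = T x)})"
    by (rule bij_betw_same_card[of prod.swap], rule bij_betw_byWitness[where f' = prod.swap])
      (auto simp: fillings_def E_def)
  also have "\<dots> = (\<Sum>T\<in>E. card {w. w permutes X \<and> (\<forall>x\<in>X. T (w x) = T x)})"
    using finP finE by (subst card_SigmaI) auto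
  also have "\<dots> = (\<Sum>T\<in>E. card {w. w permutes X \<and> (\<forall>x\<in>X. T0 (w x) = T x)})"
    by (intro sum.cong refl stab)
  also have "\<dots> = card (\<Union>T\<in>E. {w. w permutes X \<and> (\<forall>x\<in>X. T0 (w x) = T x)})"
  proof (rule card_UN_disjoint[symmetric, OF finE])
    show "\<forall>T\<in>E. finite {w. w permutes X \<and> (\<forall>x\<in>X. T0 (w x) = T x)}" using finP by auto
    show "\<forall>T\<in>E. \<forall>T'\<in>E. T \<noteq> T' \<longrightarrow>
        {w. w permutes X \<and> (\<forall>x\<in>X. T0 (w x) = T x)} \<inter> {w. w permutes X \<and> (\<forall>x\<in>X. T0 (w x) = T' x)} = {}"
      by (auto simp: E_def) (metis extensionalityI)
  qed
  also have "(\<Union>T\<in>E. {w. w permutes X \<and> (\<forall>x\<in>X. T0 (w x) = T x)}) = {w. w permutes X}"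
  proof (intro set_eqI iffI)
    fix w assume "w \<in> {w. w permutes X}"
    then have w: "w permutes X" by simp
    have "image_mset (restrict (T0 \<circ> w) X) (mset_set X) = image_mset T0 (image_mset w (mset_set X))"
      unfolding image_mset.compositionality using fin by (intro image_mset_cong) auto
    also have "image_mset w (mset_set X) = mset_set X"
      using w by (simp add: image_mset_mset_set permutes_inj_on permutes_image)
    also have "image_mset T0 (mset_set X) = Q" using T0 by (simp add: E_def)
    finally have "restrict (T0 \<circ> w) X \<in> E" by (simp only: E_def mem_Collect_eq restrict_extensional)
    then show "w \<in> (\<Union>T\<in>E. {w. w permutes X \<and> (\<forall>x\<in>X. T0 (w x) = T x)})" using w by fastforce
  qed auto
  also have "card {w. w permutes X} = fact (card X)" using fin by (simp add: card_permutations)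
  finally show ?thesis .
qed

text \<open>
  Two fillings that are fixed by \<open>w\<close> are one fixed filling whose entries are pairs.
\<close>

lemma card_fillings_pairings:
  assumes fin: "finite X" and w: "\<And>x. x \<in> X \<Longrightarrow> w x \<in> X"
  shows "card (fillings X w M) * card (fillings X w N) = (\<Sum>Q\<in>pairings M N. card (fillings X w Q))"
proof -
  let ?U = "\<Union>Q\<in>pairings M N. fillings X w Q"
  let ?f = "\<lambda>(S, T). restrict (\<lambda>x. (S x, T x)) X"
  let ?g = "\<lambda>U. (restrict (fst \<circ> U) X, restrict (snd \<circ> U) X)"
  have "bij_betw ?f (fillings X w M \<times> fillings X w N) ?U"
  proof (rule bij_betw_byWitness[where f' = ?g])
    show "\<forall>a\<in>fillings X w M \<times> fillings X w N. ?g (?f a) = a"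
      by (auto simp: fillings_def extensional_def fun_eq_iff)
    show "\<forall>U\<in>?U. ?f (?g U) = U"
      by (auto simp: fillings_def extensional_def fun_eq_iff)
    show "?f ` (fillings X w M \<times> fillings X w N) \<subseteq> ?U"
    proof (intro image_subsetI)
      fix a assume "a \<in> fillings X w M \<times> fillings X w N"
      then obtain S T where a: "a = (S, T)" "S \<in> fillings X w M" "T \<in> fillings X w N" by auto
      define Q where "Q = image_mset (\<lambda>x. (S x, T x)) (mset_set X)"
      have "Q \<in> pairings M N"
        using a by (auto simp: Q_def pairings_def fillings_def image_mset.compositionality comp_def)
      moreover have "?f a \<in> fillings X w Q"
        unfolding fillings_def using a w
        by (auto simp: Q_def fillings_def fin intro!: image_mset_cong)
      ultimately show "?f a \<in> ?U" by blast
    qed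
    show "?g ` ?U \<subseteq> fillings X w M \<times> fillings X w N"
    proof (intro image_subsetI)
      fix U assume "U \<in> ?U"
      then obtain Q where Q: "image_mset fst Q = M" "image_mset snd Q = N" "image_mset U (mset_set X) = Q"
        and U: "\<forall>x\<in>X. U (w x) = U x" by (auto simp: pairings_def fillings_def)
      have "image_mset (restrict (fst \<circ> U) X) (mset_set X) = image_mset (fst \<circ> U) (mset_set X)"
        "image_mset (restrict (snd \<circ> U) X) (mset_set X) = image_mset (snd \<circ> U) (mset_set X)"
        using fin by (auto intro!: image_mset_cong)
      moreover have "image_mset (fst \<circ> U) (mset_set X) = M" "image_mset (snd \<circ> U) (mset_set X) = N"
        using Q by (simp_all flip: image_mset.compositionality)
      ultimately show "?g U \<in> fillings X w M \<times> fillings X w N"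
        using U w by (auto simp: fillings_def)
    qed
  qed
  from bij_betw_same_card[OF this]
  have "card (fillings X w M) * card (fillings X w N) = card ?U"
    by (simp only: card_cartesian_product)
  also have "\<dots> = (\<Sum>Q\<in>pairings M N. card (fillings X w Q))"
  proof (rule card_UN_disjoint[OF finite_pairings])
    show "\<forall>Q\<in>pairings M N. finite (fillings X w Q)" using finite_fillings[OF fin] by blast
    show "\<forall>Q\<in>pairings M N. \<forall>Q'\<in>pairings M N. Q \<noteq> Q' \<longrightarrow> fillings X w Q \<inter> fillings X w Q' = {}"
      by (auto simp: fillings_def)
  qed
  finally show ?thesis .
qed

theorem burnside_pairings:
  assumes fin: "finite X" and M: "size M = card X"
  shows "(\<Sum>w | w permutes X. card (fillings X w M) * card (fillings X w N)) = fact (card X) * card (pairings M N)"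
proof -
  have "(\<Sum>w | w permutes X. card (fillings X w M) * card (fillings X w N)) =
    (\<Sum>w | w permutes X. \<Sum>Q\<in>pairings M N. card (fillings X w Q))"
    by (intro sum.cong refl card_fillings_pairings fin) (simp add: permutes_in_image)
  also have "\<dots> = (\<Sum>Q\<in>pairings M N. \<Sum>w | w permutes X. card (fillings X w Q))"
    by (rule sum.swap)
  also have "\<dots> = (\<Sum>Q\<in>pairings M N. fact (card X))"
  proof (intro sum.cong refl sum_card_fillings fin)
    fix Q assume "Q \<in> pairings M N"
    then have "size Q = size M" by (auto simp: pairings_def)
    then show "size Q = card X" using M by simp
  qed
  finally show ?thesis by simp
qed

section \<open>The Schur basis of the symmetric functions\<close>

definition perm_series :: "nat \<Rightarrow> (nat \<Rightarrow> nat) \<Rightarrow> mser" where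
  "perm_series n w = fix_series {..<n} w"

abbreviation symgrp :: "nat \<Rightarrow> (nat \<Rightarrow> nat) set" where
  "symgrp n \<equiv> {w. w permutes {..<n}}"

lemma symgrp_in: "w \<in> symgrp n \<Longrightarrow> x \<in> {..<n} \<Longrightarrow> w x \<in> {..<n}"
  using permutes_in_image[of w "{..<n}" x] by simp

lemma finite_symgrp: "finite (symgrp n)" by (intro finite_permutations) simp

lemma mcoeff_perm_series_size: "size M \<noteq> n \<Longrightarrow> mcoeff (perm_series n w) M = 0"
proof -
  assume "size M \<noteq> n"
  then have "fillings {..<n} w M = {}" by (auto simp: fillings_def)
  then show ?thesis by (simp add: perm_series_def mcoeff_fix_series)
qed

lemma mcoeff_schur_kostka: "mcoeff (schur \<kappa>) M = of_nat (kostka \<kappa> M)"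
  by (simp add: mcoeff_schur kostka_def)

lemma mcoeff_schur_size: "\<kappa> \<in> partitions_of n \<Longrightarrow> size M \<noteq> n \<Longrightarrow> mcoeff (schur \<kappa>) M = 0"
proof -
  assume "\<kappa> \<in> partitions_of n" "size M \<noteq> n"
  then have "{T \<in> ssyt \<kappa>. content \<kappa> T = M} = {}"
    by (auto simp: content_def card_diagram partitions_of_def)
  then show ?thesis by (simp add: mcoeff_schur del: Collect_empty_eq)
qed

text \<open>
  Both sides count matrices with the row and column sums \<open>M\<close> and \<open>N\<close>: the left one by Burnside's
  lemma, the right one by the Cauchy identity. In symmetric functions this is
  \<open>\<Sum>\<^sub>w p\<^sub>w(x) p\<^sub>w(y) = n! \<Sum>\<^sub>\<kappa> s\<^sub>\<kappa>(x) s\<^sub>\<kappa>(y)\<close>, and it is the source of the character theory below.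
\<close>

lemma cauchy_kernel:
  "(\<Sum>w\<in>symgrp n. mcoeff (perm_series n w) M * mcoeff (perm_series n w) N) =
    fact n * (\<Sum>\<kappa>\<in>partitions_of n. mcoeff (schur \<kappa>) M * mcoeff (schur \<kappa>) N)"
proof (cases "size M = n")
  case True
  have "(\<Sum>w\<in>symgrp n. mcoeff (perm_series n w) M * mcoeff (perm_series n w) N) =
    of_nat (\<Sum>w\<in>symgrp n. card (fillings {..<n} w M) * card (fillings {..<n} w N))"
    by (simp add: perm_series_def mcoeff_fix_series)
  also have "(\<Sum>w\<in>symgrp n. card (fillings {..<n} w M) * card (fillings {..<n} w N)) =
      fact n * (\<Sum>\<kappa>\<in>partitions_of n. kostka \<kappa> M * kostka \<kappa> N)"
    using burnside_pairings[of "{..<n}" M N] True kostka_cauchy[OF True, of N] by simp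
  finally show ?thesis by (simp add: mcoeff_schur_kostka)
next
  case False
  then show ?thesis by (simp add: mcoeff_perm_series_size mcoeff_schur_size)
qed

lemma cauchy_kernel_series:
  "(\<Sum>w\<in>symgrp n. msmult (mcoeff (perm_series n w) N) (perm_series n w)) =
    msmult (fact n) (\<Sum>\<kappa>\<in>partitions_of n. msmult (mcoeff (schur \<kappa>) N) (schur \<kappa>))"
proof (rule mser_eqI)
  fix M
  show "mcoeff (\<Sum>w\<in>symgrp n. msmult (mcoeff (perm_series n w) N) (perm_series n w)) M =
    mcoeff (msmult (fact n) (\<Sum>\<kappa>\<in>partitions_of n. msmult (mcoeff (schur \<kappa>) N) (schur \<kappa>))) M"
    using cauchy_kernel[of n N M] by simp
qed

definition dominates :: "nat list \<Rightarrow> nat list \<Rightarrow> bool" where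
  "dominates \<kappa> \<rho> \<longleftrightarrow> (\<forall>k. sum_list (take k \<rho>) \<le> sum_list (take k \<kappa>))"

text \<open>
  This number grows strictly along the dominance order and serves as an induction measure.
\<close>

definition dominance_rank :: "nat list \<Rightarrow> nat" where
  "dominance_rank \<kappa> = (\<Sum>k\<le>sum_list \<kappa>. sum_list (take k \<kappa>))"

lemma dominates_antisym:
  "is_partition \<kappa> \<Longrightarrow> is_partition \<rho> \<Longrightarrow> dominates \<kappa> \<rho> \<Longrightarrow> dominates \<rho> \<kappa> \<Longrightarrow> \<kappa> = \<rho>"
  by (intro partition_eqI) (auto simp: dominates_def intro: antisym)

lemma length_le_sum_list: "is_partition \<xi> \<Longrightarrow> length \<xi> \<le> sum_list \<xi>"
  by (induction \<xi>) (auto simp: is_partition_def)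

lemma dominance_rank_less:
  assumes "\<kappa> \<in> partitions_of n" "\<rho> \<in> partitions_of n" "dominates \<kappa> \<rho>" "\<kappa> \<noteq> \<rho>"
  shows "dominance_rank \<rho> < dominance_rank \<kappa>"
proof -
  have P: "is_partition \<kappa>" "is_partition \<rho>" "sum_list \<kappa> = n" "sum_list \<rho> = n"
    using assms by (auto simp: partitions_of_def)
  have le: "sum_list (take k \<rho>) \<le> sum_list (take k \<kappa>)" for k using assms(3) by (simp add: dominates_def)
  obtain k where k: "sum_list (take k \<kappa>) \<noteq> sum_list (take k \<rho>)"
    using assms(4) partition_eqI[OF P(1,2)] by blast
  have "k \<le> n"
  proof (rule ccontr)
    assume "\<not> k \<le> n"
    then show False using k length_le_sum_list[OF P(1)] length_le_sum_list[OF P(2)] P by simp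
  qed
  then have "(\<Sum>k\<le>n. sum_list (take k \<rho>)) < (\<Sum>k\<le>n. sum_list (take k \<kappa>))"
    using le k by (intro sum_strict_mono2 sum_strict_mono_ex1) (auto intro!: bexI[of _ k] order.not_eq_order_implies_strict)
  then show ?thesis by (simp add: dominance_rank_def P)
qed

lemma schur_top_dominates:
  "\<kappa> \<in> partitions_of n \<Longrightarrow> mcoeff (schur \<kappa>) (top_content \<rho>) \<noteq> 0 \<Longrightarrow> dominates \<kappa> \<rho>"
  using schur_dominance by (auto simp: dominates_def partitions_of_def)

text \<open>
  Taking the coefficient at \<open>top_content \<rho>\<close> in one of the two sets of variables of the Cauchy kernel
  shows that the span contains a combination of Schur functions with nonzero coefficient at \<open>schur \<rho>\<close>
  whose other members dominate \<open>\<rho>\<close>; these are dealt with by induction. As a consequence Schur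
  functions are symmetric.
\<close>

lemma schur_in_span_perm_series:
  assumes "\<rho> \<in> partitions_of n"
  shows "schur \<rho> \<in> mser.span (perm_series n ` symgrp n)"
proof -
  let ?V = "mser.span (perm_series n ` symgrp n)"
  obtain B where B: "\<And>\<kappa>. \<kappa> \<in> partitions_of n \<Longrightarrow> dominance_rank \<kappa> \<le> B"
    using Max_ge[OF finite_imageI[OF finite_partitions_of]] by (metis imageI)
  show ?thesis using assms
  proof (induction "B - dominance_rank \<rho>" arbitrary: \<rho> rule: less_induct)
    case (less \<rho>)
    let ?c = "\<lambda>\<kappa>. mcoeff (schur \<kappa>) (top_content \<rho>)"
    have "(\<Sum>w\<in>symgrp n. msmult (mcoeff (perm_series n w) (top_content \<rho>)) (perm_series n w)) \<in> ?V"
      by (intro mser.span_sum mser.span_scale mser.span_base) auto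
    then have "msmult (1 / fact n) (msmult (fact n) (\<Sum>\<kappa>\<in>partitions_of n. msmult (?c \<kappa>) (schur \<kappa>))) \<in> ?V"
      unfolding cauchy_kernel_series by (rule mser.span_scale)
    then have all: "(\<Sum>\<kappa>\<in>partitions_of n. msmult (?c \<kappa>) (schur \<kappa>)) \<in> ?V" by simp
    have "msmult (?c \<kappa>) (schur \<kappa>) \<in> ?V" if \<kappa>: "\<kappa> \<in> partitions_of n - {\<rho>}" for \<kappa>
    proof (cases "?c \<kappa> = 0")
      case True
      then show ?thesis by (simp add: mser.span_zero)
    next
      case False
      then have "dominance_rank \<rho> < dominance_rank \<kappa>"
        using \<kappa> less.prems schur_top_dominates[of \<kappa> n \<rho>] by (intro dominance_rank_less[of _ n]) auto
      then have "schur \<kappa> \<in> ?V" using less.hyps[of \<kappa>] \<kappa> B[of \<kappa>] by auto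
      then show ?thesis by (rule mser.span_scale)
    qed
    then have "(\<Sum>\<kappa>\<in>partitions_of n - {\<rho>}. msmult (?c \<kappa>) (schur \<kappa>)) \<in> ?V" by (rule mser.span_sum)
    from mser.span_diff[OF all this] have "msmult (?c \<rho>) (schur \<rho>) \<in> ?V"
      using less.prems by (simp add: sum_diff1)
    then have "msmult (1 / ?c \<rho>) (msmult (?c \<rho>) (schur \<rho>)) \<in> ?V" by (rule mser.span_scale)
    then show ?case using mcoeff_schur_top[of \<rho>] by simp
  qed
qed

lemma subspace_Lambda: "mser.subspace (Lambda n)"
  by (rule mser.subspaceI) (auto simp: Lambda_def, metis add.right_neutral add_0)

lemma card_fillings_image:
  fixes \<sigma> :: "'b \<Rightarrow> 'b"
  assumes "bij \<sigma>" and fin: "finite X" and w: "\<And>x. x \<in> X \<Longrightarrow> w x \<in> X"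
  shows "card (fillings X w (image_mset \<sigma> M)) = card (fillings X w M)"
proof -
  have inv: "inv \<sigma> (\<sigma> y) = y" "\<sigma> (inv \<sigma> y) = y" for y
    using assms(1) by (auto simp: bij_is_inj bij_is_surj surj_f_inv_f)
  have one: "restrict (\<tau> \<circ> T) X \<in> fillings X w (image_mset \<tau> N)" if "T \<in> fillings X w N" for \<tau> T N
  proof -
    have "image_mset (restrict (\<tau> \<circ> T) X) (mset_set X) = image_mset \<tau> (image_mset T (mset_set X))"
      unfolding image_mset.compositionality using fin by (intro image_mset_cong) auto
    then show ?thesis using that w by (auto simp: fillings_def)
  qed
  have recover: "image_mset (inv \<sigma>) (image_mset \<sigma> M) = M"
    by (simp add: image_mset.compositionality comp_def inv)
  have "bij_betw (\<lambda>T. restrict (\<sigma> \<circ> T) X) (fillings X w M) (fillings X w (image_mset \<sigma> M))"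
  proof (rule bij_betw_byWitness[where f' = "\<lambda>T. restrict (inv \<sigma> \<circ> T) X"])
    show "\<forall>a\<in>fillings X w M. restrict (inv \<sigma> \<circ> restrict (\<sigma> \<circ> a) X) X = a"
      "\<forall>a\<in>fillings X w (image_mset \<sigma> M). restrict (\<sigma> \<circ> restrict (inv \<sigma> \<circ> a) X) X = a"
      by (auto simp: fillings_def fun_eq_iff extensional_def inv)
    show "(\<lambda>T. restrict (\<sigma> \<circ> T) X) ` fillings X w M \<subseteq> fillings X w (image_mset \<sigma> M)"
      using one by blast
    show "(\<lambda>T. restrict (inv \<sigma> \<circ> T) X) ` fillings X w (image_mset \<sigma> M) \<subseteq> fillings X w M"
      using one[of _ "image_mset \<sigma> M" "inv \<sigma>"] by (auto simp only: recover image_subset_iff)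
  qed
  then show ?thesis by (metis bij_betw_same_card)
qed

lemma perm_series_in_Lambda: "w \<in> symgrp n \<Longrightarrow> perm_series n w \<in> Lambda n"
proof -
  assume "w \<in> symgrp n"
  then have w: "\<And>x. x \<in> {..<n} \<Longrightarrow> w x \<in> {..<n}" by (rule symgrp_in)
  have "mcoeff (perm_series n w) (image_mset \<sigma> M) = mcoeff (perm_series n w) M" if "bij \<sigma>" for \<sigma> M
    using card_fillings_image[OF that finite_lessThan w] by (simp add: perm_series_def mcoeff_fix_series)
  moreover have "size M = n" if "mcoeff (perm_series n w) M \<noteq> 0" for M
    using that mcoeff_perm_series_size by metis
  ultimately show ?thesis by (simp add: Lambda_def)
qed

lemma schur_in_Lambda:
  assumes "\<kappa> \<in> partitions_of n" shows "schur \<kappa> \<in> Lambda n"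
proof -
  have "mser.span (perm_series n ` symgrp n) \<subseteq> Lambda n"
    by (intro mser.span_minimal subspace_Lambda) (auto intro: perm_series_in_Lambda)
  then show ?thesis using schur_in_span_perm_series[OF assms] by blast
qed

text \<open>
  Two monomials are related by a permutation of the variables if and only if these partitions agree.
\<close>

definition exponents :: "nat multiset \<Rightarrow> nat list" where
  "exponents M = rev (sorted_list_of_multiset (image_mset (count M) (mset_set (set_mset M))))"

lemma exponents_partition: "exponents M \<in> partitions_of (size M)"
proof -
  have "sum_list (exponents M) = sum_mset (mset (exponents M))" by (simp add: sum_mset_sum_list)
  also have "\<dots> = (\<Sum>x\<in>set_mset M. count M x)" by (simp add: exponents_def sum_unfold_sum_mset)
  also have "\<dots> = size M" by (simp add: size_multiset_overloaded_eq)
  finally have "sum_list (exponents M) = size M" .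
  moreover have "0 \<notin> count M ` set_mset M"
  proof
    assume "0 \<in> count M ` set_mset M"
    then obtain x where "x \<in># M" "count M x = 0" by (metis imageE)
    then show False by (simp add: not_in_iff[symmetric])
  qed
  then have "0 \<notin> set (exponents M)" by (simp add: exponents_def)
  moreover have "sorted_wrt (\<ge>) (exponents M)" by (simp add: exponents_def sorted_wrt_rev)
  ultimately show ?thesis by (simp add: partitions_of_def is_partition_def)
qed

lemma exponents_eq_imp_image:
  assumes "exponents M = exponents N"
  obtains \<sigma> where "bij \<sigma>" "image_mset \<sigma> M = N"
proof -
  let ?A = "set_mset M \<union> set_mset N"
  have eq: "image_mset (count M) (mset_set (set_mset M)) = image_mset (count N) (mset_set (set_mset N))"
    using arg_cong[OF assms, of mset] by (simp add: exponents_def)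
  have size: "card (set_mset M) = card (set_mset N)" using arg_cong[OF eq, of size] by simp
  have ext: "image_mset (count L) (mset_set ?A) =
      image_mset (count L) (mset_set (set_mset L)) + replicate_mset (card ?A - card (set_mset L)) 0"
    if "set_mset L \<subseteq> ?A" for L
  proof -
    have "mset_set ?A = mset_set (set_mset L) + mset_set (?A - set_mset L)"
      using that by (metis Diff_disjoint Un_Diff_cancel finite_Diff finite_UnI finite_set_mset mset_set_Union sup.absorb2)
    moreover have "image_mset (count L) (mset_set (?A - set_mset L)) = image_mset (\<lambda>_. 0) (mset_set (?A - set_mset L))"
      by (intro image_mset_cong) (auto simp: not_in_iff)
    moreover have "card (?A - set_mset L) = card ?A - card (set_mset L)"
      using that by (intro card_Diff_subset) auto
    ultimately show ?thesis by (simp add: image_mset_const_eq)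
  qed
  have "image_mset (count M) (mset_set ?A) = image_mset (count N) (mset_set ?A)"
    using ext[of M] ext[of N] eq size by simp
  then obtain p where p: "p permutes ?A" "\<forall>x\<in>?A. count M x = count N (p x)"
    using image_mset_eq_implies_permutes[of ?A "count M" "count N"] by auto
  have c: "count M x = count N (p x)" for x
  proof (cases "x \<in> ?A")
    case False
    then show ?thesis using permutes_not_in[OF p(1)] by (auto simp: not_in_iff)
  qed (use p in blast)
  have "image_mset p M = N"
  proof (rule multiset_eqI)
    fix y
    have "p -` {y} = {inv p y}" using permutes_inverses[OF p(1)] by auto
    then have "count (image_mset p M) y = count M (inv p y)"
      by (cases "inv p y \<in># M") (auto simp: count_image_mset not_in_iff)
    then show "count (image_mset p M) y = count N y"
      using c[of "inv p y"] permutes_inverses[OF p(1)] by simp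
  qed
  then show thesis using that permutes_bij[OF p(1)] by blast
qed

text \<open>
  The monomial symmetric functions span, and there is one of them for each partition.
\<close>

lemma Lambda_subset_span_small:
  obtains S where "finite S" "card S \<le> card (partitions_of n)" "Lambda n \<subseteq> mser.span S"
proof -
  define mono where "mono \<mu> = Abs_mser (\<lambda>M. if size M = n \<and> exponents M = \<mu> then 1 else 0)" for \<mu>
  have mono: "mcoeff (mono \<mu>) M = (if size M = n \<and> exponents M = \<mu> then 1 else 0)" for \<mu> M
    by (simp add: mono_def Abs_mser_inverse)
  have "F \<in> mser.span (mono ` partitions_of n)" if F: "F \<in> Lambda n" for F
  proof -
    have sym: "mcoeff F M = mcoeff F N" if "exponents M = exponents N" for M N
      using exponents_eq_imp_image[OF that] F by (metis (mono_tags, lifting) Lambda_def mem_Collect_eq)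
    define c where "c \<mu> = mcoeff F (SOME M. exponents M = \<mu>)" for \<mu>
    have c: "c (exponents M) = mcoeff F M" for M
      unfolding c_def by (rule sym) (rule someI[of "\<lambda>N. exponents N = exponents M" M], rule refl)
    have "F = (\<Sum>\<mu>\<in>partitions_of n. msmult (c \<mu>) (mono \<mu>))"
    proof (rule mser_eqI)
      fix M
      have "mcoeff (\<Sum>\<mu>\<in>partitions_of n. msmult (c \<mu>) (mono \<mu>)) M =
        (\<Sum>\<mu>\<in>partitions_of n. c \<mu> * mcoeff (mono \<mu>) M)" by simp
      also have "\<dots> = (\<Sum>\<mu>\<in>partitions_of n. if exponents M = \<mu> then (if size M = n then c \<mu> else 0) else 0)"
        by (intro sum.cong refl) (simp add: mono)
      also have "\<dots> = (if size M = n then c (exponents M) else 0)"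
        using exponents_partition[of M] by (subst sum.delta') auto
      also have "\<dots> = mcoeff F M" using F by (auto simp: c Lambda_def)
      finally show "mcoeff F M = mcoeff (\<Sum>\<mu>\<in>partitions_of n. msmult (c \<mu>) (mono \<mu>)) M" by simp
    qed
    also have "\<dots> \<in> mser.span (mono ` partitions_of n)"
      by (intro mser.span_sum mser.span_scale mser.span_base) auto
    finally show ?thesis .
  qed
  then show thesis
    by (intro that[of "mono ` partitions_of n"]) (auto intro: card_image_le)
qed

lemma card_schur_basis: "card (schur ` partitions_of n) = card (partitions_of n)"
  by (rule card_image[OF inj_on_schur])

text \<open>
  The Schur functions of degree \<open>n\<close> are independent elements of a space spanned by equally many
  elements.
\<close>

lemma Lambda_subset_span_schur: "Lambda n \<subseteq> mser.span (schur ` partitions_of n)"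
proof
  fix F assume F: "F \<in> Lambda n"
  obtain S where S: "finite S" "card S \<le> card (partitions_of n)" "Lambda n \<subseteq> mser.span S"
    using Lambda_subset_span_small by blast
  show "F \<in> mser.span (schur ` partitions_of n)"
  proof (rule ccontr)
    assume nin: "F \<notin> mser.span (schur ` partitions_of n)"
    then have ind: "\<not> mser.dependent (insert F (schur ` partitions_of n))"
      using independent_schur by (rule mser.independent_insertI)
    have "insert F (schur ` partitions_of n) \<subseteq> mser.span S"
      using S(3) F schur_in_Lambda by blast
    then have "card (insert F (schur ` partitions_of n)) \<le> card S"
      using mser.independent_span_bound[OF S(1) ind] by blast
    moreover have "F \<notin> schur ` partitions_of n" using nin mser.span_base by blast
    ultimately show False using S(2) by (simp add: card_schur_basis)
  qed
qed

section \<open>Schur coordinates and characters\<close>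

definition schur_coord :: "nat \<Rightarrow> mser \<Rightarrow> nat list \<Rightarrow> complex" where
  "schur_coord n F \<kappa> = mser.representation (schur ` partitions_of n) F (schur \<kappa>)"

lemma class_prod_coord:
  "class_prod n F G = (\<Sum>\<kappa>\<in>partitions_of n.
     msmult (schur_coord n F \<kappa> * schur_coord n G \<kappa> / of_nat (num_syt \<kappa>)) (schur \<kappa>))"
  by (simp add: class_prod_def schur_coord_def Let_def)

lemma schur_combination_eqD:
  assumes "(\<Sum>\<kappa>\<in>partitions_of n. msmult (a \<kappa>) (schur \<kappa>)) = (\<Sum>\<kappa>\<in>partitions_of n. msmult (b \<kappa>) (schur \<kappa>))"
    "\<kappa> \<in> partitions_of n"
  shows "a \<kappa> = b \<kappa>"
proof -
  have "(\<Sum>\<kappa>\<in>partitions_of n. msmult (a \<kappa> - b \<kappa>) (schur \<kappa>)) = 0"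
    using assms(1) by (simp add: mser.scale_left_diff_distrib sum_subtractf)
  from schur_combination_eq_0[OF this assms(2)] show ?thesis by simp
qed

lemma schur_expansion:
  assumes "F \<in> Lambda n"
  shows "(\<Sum>\<kappa>\<in>partitions_of n. msmult (schur_coord n F \<kappa>) (schur \<kappa>)) = F"
proof -
  have "(\<Sum>b\<in>schur ` partitions_of n. msmult (mser.representation (schur ` partitions_of n) F b) b) = F"
    using assms Lambda_subset_span_schur independent_schur
    by (intro mser.sum_representation_eq) auto
  then show ?thesis by (simp add: schur_coord_def sum.reindex[OF inj_on_schur])
qed

lemma schur_combination_in_Lambda: "(\<Sum>\<kappa>\<in>partitions_of n. msmult (a \<kappa>) (schur \<kappa>)) \<in> Lambda n"
  by (intro mser.subspace_sum mser.subspace_scale subspace_Lambda schur_in_Lambda)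

lemma schur_coord_combination:
  assumes "\<kappa> \<in> partitions_of n"
  shows "schur_coord n (\<Sum>\<kappa>\<in>partitions_of n. msmult (a \<kappa>) (schur \<kappa>)) \<kappa> = a \<kappa>"
  by (rule schur_combination_eqD[OF schur_expansion[OF schur_combination_in_Lambda] assms])

lemma class_prod_combination:
  "class_prod n (\<Sum>\<kappa>\<in>partitions_of n. msmult (a \<kappa>) (schur \<kappa>)) (\<Sum>\<kappa>\<in>partitions_of n. msmult (b \<kappa>) (schur \<kappa>))
    = (\<Sum>\<kappa>\<in>partitions_of n. msmult (a \<kappa> * b \<kappa> / of_nat (num_syt \<kappa>)) (schur \<kappa>))"
  unfolding class_prod_coord by (intro sum.cong refl) (simp add: schur_coord_combination)

text \<open>
  Frobenius' formula \<open>p\<^sub>w = \<Sum>\<^sub>\<kappa> \<chi>\<^sup>\<kappa>(w) s\<^sub>\<kappa>\<close> is taken as the definition of the irreducible characters.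
\<close>

definition character :: "nat \<Rightarrow> nat list \<Rightarrow> (nat \<Rightarrow> nat) \<Rightarrow> complex" where
  "character n \<kappa> w = schur_coord n (perm_series n w) \<kappa>"

lemma perm_series_expansion:
  "w \<in> symgrp n \<Longrightarrow> perm_series n w = (\<Sum>\<kappa>\<in>partitions_of n. msmult (character n \<kappa> w) (schur \<kappa>))"
  using schur_expansion[OF perm_series_in_Lambda] by (simp add: character_def)

text \<open>
  Compare the coefficients of \<open>schur \<kappa>\<close> on both sides of \<open>cauchy_kernel_series\<close>.
\<close>

lemma sum_character_mcoeff:
  assumes "\<kappa> \<in> partitions_of n"
  shows "(\<Sum>w\<in>symgrp n. character n \<kappa> w * mcoeff (perm_series n w) N) = fact n * mcoeff (schur \<kappa>) N"
proof (rule schur_combination_eqD[OF _ assms])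
  have "(\<Sum>\<kappa>\<in>partitions_of n. msmult (\<Sum>w\<in>symgrp n. character n \<kappa> w * mcoeff (perm_series n w) N) (schur \<kappa>)) =
    (\<Sum>\<kappa>\<in>partitions_of n. \<Sum>w\<in>symgrp n. msmult (mcoeff (perm_series n w) N) (msmult (character n \<kappa> w) (schur \<kappa>)))"
    by (simp add: mser.scale_sum_left mult.commute)
  also have "\<dots> = (\<Sum>w\<in>symgrp n. \<Sum>\<kappa>\<in>partitions_of n. msmult (mcoeff (perm_series n w) N) (msmult (character n \<kappa> w) (schur \<kappa>)))"
    by (rule sum.swap)
  also have "\<dots> = (\<Sum>w\<in>symgrp n. msmult (mcoeff (perm_series n w) N) (perm_series n w))"
    by (intro sum.cong refl) (simp only: perm_series_expansion mser.scale_sum_right)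
  also have "\<dots> = (\<Sum>\<kappa>\<in>partitions_of n. msmult (fact n * mcoeff (schur \<kappa>) N) (schur \<kappa>))"
    by (simp add: cauchy_kernel_series mser.scale_sum_right)
  finally show "(\<Sum>\<kappa>\<in>partitions_of n. msmult (\<Sum>w\<in>symgrp n. character n \<kappa> w * mcoeff (perm_series n w) N) (schur \<kappa>)) =
    (\<Sum>\<kappa>\<in>partitions_of n. msmult (fact n * mcoeff (schur \<kappa>) N) (schur \<kappa>))" .
qed

lemma sum_character_perm_series:
  assumes "\<kappa> \<in> partitions_of n"
  shows "(\<Sum>w\<in>symgrp n. msmult (character n \<kappa> w) (perm_series n w)) = msmult (fact n) (schur \<kappa>)"
  by (rule mser_eqI) (simp add: sum_character_mcoeff[OF assms])

lemma character_orthogonality: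
  assumes "\<kappa> \<in> partitions_of n" "\<rho> \<in> partitions_of n"
  shows "(\<Sum>w\<in>symgrp n. character n \<kappa> w * character n \<rho> w) = (if \<rho> = \<kappa> then fact n else 0)"
proof (rule schur_combination_eqD[OF _ assms(2)])
  have "(\<Sum>\<rho>\<in>partitions_of n. msmult (\<Sum>w\<in>symgrp n. character n \<kappa> w * character n \<rho> w) (schur \<rho>)) =
    (\<Sum>\<rho>\<in>partitions_of n. \<Sum>w\<in>symgrp n. msmult (character n \<kappa> w) (msmult (character n \<rho> w) (schur \<rho>)))"
    by (simp add: mser.scale_sum_left)
  also have "\<dots> = (\<Sum>w\<in>symgrp n. \<Sum>\<rho>\<in>partitions_of n. msmult (character n \<kappa> w) (msmult (character n \<rho> w) (schur \<rho>)))"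
    by (rule sum.swap)
  also have "\<dots> = (\<Sum>w\<in>symgrp n. msmult (character n \<kappa> w) (perm_series n w))"
    by (intro sum.cong refl) (simp only: perm_series_expansion mser.scale_sum_right)
  also have "\<dots> = msmult (fact n) (schur \<kappa>)" by (rule sum_character_perm_series[OF assms(1)])
  also have "\<dots> = (\<Sum>\<rho>\<in>partitions_of n. if \<rho> = \<kappa> then msmult (fact n) (schur \<kappa>) else 0)"
    using assms(1) by (simp add: sum.delta)
  also have "\<dots> = (\<Sum>\<rho>\<in>partitions_of n. msmult (if \<rho> = \<kappa> then fact n else 0) (schur \<rho>))"
    by (intro sum.cong refl) auto
  finally show "(\<Sum>\<rho>\<in>partitions_of n. msmult (\<Sum>w\<in>symgrp n. character n \<kappa> w * character n \<rho> w) (schur \<rho>)) =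
    (\<Sum>\<rho>\<in>partitions_of n. msmult (if \<rho> = \<kappa> then fact n else 0) (schur \<rho>))" .
qed

lemma perm_series_conj:
  assumes "g \<in> symgrp n" "w \<in> symgrp n"
  shows "perm_series n (g \<circ> w \<circ> inv g) = perm_series n w"
proof -
  have g: "bij_betw g {..<n} {..<n}" "inv g (g x) = x" for x
    using assms by (auto simp: permutes_imp_bij permutes_inverses)
  show ?thesis unfolding perm_series_def
  proof (rule fix_series_transport[symmetric, OF g(1)])
    show "g (w x) = (g \<circ> w \<circ> inv g) (g x)" for x using g(2) by simp
    show "x \<in> {..<n} \<Longrightarrow> w x \<in> {..<n}" for x using assms(2) by (rule symgrp_in)
  qed
qed

lemma perm_series_inverse:
  assumes "w \<in> symgrp n"
  shows "perm_series n (inv w) = perm_series n w"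
proof -
  have w: "w permutes {..<n}" using assms by simp
  have "(\<forall>x\<in>{..<n}. T (inv w x) = T x) \<longleftrightarrow> (\<forall>x\<in>{..<n}. T (w x) = T x)" for T :: "nat \<Rightarrow> nat"
    using permutes_in_image[OF w] permutes_in_image[OF permutes_inv[OF w]] permutes_inverses[OF w] by metis
  then have "fillings {..<n} (inv w) M = fillings {..<n} w M" for M :: "nat multiset"
    by (simp add: fillings_def)
  then show ?thesis by (intro mser_eqI) (simp add: perm_series_def mcoeff_fix_series)
qed

text \<open>
  A semistandard tableau in which each of the letters \<open>0, \<dots>, n - 1\<close> occurs once is a standard tableau
  with all entries lowered by one.
\<close>

lemma mcoeff_schur_standard: "\<kappa> \<in> partitions_of n \<Longrightarrow> mcoeff (schur \<kappa>) (mset_set {..<n}) = of_nat (num_syt \<kappa>)"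
proof -
  assume \<kappa>: "\<kappa> \<in> partitions_of n"
  have n: "sum_list \<kappa> = n" using \<kappa> by (simp add: partitions_of_def)
  let ?S = "{T \<in> ssyt \<kappa>. content \<kappa> T = mset_set {..<n}}"
  have bij: "bij_betw T (diagram \<kappa>) {..<n}" if "T \<in> ?S" for T
  proof -
    have eq: "image_mset T (mset_set (diagram \<kappa>)) = mset_set {..<n}" using that by (simp add: content_def)
    then have im: "T ` diagram \<kappa> = {..<n}" using arg_cong[OF eq, of set_mset, unfolded set_image_mset] by simp
    moreover have "inj_on T (diagram \<kappa>)"
      using im by (intro eq_card_imp_inj_on) (simp_all add: card_diagram n)
    ultimately show ?thesis by (simp add: bij_betw_def)
  qed
  have "bij_betw (\<lambda>T. restrict (\<lambda>c. Suc (T c)) (diagram \<kappa>)) ?S (syt \<kappa>)"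
  proof (rule bij_betw_byWitness[where f' = "\<lambda>T. restrict (\<lambda>c. T c - 1) (diagram \<kappa>)"])
    show "\<forall>T\<in>?S. restrict (\<lambda>c. restrict (\<lambda>c. Suc (T c)) (diagram \<kappa>) c - 1) (diagram \<kappa>) = T"
    proof (intro ballI ext)
      fix T c assume "T \<in> ?S"
      then have "T \<in> extensional (diagram \<kappa>)" by (simp add: ssyt_def)
      then show "restrict (\<lambda>c. restrict (\<lambda>c. Suc (T c)) (diagram \<kappa>) c - 1) (diagram \<kappa>) c = T c"
        by (cases c) (simp add: restrict_def extensional_def)
    qed
    have pos: "Suc (T c - Suc 0) = T c" if "T \<in> syt \<kappa>" "c \<in> diagram \<kappa>" for T c
    proof -
      have "T c \<in> {1..sum_list \<kappa>}" using that unfolding syt_def bij_betw_def by blast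
      then show ?thesis by simp
    qed
    show "\<forall>T\<in>syt \<kappa>. restrict (\<lambda>c. Suc (restrict (\<lambda>c. T c - 1) (diagram \<kappa>) c)) (diagram \<kappa>) = T"
    proof (intro ballI ext)
      fix T c assume T: "T \<in> syt \<kappa>"
      then have "T \<in> extensional (diagram \<kappa>)" by (simp add: syt_def)
      then show "restrict (\<lambda>c. Suc (restrict (\<lambda>c. T c - 1) (diagram \<kappa>) c)) (diagram \<kappa>) c = T c"
        using pos[OF T, of c] by (cases c) (simp add: restrict_def extensional_def)
    qed
    show "(\<lambda>T. restrict (\<lambda>c. Suc (T c)) (diagram \<kappa>)) ` ?S \<subseteq> syt \<kappa>"
    proof (intro image_subsetI)
      fix T assume T: "T \<in> ?S"
      have "bij_betw (Suc \<circ> T) (diagram \<kappa>) {1..n}"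
        by (rule bij_betw_trans[OF bij[OF T]]) (auto simp: bij_betw_def image_Suc_lessThan)
      then have b: "bij_betw (restrict (\<lambda>c. Suc (T c)) (diagram \<kappa>)) (diagram \<kappa>) {1..n}"
        by (rule bij_betw_cong[THEN iffD1, rotated]) simp
      have rows: "\<forall>i j j'. (i, j) \<in> diagram \<kappa> \<and> (i, j') \<in> diagram \<kappa> \<and> j < j' \<longrightarrow> T (i, j) \<le> T (i, j')"
        and cols: "\<forall>i i' j. (i, j) \<in> diagram \<kappa> \<and> (i', j) \<in> diagram \<kappa> \<and> i < i' \<longrightarrow> T (i, j) < T (i', j)"
        using T by (simp_all add: ssyt_def)
      have inj: "T (i, j) \<noteq> T (i, j')" if "(i, j) \<in> diagram \<kappa>" "(i, j') \<in> diagram \<kappa>" "j < j'" for i j j'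
        using bij[OF T] that by (metis Pair_inject bij_betw_def inj_onD less_irrefl)
      have "\<forall>i j j'. (i, j) \<in> diagram \<kappa> \<and> (i, j') \<in> diagram \<kappa> \<and> j < j' \<longrightarrow> T (i, j) < T (i, j')"
        using rows inj by (meson order.not_eq_order_implies_strict)
      then show "restrict (\<lambda>c. Suc (T c)) (diagram \<kappa>) \<in> syt \<kappa>"
        using b cols by (simp add: syt_def n)
    qed
    show "(\<lambda>T. restrict (\<lambda>c. T c - 1) (diagram \<kappa>)) ` syt \<kappa> \<subseteq> ?S"
    proof (intro image_subsetI CollectI conjI)
      fix T assume T: "T \<in> syt \<kappa>"
      have rows: "\<forall>i j j'. (i, j) \<in> diagram \<kappa> \<and> (i, j') \<in> diagram \<kappa> \<and> j < j' \<longrightarrow> T (i, j) < T (i, j')"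
        and cols: "\<forall>i i' j. (i, j) \<in> diagram \<kappa> \<and> (i', j) \<in> diagram \<kappa> \<and> i < i' \<longrightarrow> T (i, j) < T (i', j)"
        and b: "bij_betw T (diagram \<kappa>) {1..n}"
        using T by (simp_all add: syt_def n)
      have p: "0 < T c" if "c \<in> diagram \<kappa>" for c using pos[OF T that] by linarith
      show "restrict (\<lambda>c. T c - 1) (diagram \<kappa>) \<in> ssyt \<kappa>"
        unfolding ssyt_def
      proof (intro CollectI conjI allI impI)
        fix i j j' assume *: "(i, j) \<in> diagram \<kappa> \<and> (i, j') \<in> diagram \<kappa> \<and> j < j'"
        then have "T (i, j) < T (i, j')" using rows by blast
        then show "restrict (\<lambda>c. T c - 1) (diagram \<kappa>) (i, j) \<le> restrict (\<lambda>c. T c - 1) (diagram \<kappa>) (i, j')"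
          using * by simp
      next
        fix i i' j assume *: "(i, j) \<in> diagram \<kappa> \<and> (i', j) \<in> diagram \<kappa> \<and> i < i'"
        then have "T (i, j) < T (i', j)" using cols by blast
        then show "restrict (\<lambda>c. T c - 1) (diagram \<kappa>) (i, j) < restrict (\<lambda>c. T c - 1) (diagram \<kappa>) (i', j)"
          using * p[of "(i, j)"] by simp
      qed simp
      have "image_mset (restrict (\<lambda>c. T c - 1) (diagram \<kappa>)) (mset_set (diagram \<kappa>)) =
          image_mset (\<lambda>v. v - 1) (image_mset T (mset_set (diagram \<kappa>)))"
        unfolding image_mset.compositionality by (intro image_mset_cong) auto
      also have "image_mset T (mset_set (diagram \<kappa>)) = mset_set {1..n}"
        using b by (simp add: bij_betw_def image_mset_mset_set)
      also have "image_mset (\<lambda>v. v - 1) (mset_set {1..n}) = mset_set ((\<lambda>v. v - 1) ` {1..n})"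
        by (rule image_mset_mset_set) (auto simp: inj_on_def)
      also have "(\<lambda>v. v - 1) ` {1..n} = {..<n}"
        by (auto simp: image_iff intro!: bexI[of _ "Suc _"])
      finally show "content \<kappa> (restrict (\<lambda>c. T c - 1) (diagram \<kappa>)) = mset_set {..<n}"
        unfolding content_def .
    qed
  qed
  from bij_betw_same_card[OF this] show ?thesis unfolding mcoeff_schur num_syt_def by (rule arg_cong)
qed

lemma mcoeff_perm_series_standard:
  assumes "w \<in> symgrp n"
  shows "mcoeff (perm_series n w) (mset_set {..<n}) = (if w = id then fact n else 0)"
proof -
  have zero: "mcoeff (perm_series n v) (mset_set {..<n}) = 0" if v: "v \<in> symgrp n" "v \<noteq> id" for v
  proof -
    have "T \<notin> fillings {..<n} v (mset_set {..<n})" for T :: "nat \<Rightarrow> nat"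
    proof
      assume T: "T \<in> fillings {..<n} v (mset_set {..<n})"
      then have eq: "image_mset T (mset_set {..<n}) = mset_set {..<n}" by (simp add: fillings_def)
      then have "T ` {..<n} = {..<n}" using arg_cong[OF eq, of set_mset, unfolded set_image_mset] by simp
      then have "inj_on T {..<n}" by (intro eq_card_imp_inj_on) simp_all
      moreover have "\<forall>x\<in>{..<n}. T (v x) = T x" using T by (simp add: fillings_def)
      ultimately have "v x = x" if "x \<in> {..<n}" for x
        using that v(1) permutes_in_image[of v "{..<n}" x] unfolding inj_on_def by blast
      then have "v = id" using v(1) permutes_not_in[of v "{..<n}"] by (intro ext) (metis id_apply mem_Collect_eq)
      then show False using v(2) by simp
    qed
    then have "fillings {..<n} v (mset_set {..<n}) = ({} :: (nat \<Rightarrow> nat) set)" by blast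
    then show ?thesis by (simp add: perm_series_def mcoeff_fix_series)
  qed
  have "(\<Sum>v\<in>symgrp n. card (fillings {..<n} v (mset_set {..<n}))) = fact n"
    using sum_card_fillings[of "{..<n}" "mset_set {..<n}"] by simp
  then have "of_nat (\<Sum>v\<in>symgrp n. card (fillings {..<n} v (mset_set {..<n}))) = (of_nat (fact n) :: complex)"
    by (rule arg_cong)
  then have "fact n = (\<Sum>v\<in>symgrp n. mcoeff (perm_series n v) (mset_set {..<n}))"
    by (simp add: perm_series_def mcoeff_fix_series)
  also have "\<dots> = (\<Sum>v\<in>{id}. mcoeff (perm_series n v) (mset_set {..<n}))"
    using zero by (intro sum.mono_neutral_right finite_symgrp) (auto simp: permutes_id)
  finally show ?thesis using zero assms by auto
qed

text \<open>
  The coefficient of \<open>y\<^sub>0 \<cdots> y\<^sub>n\<^sub>-\<^sub>1\<close> in the Cauchy kernel: a filling with distinct entries is fixed by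
  the identity only.
\<close>

lemma perm_series_id: "perm_series n id = (\<Sum>\<kappa>\<in>partitions_of n. msmult (of_nat (num_syt \<kappa>)) (schur \<kappa>))"
proof -
  let ?N = "mset_set {..<n}"
  have "msmult (fact n) (perm_series n id) =
      (\<Sum>w\<in>symgrp n. if w = id then msmult (fact n) (perm_series n w) else 0)"
    using finite_symgrp[of n] by (simp add: sum.delta permutes_id)
  also have "\<dots> = (\<Sum>w\<in>symgrp n. msmult (mcoeff (perm_series n w) ?N) (perm_series n w))"
    by (intro sum.cong refl) (simp add: mcoeff_perm_series_standard)
  also have "\<dots> = msmult (fact n) (\<Sum>\<kappa>\<in>partitions_of n. msmult (of_nat (num_syt \<kappa>)) (schur \<kappa>))"
    unfolding cauchy_kernel_series by (intro arg_cong[of _ _ "msmult _"] sum.cong refl) (simp add: mcoeff_schur_standard)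
  finally show ?thesis by simp
qed

lemma sum_num_syt_character:
  assumes "w \<in> symgrp n"
  shows "(\<Sum>\<kappa>\<in>partitions_of n. of_nat (num_syt \<kappa>) * character n \<kappa> w) = (if w = id then fact n else 0)"
proof -
  have "(\<Sum>\<kappa>\<in>partitions_of n. of_nat (num_syt \<kappa>) * character n \<kappa> w) =
    (\<Sum>\<kappa>\<in>partitions_of n. character n \<kappa> w * mcoeff (schur \<kappa>) (mset_set {..<n}))"
    by (intro sum.cong refl) (simp add: mcoeff_schur_standard)
  also have "\<dots> = mcoeff (perm_series n w) (mset_set {..<n})"
    by (simp add: perm_series_expansion[OF assms])
  finally show ?thesis by (simp add: mcoeff_perm_series_standard[OF assms])
qed

section \<open>Class functions\<close>

text \<open>
  The power sums of degree \<open>n\<close> span the independent Schur functions and are not more numerous.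
\<close>

lemma psums_independent:
  assumes "(\<Sum>\<mu>\<in>partitions_of n. msmult (c \<mu>) (psums \<mu>)) = 0" "\<mu> \<in> partitions_of n"
  shows "c \<mu> = 0"
proof -
  let ?P = "psums ` partitions_of n"
  have "perm_series n w \<in> ?P" if "w \<in> symgrp n" for w
  proof -
    have "bij_betw w {..<n} {..<n}" using that by (simp add: permutes_imp_bij)
    from cycle_type_exists[OF _ this] obtain \<kappa> \<phi> where "\<kappa> \<in> partitions_of n" "rotation_model \<kappa> \<phi> {..<n} w"
      by auto
    then show ?thesis using fix_series_eq_psums[of \<kappa> \<phi>] by (auto simp: partitions_of_def perm_series_def)
  qed
  then have "mser.span (perm_series n ` symgrp n) \<subseteq> mser.span ?P" by (intro mser.span_mono) auto
  then have sub: "schur ` partitions_of n \<subseteq> mser.span ?P" using schur_in_span_perm_series by blast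
  have bound: "card (partitions_of n) \<le> card S" if "finite S" "schur ` partitions_of n \<subseteq> mser.span S" for S
    using mser.independent_span_bound[OF that(1) independent_schur that(2)] by (simp add: card_schur_basis)
  have "card ?P = card (partitions_of n)"
    using bound[OF _ sub] card_image_le[of "partitions_of n" psums] by simp
  then have inj: "inj_on psums (partitions_of n)" by (simp add: eq_card_imp_inj_on)
  have ind: "\<not> mser.dependent ?P"
  proof
    assume "mser.dependent ?P"
    then obtain a where a: "a \<in> ?P" "a \<in> mser.span (?P - {a})" by (auto simp: mser.dependent_def)
    then have "mser.span (?P - {a}) = mser.span ?P" using mser.span_redundant[OF a(2)] by (simp add: insert_absorb)
    then have "card (partitions_of n) \<le> card (?P - {a})" using bound[of "?P - {a}"] sub by simp
    moreover have "card (?P - {a}) < card ?P" using a(1) by (intro psubset_card_mono) auto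
    ultimately show False using \<open>card ?P = card (partitions_of n)\<close> by simp
  qed
  define u where "u = c \<circ> inv_into (partitions_of n) psums"
  have u: "u (psums \<mu>) = c \<mu>" if "\<mu> \<in> partitions_of n" for \<mu> using that inj by (simp add: u_def)
  have "(\<Sum>v\<in>?P. msmult (u v) v) = 0" using assms(1) by (simp add: sum.reindex[OF inj] u)
  then have "u (psums \<mu>) = 0" using ind assms(2) by (auto simp: mser.dependent_finite)
  then show ?thesis using u assms(2) by simp
qed

text \<open>
  Grouping the sum by cycle type gives a combination of independent power sums. Its coefficients are
  the sums of \<open>f\<close> over the conjugacy classes, since permutations of equal cycle type are conjugate
  through their rotation models.
\<close>

lemma class_function_eq_0:
  assumes cls: "\<And>g w. g \<in> symgrp n \<Longrightarrow> w \<in> symgrp n \<Longrightarrow> f (g \<circ> w \<circ> inv g) = f w"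
    and sum0: "(\<Sum>w\<in>symgrp n. msmult (f w) (perm_series n w)) = 0" and w: "w \<in> symgrp n"
  shows "f w = 0"
proof -
  have "\<exists>\<kappa>. \<kappa> \<in> partitions_of n \<and> (\<exists>\<phi>. rotation_model \<kappa> \<phi> {..<n} w)" if "w \<in> symgrp n" for w
    using cycle_type_exists[of "{..<n}" w] that by (simp add: permutes_imp_bij)
  then obtain ct where ct: "\<And>w. w \<in> symgrp n \<Longrightarrow> ct w \<in> partitions_of n \<and> (\<exists>\<phi>. rotation_model (ct w) \<phi> {..<n} w)"
    by metis
  have conj: "f v = f w" if v: "v \<in> symgrp n" and w: "w \<in> symgrp n" and eq: "ct v = ct w" for v w
  proof -
    obtain \<phi> \<psi> where m: "rotation_model (ct v) \<phi> {..<n} v" "rotation_model (ct v) \<psi> {..<n} w"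
      using ct[OF v] ct[OF w] eq by auto
    let ?D = "diagram (ct v)"
    have b: "bij_betw \<phi> ?D {..<n}" "bij_betw \<psi> ?D {..<n}" using m by (auto simp: rotation_model_def)
    define h where "h = \<psi> \<circ> inv_into ?D \<phi>"
    have h: "bij_betw h {..<n} {..<n}" unfolding h_def by (rule bij_betw_trans[OF bij_betw_inv_into[OF b(1)] b(2)])
    define g where "g x = (if x \<in> {..<n} then h x else x)" for x
    have g: "g permutes {..<n}"
    proof (rule bij_imp_permutes)
      show "bij_betw g {..<n} {..<n}"
        using h by (rule bij_betw_cong[THEN iffD1, rotated]) (simp add: g_def)
    qed (auto simp: g_def)
    have gw: "g (v x) = w (g x)" if x: "x \<in> {..<n}" for x
    proof -
      obtain c where c: "c \<in> ?D" "x = \<phi> c" using x b(1) unfolding bij_betw_def by blast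
      have inv: "inv_into ?D \<phi> (\<phi> d) = d" if "d \<in> ?D" for d using that b(1) by (simp add: bij_betw_inv_into_left)
      have "v x = \<phi> (row_rotation (ct v) c)" using m(1) c by (simp add: rotation_model_def)
      then have "g (v x) = \<psi> (row_rotation (ct v) c)"
        using v x row_rotation_in[OF c(1)] inv permutes_in_image[of v "{..<n}" x] by (simp add: g_def h_def)
      also have "\<dots> = w (\<psi> c)" using m(2) c by (simp add: rotation_model_def)
      also have "\<psi> c = g x" using x c inv by (simp add: g_def h_def)
      finally show ?thesis .
    qed
    have "g \<circ> v \<circ> inv g = w"
    proof
      fix y
      show "(g \<circ> v \<circ> inv g) y = w y"
      proof (cases "y \<in> {..<n}")
        case True
        then have "inv g y \<in> {..<n}" using permutes_in_image[OF permutes_inv[OF g]] by blast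
        from gw[OF this] show ?thesis using permutes_inverses[OF g] by simp
      next
        case False
        then have "inv g y = y" "v y = y" "g y = y" "w y = y"
          using permutes_not_in[OF permutes_inv[OF g]] v w g by (auto simp: permutes_not_in)
        then show ?thesis by simp
      qed
    qed
    then show ?thesis using cls[of g v] g v by auto
  qed
  have ser: "perm_series n w = psums (ct w)" if "w \<in> symgrp n" for w
    using ct[OF that] fix_series_eq_psums by (auto simp: partitions_of_def perm_series_def)
  define S where "S \<mu> = (\<Sum>v | v \<in> symgrp n \<and> ct v = \<mu>. f v)" for \<mu>
  have "(\<Sum>\<mu>\<in>partitions_of n. msmult (S \<mu>) (psums \<mu>)) =
    (\<Sum>\<mu>\<in>partitions_of n. \<Sum>w | w \<in> symgrp n \<and> ct w = \<mu>. msmult (f w) (perm_series n w))"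
    unfolding S_def mser.scale_sum_left
    by (rule sum.cong[OF refl], rule sum.cong[OF refl]) (simp add: ser)
  also have "\<dots> = (\<Sum>w\<in>symgrp n. msmult (f w) (perm_series n w))"
    using ct by (intro sum.group finite_symgrp finite_partitions_of) auto
  finally have "(\<Sum>\<mu>\<in>partitions_of n. msmult (S \<mu>) (psums \<mu>)) = 0" unfolding sum0 .
  then have "S (ct w) = 0" by (rule psums_independent) (rule conjunct1[OF ct[OF w]])
  moreover have "S (ct w) = (\<Sum>v | v \<in> symgrp n \<and> ct v = ct w. f w)"
    unfolding S_def
  proof (rule sum.cong[OF refl])
    fix v assume "v \<in> {v. v \<in> symgrp n \<and> ct v = ct w}"
    then have v: "v \<in> symgrp n" "ct v = ct w" by simp_all
    show "f v = f w" by (rule conj[OF v(1) w v(2)])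
  qed
  moreover have "card {v. v \<in> symgrp n \<and> ct v = ct w} \<noteq> 0"
    using w finite_symgrp[of n] by (auto simp: card_eq_0_iff)
  ultimately show ?thesis by simp
qed

text \<open>
  Subtract from \<open>f\<close> the combination of characters that has the same image in \<open>Lambda n\<close>; what remains
  is a class function with image zero.
\<close>

lemma class_function_expansion:
  assumes cls: "\<And>g w. g \<in> symgrp n \<Longrightarrow> w \<in> symgrp n \<Longrightarrow> f (g \<circ> w \<circ> inv g) = f w"
  obtains c where "\<And>w. w \<in> symgrp n \<Longrightarrow> f w = (\<Sum>\<kappa>\<in>partitions_of n. c \<kappa> * character n \<kappa> w)"
proof -
  let ?F = "\<Sum>w\<in>symgrp n. msmult (f w) (perm_series n w)"
  have F: "?F \<in> Lambda n"
    by (intro mser.subspace_sum mser.subspace_scale subspace_Lambda perm_series_in_Lambda)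
  define c where "c \<kappa> = schur_coord n ?F \<kappa> / fact n" for \<kappa>
  define f' where "f' w = (\<Sum>\<kappa>\<in>partitions_of n. c \<kappa> * character n \<kappa> w)" for w
  have "(\<Sum>w\<in>symgrp n. msmult (f' w) (perm_series n w)) =
      (\<Sum>w\<in>symgrp n. \<Sum>\<kappa>\<in>partitions_of n. msmult (c \<kappa>) (msmult (character n \<kappa> w) (perm_series n w)))"
    by (simp add: f'_def mser.scale_sum_left)
  also have "\<dots> = (\<Sum>\<kappa>\<in>partitions_of n. \<Sum>w\<in>symgrp n. msmult (c \<kappa>) (msmult (character n \<kappa> w) (perm_series n w)))"
    by (rule sum.swap)
  also have "\<dots> = (\<Sum>\<kappa>\<in>partitions_of n. msmult (c \<kappa>) (msmult (fact n) (schur \<kappa>)))"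
    by (intro sum.cong refl) (simp only: mser.scale_sum_right[symmetric] sum_character_perm_series)
  also have "\<dots> = (\<Sum>\<kappa>\<in>partitions_of n. msmult (schur_coord n ?F \<kappa>) (schur \<kappa>))"
    by (simp add: c_def)
  also have "\<dots> = ?F" by (rule schur_expansion[OF F])
  finally have "(\<Sum>w\<in>symgrp n. msmult (f w - f' w) (perm_series n w)) = 0"
    by (simp add: mser.scale_left_diff_distrib sum_subtractf)
  moreover have "f (g \<circ> w \<circ> inv g) - f' (g \<circ> w \<circ> inv g) = f w - f' w" if "g \<in> symgrp n" "w \<in> symgrp n" for g w
    using cls[OF that] perm_series_conj[OF that] by (simp add: f'_def character_def)
  ultimately have "f w - f' w = 0" if "w \<in> symgrp n" for w
    using class_function_eq_0[of n "\<lambda>w. f w - f' w" w] that by blast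
  then show thesis by (intro that[of c]) (simp add: f'_def)
qed

section \<open>The group algebra and the Frobenius map\<close>

text \<open>
  The finitely supported permutations of the natural numbers, written additively although composition
  is not commutative: finitely supported functions on an additive monoid carry the convolution
  product, so \<open>fperm \<Rightarrow>\<^sub>0 complex\<close> is the group algebra of the infinite symmetric group. It contains the
  group algebras of all \<open>S\<^sub>n\<close>.
\<close>

typedef fperm = "{p :: nat \<Rightarrow> nat. permutation p}" morphisms perm_of Abs_fperm
  by (auto intro: permutation_id)

setup_lifting type_definition_fperm

instantiation fperm :: group_add
begin

lift_definition zero_fperm :: fperm is id by (rule permutation_id)
lift_definition plus_fperm :: "fperm \<Rightarrow> fperm \<Rightarrow> fperm" is "(\<circ>)" by (rule permutation_compose)
lift_definition uminus_fperm :: "fperm \<Rightarrow> fperm" is inv by (rule permutation_inverse)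
lift_definition minus_fperm :: "fperm \<Rightarrow> fperm \<Rightarrow> fperm" is "\<lambda>f g. f \<circ> inv g"
  by (intro permutation_compose permutation_inverse)

instance
  by standard (transfer, simp add: o_assoc permutation_inverse_works)+

end

lemma perm_of_add: "perm_of (g + h) = perm_of g \<circ> perm_of h" by transfer simp
lemma perm_of_zero: "perm_of 0 = id" by transfer simp
lemma perm_of_uminus: "perm_of (- g) = inv (perm_of g)" by transfer simp
lemma perm_of_inject_eq: "perm_of g = perm_of h \<longleftrightarrow> g = h" by (rule perm_of_inject)
lemma permutation_perm_of: "permutation (perm_of g)" using perm_of[of g] by simp

definition Sn :: "nat \<Rightarrow> fperm set" where
  "Sn n = {g. perm_of g permutes {..<n}}"

lemma perm_of_image_Sn: "bij_betw perm_of (Sn n) (symgrp n)"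
proof (rule bij_betw_byWitness[where f' = Abs_fperm])
  have p: "permutation w" if "w permutes {..<n}" for w
    using that permutation_permutes by blast
  show "\<forall>a\<in>Sn n. Abs_fperm (perm_of a) = a" by (simp add: perm_of_inverse)
  show "\<forall>w\<in>symgrp n. perm_of (Abs_fperm w) = w" using p by (simp add: Abs_fperm_inverse)
  show "perm_of ` Sn n \<subseteq> symgrp n" by (auto simp: Sn_def)
  show "Abs_fperm ` symgrp n \<subseteq> Sn n" using p by (auto simp: Sn_def Abs_fperm_inverse)
qed

lemma finite_Sn [simp]: "finite (Sn n)"
  using perm_of_image_Sn[of n] finite_symgrp[of n] by (simp add: bij_betw_finite)

lemma sum_symgrp: "(\<Sum>w\<in>symgrp n. F w) = (\<Sum>g\<in>Sn n. F (perm_of g))"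
  using sum.reindex_bij_betw[OF perm_of_image_Sn, of F n] by simp

lemma Sn_zero [simp]: "0 \<in> Sn n" by (simp add: Sn_def perm_of_zero permutes_id)
lemma Sn_add: "g \<in> Sn n \<Longrightarrow> h \<in> Sn n \<Longrightarrow> g + h \<in> Sn n"
  by (simp add: Sn_def perm_of_add permutes_compose)
lemma Sn_uminus: "g \<in> Sn n \<Longrightarrow> - g \<in> Sn n"
  by (simp add: Sn_def perm_of_uminus permutes_inv)
lemma Sn_uminus_iff: "- g \<in> Sn n \<longleftrightarrow> g \<in> Sn n"
  using Sn_uminus[of g n] Sn_uminus[of "- g" n] by auto
lemma Sn_perm_of: "g \<in> Sn n \<Longrightarrow> i < n \<Longrightarrow> perm_of g i < n"
  using permutes_in_image[of "perm_of g" "{..<n}" i] by (simp add: Sn_def)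

type_synonym galg = "fperm \<Rightarrow>\<^sub>0 complex"

abbreviation gcoeff :: "galg \<Rightarrow> fperm \<Rightarrow> complex" where "gcoeff \<equiv> Poly_Mapping.lookup"
abbreviation gsingle :: "fperm \<Rightarrow> complex \<Rightarrow> galg" where "gsingle \<equiv> Poly_Mapping.single"

definition Sn_algebra :: "nat \<Rightarrow> galg set" where
  "Sn_algebra n = {x. \<forall>g. gcoeff x g \<noteq> 0 \<longrightarrow> g \<in> Sn n}"

lemma Sn_algebra_coeff: "x \<in> Sn_algebra n \<Longrightarrow> g \<notin> Sn n \<Longrightarrow> gcoeff x g = 0" by (auto simp: Sn_algebra_def)

lemma Sn_algebra_expand:
  assumes "x \<in> Sn_algebra n" shows "x = (\<Sum>g\<in>Sn n. gsingle g (gcoeff x g))"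
proof (rule poly_mapping_eqI)
  fix h
  have "gcoeff (\<Sum>g\<in>Sn n. gsingle g (gcoeff x g)) h = (\<Sum>g\<in>Sn n. if g = h then gcoeff x g else 0)"
    unfolding lookup_sum by (intro sum.cong refl) (simp add: lookup_single when_def)
  also have "\<dots> = gcoeff x h" using Sn_algebra_coeff[OF assms, of h] by (simp add: sum.delta)
  finally show "gcoeff x h = gcoeff (\<Sum>g\<in>Sn n. gsingle g (gcoeff x g)) h" by simp
qed

lemma galg_expand: "x = (\<Sum>g\<in>Poly_Mapping.keys x. gsingle g (gcoeff x g))" for x :: galg
proof (rule poly_mapping_eqI)
  fix h
  have "gcoeff (\<Sum>g\<in>Poly_Mapping.keys x. gsingle g (gcoeff x g)) h = (\<Sum>g\<in>Poly_Mapping.keys x. if g = h then gcoeff x g else 0)"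
    unfolding lookup_sum by (intro sum.cong refl) (simp add: lookup_single when_def)
  also have "\<dots> = gcoeff x h" by (simp add: sum.delta in_keys_iff)
  finally show "gcoeff x h = gcoeff (\<Sum>g\<in>Poly_Mapping.keys x. gsingle g (gcoeff x g)) h" by simp
qed

lemma gcoeff_single_mult: "gcoeff (gsingle g c * x) h = c * gcoeff x (- g + h)"
proof -
  have "gsingle g c * x = (\<Sum>k\<in>Poly_Mapping.keys x. gsingle (g + k) (c * gcoeff x k))"
    by (subst (1) galg_expand[of x]) (simp add: sum_distrib_left mult_single)
  then have "gcoeff (gsingle g c * x) h = (\<Sum>k\<in>Poly_Mapping.keys x. if k = - g + h then c * gcoeff x k else 0)"
    by (simp only: lookup_sum lookup_single when_def)
      (intro sum.cong refl, metis add.assoc add.left_neutral add.right_inverse left_minus)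
  also have "\<dots> = c * gcoeff x (- g + h)" by (simp add: sum.delta in_keys_iff)
  finally show ?thesis .
qed

lemma gcoeff_mult_single: "gcoeff (x * gsingle g c) h = gcoeff x (h - g) * c"
proof -
  have "x * gsingle g c = (\<Sum>k\<in>Poly_Mapping.keys x. gsingle (k + g) (gcoeff x k * c))"
    by (subst (1) galg_expand[of x]) (simp add: sum_distrib_right mult_single)
  then have "gcoeff (x * gsingle g c) h = (\<Sum>k\<in>Poly_Mapping.keys x. if k = h - g then gcoeff x k * c else 0)"
    by (simp only: lookup_sum lookup_single when_def)
      (intro sum.cong refl, metis add_diff_cancel diff_add_cancel)
  also have "\<dots> = gcoeff x (h - g) * c" by (simp add: sum.delta in_keys_iff)
  finally show ?thesis .
qed

definition scalar :: "complex \<Rightarrow> galg" where "scalar c = gsingle 0 c"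

lemma gcoeff_scalar: "gcoeff (scalar c) g = (if g = 0 then c else 0)"
  by (simp add: scalar_def lookup_single when_def)

lemma gcoeff_scalar_mult [simp]: "gcoeff (scalar c * x) g = c * gcoeff x g"
  by (simp add: scalar_def gcoeff_single_mult)

lemma scalar_commute: "x * scalar c = scalar c * x"
  by (rule poly_mapping_eqI) (simp add: scalar_def gcoeff_single_mult gcoeff_mult_single)

lemma scalar_mult: "scalar c * scalar d = scalar (c * d)" by (simp add: scalar_def mult_single)
lemma scalar_0 [simp]: "scalar 0 = 0" by (simp add: scalar_def)
lemma scalar_mult_left_commute: "x * (scalar c * y) = scalar c * (x * y)"
  by (metis scalar_commute mult.assoc)
lemma scalar_mult_cancel:
  assumes "c \<noteq> 0" "scalar c * x = scalar c * y" shows "x = y"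
proof (rule poly_mapping_eqI)
  fix g
  have "gcoeff (scalar c * x) g = gcoeff (scalar c * y) g" using assms(2) by simp
  then show "gcoeff x g = gcoeff y g" using assms(1) by simp
qed

lemma Sn_algebra_single [simp]: "g \<in> Sn n \<Longrightarrow> gsingle g c \<in> Sn_algebra n"
  by (auto simp: Sn_algebra_def lookup_single when_def split: if_splits)
lemma Sn_algebra_sum:
  assumes "\<And>i. i \<in> I \<Longrightarrow> f i \<in> Sn_algebra n" shows "sum f I \<in> Sn_algebra n"
  unfolding Sn_algebra_def
proof (intro CollectI allI impI)
  fix g assume "gcoeff (sum f I) g \<noteq> 0"
  then obtain i where "i \<in> I" "gcoeff (f i) g \<noteq> 0"
    unfolding lookup_sum by (rule sum.not_neutral_contains_not_neutral)
  then show "g \<in> Sn n" using assms[of i] by (simp add: Sn_algebra_def)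
qed
lemma Sn_algebra_mult: assumes "x \<in> Sn_algebra n" "y \<in> Sn_algebra n" shows "x * y \<in> Sn_algebra n"
proof -
  have "gsingle (g + h) c \<in> Sn_algebra n" if "g \<in> Sn n" "h \<in> Sn n" for g h c
    using that by (intro Sn_algebra_single Sn_add)
  then have "(\<Sum>g\<in>Sn n. \<Sum>h\<in>Sn n. gsingle (g + h) (gcoeff x g * gcoeff y h)) \<in> Sn_algebra n"
    by (rule Sn_algebra_sum[OF Sn_algebra_sum])
  moreover have "x * y = (\<Sum>g\<in>Sn n. \<Sum>h\<in>Sn n. gsingle (g + h) (gcoeff x g * gcoeff y h))"
    using arg_cong2[of _ _ _ _ "(*)", OF Sn_algebra_expand[OF assms(1)] Sn_algebra_expand[OF assms(2)]]
    unfolding sum_product mult_single .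
  ultimately show ?thesis by (rule ssubst[rotated])
qed
lemma gcoeff_mult_0:
  assumes "x \<in> Sn_algebra n" shows "gcoeff (x * y) 0 = (\<Sum>g\<in>Sn n. gcoeff x g * gcoeff y (- g))"
proof -
  have "x * y = (\<Sum>g\<in>Sn n. gsingle g (gcoeff x g) * y)"
    using arg_cong[OF Sn_algebra_expand[OF assms], of "\<lambda>z. z * y"] unfolding sum_distrib_right .
  then have "gcoeff (x * y) 0 = gcoeff (\<Sum>g\<in>Sn n. gsingle g (gcoeff x g) * y) 0" by (rule arg_cong)
  then show ?thesis by (simp only: lookup_sum gcoeff_single_mult add_0_right)
qed

definition central :: "nat \<Rightarrow> galg \<Rightarrow> bool" where
  "central n x \<longleftrightarrow> x \<in> Sn_algebra n \<and> (\<forall>g\<in>Sn n. gsingle g 1 * x = x * gsingle g 1)"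

lemma central_Sn_algebra: "central n x \<Longrightarrow> x \<in> Sn_algebra n" by (simp add: central_def)

lemma central_commute:
  assumes "central n x" "y \<in> Sn_algebra n" shows "x * y = y * x"
proof -
  have s: "gsingle g c * x = x * gsingle g c" if g: "g \<in> Sn n" for g c
  proof -
    have e: "gsingle g c = scalar c * gsingle g 1" by (simp add: scalar_def mult_single)
    have "gsingle g 1 * x = x * gsingle g 1" using assms(1) g by (simp add: central_def)
    then show ?thesis unfolding e by (simp only: mult.assoc scalar_mult_left_commute)
  qed
  have "x * y = (\<Sum>g\<in>Sn n. x * gsingle g (gcoeff y g))"
    using arg_cong[OF Sn_algebra_expand[OF assms(2)], of "\<lambda>z. x * z"] unfolding sum_distrib_left .
  also have "\<dots> = (\<Sum>g\<in>Sn n. gsingle g (gcoeff y g) * x)" by (intro sum.cong refl s[symmetric])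
  also have "\<dots> = y * x"
    using arg_cong[OF Sn_algebra_expand[OF assms(2)], of "\<lambda>z. z * x"] unfolding sum_distrib_right by (rule sym)
  finally show ?thesis .
qed

lemma central_iff_coeff:
  assumes "x \<in> Sn_algebra n"
  shows "central n x \<longleftrightarrow> (\<forall>g\<in>Sn n. \<forall>h. gcoeff x (g + h - g) = gcoeff x h)"
proof -
  have "gsingle g 1 * x = x * gsingle g 1 \<longleftrightarrow> (\<forall>h. gcoeff x (g + h - g) = gcoeff x h)" for g
  proof -
    have "gsingle g 1 * x = x * gsingle g 1 \<longleftrightarrow> (\<forall>k. gcoeff x (- g + k) = gcoeff x (k - g))"
      by (simp add: poly_mapping_eq_iff fun_eq_iff gcoeff_single_mult gcoeff_mult_single)
    also have "\<dots> \<longleftrightarrow> (\<forall>h. gcoeff x (- g + (g + h)) = gcoeff x (g + h - g))"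
      by (metis add.assoc add.left_neutral add.right_inverse)
    finally show ?thesis by (simp add: add.assoc[symmetric] eq_commute)
  qed
  then show ?thesis using assms by (simp add: central_def)
qed

text \<open>
  On the centre this is the Frobenius characteristic, normalised so that a permutation goes to the
  power sum of its cycle type. With this normalisation \<open>s\<^sub>\<kappa> / f\<^sup>\<kappa>\<close> is the square of \<open>s\<^sub>\<kappa>\<close>, as in the class
  product.
\<close>

definition frobenius :: "nat \<Rightarrow> galg \<Rightarrow> mser" where
  "frobenius n x = (\<Sum>g\<in>Sn n. msmult (gcoeff x g) (perm_series n (perm_of g)))"

lemma frobenius_sum: "frobenius n (sum f I) = (\<Sum>i\<in>I. frobenius n (f i))"
  by (simp add: frobenius_def lookup_sum mser.scale_sum_left) (rule sum.swap)
lemma frobenius_scalar_mult: "frobenius n (scalar c * x) = msmult c (frobenius n x)"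
  by (simp add: frobenius_def mser.scale_sum_right)
lemma frobenius_single: "g \<in> Sn n \<Longrightarrow> frobenius n (gsingle g c) = msmult c (perm_series n (perm_of g))"
proof -
  assume g: "g \<in> Sn n"
  have "frobenius n (gsingle g c) = (\<Sum>h\<in>Sn n. if h = g then msmult c (perm_series n (perm_of g)) else 0)"
    unfolding frobenius_def by (intro sum.cong refl) (auto simp: lookup_single when_def)
  then show ?thesis using g by (simp add: sum.delta)
qed

definition char_elem :: "nat \<Rightarrow> nat list \<Rightarrow> galg" where
  "char_elem n \<kappa> = (\<Sum>g\<in>Sn n. gsingle g (character n \<kappa> (perm_of g)))"

lemma gcoeff_char_elem: "gcoeff (char_elem n \<kappa>) g = (if g \<in> Sn n then character n \<kappa> (perm_of g) else 0)"
proof -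
  have "gcoeff (char_elem n \<kappa>) g = (\<Sum>h\<in>Sn n. if h = g then character n \<kappa> (perm_of h) else 0)"
    unfolding char_elem_def lookup_sum by (intro sum.cong refl) (simp add: lookup_single when_def)
  then show ?thesis by (simp add: sum.delta)
qed

lemma char_elem_Sn_algebra: "char_elem n \<kappa> \<in> Sn_algebra n" by (auto simp: Sn_algebra_def gcoeff_char_elem)

lemma char_elem_uminus: "gcoeff (char_elem n \<kappa>) (- g) = gcoeff (char_elem n \<kappa>) g"
proof (cases "g \<in> Sn n")
  case True
  then have "perm_series n (inv (perm_of g)) = perm_series n (perm_of g)"
    by (intro perm_series_inverse) (simp add: Sn_def)
  then show ?thesis using True by (simp add: gcoeff_char_elem Sn_uminus perm_of_uminus character_def)
qed (simp add: gcoeff_char_elem Sn_uminus_iff)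

lemma perm_of_conj: "perm_of (g + h - g) = perm_of g \<circ> perm_of h \<circ> inv (perm_of g)"
  by (simp add: diff_conv_add_uminus perm_of_add perm_of_uminus del: add_uminus_conv_diff)

lemma central_expansion:
  assumes "central n x"
  obtains c where "x = (\<Sum>\<kappa>\<in>partitions_of n. scalar (c \<kappa>) * char_elem n \<kappa>)"
proof -
  have A: "x \<in> Sn_algebra n" using assms by (rule central_Sn_algebra)
  have conj: "gcoeff x (g + h - g) = gcoeff x h" if "g \<in> Sn n" for g h
    using assms that unfolding central_iff_coeff[OF A] by blast
  define f where "f w = gcoeff x (Abs_fperm w)" for w
  have f: "f (perm_of g) = gcoeff x g" for g by (simp add: f_def perm_of_inverse)
  have "f (g \<circ> w \<circ> inv g) = f w" if gw: "g \<in> symgrp n" "w \<in> symgrp n" for g w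
  proof -
    obtain g' h' where "g = perm_of g'" "w = perm_of h'" "g' \<in> Sn n"
      using gw perm_of_image_Sn[of n] unfolding bij_betw_def by (metis imageE)
    then show ?thesis using conj by (simp add: f perm_of_conj[symmetric])
  qed
  then obtain c where c: "\<And>w. w \<in> symgrp n \<Longrightarrow> f w = (\<Sum>\<kappa>\<in>partitions_of n. c \<kappa> * character n \<kappa> w)"
    using class_function_expansion[of n f] by metis
  show thesis
  proof (rule that, rule poly_mapping_eqI)
    fix g
    show "gcoeff x g = gcoeff (\<Sum>\<kappa>\<in>partitions_of n. scalar (c \<kappa>) * char_elem n \<kappa>) g"
    proof (cases "g \<in> Sn n")
      case True
      then show ?thesis using c[of "perm_of g"] by (simp add: lookup_sum gcoeff_char_elem f Sn_def)
    next
      case False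
      then show ?thesis using Sn_algebra_coeff[OF A] by (simp add: lookup_sum gcoeff_char_elem)
    qed
  qed
qed

lemma frobenius_char_elem: "\<kappa> \<in> partitions_of n \<Longrightarrow> frobenius n (char_elem n \<kappa>) = msmult (fact n) (schur \<kappa>)"
  using sum_character_perm_series[of \<kappa> n]
  by (simp add: frobenius_def gcoeff_char_elem sum_symgrp)

lemma char_elem_orthogonality:
  assumes "\<kappa> \<in> partitions_of n" "\<rho> \<in> partitions_of n"
  shows "gcoeff (char_elem n \<kappa> * char_elem n \<rho>) 0 = (if \<rho> = \<kappa> then fact n else 0)"
  unfolding gcoeff_mult_0[OF char_elem_Sn_algebra] char_elem_uminus
  using character_orthogonality[OF assms] by (simp add: gcoeff_char_elem sum_symgrp)

text \<open>
  The coefficient at the squarefree monomial \<open>x\<^sub>0 \<cdots> x\<^sub>n\<^sub>-\<^sub>1\<close> vanishes on the series of every permutation except the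
  unit, while on \<open>s\<^sub>\<kappa>\<close> it is \<open>f\<^sup>\<kappa>\<close>.
\<close>

lemma sum_num_syt_char_elem: "(\<Sum>\<kappa>\<in>partitions_of n. scalar (of_nat (num_syt \<kappa>)) * char_elem n \<kappa>) = scalar (fact n)"
proof (rule poly_mapping_eqI)
  fix g
  show "gcoeff (\<Sum>\<kappa>\<in>partitions_of n. scalar (of_nat (num_syt \<kappa>)) * char_elem n \<kappa>) g = gcoeff (scalar (fact n)) g"
  proof (cases "g \<in> Sn n")
    case True
    then have "perm_of g \<in> symgrp n" by (simp add: Sn_def)
    moreover have "perm_of g = id \<longleftrightarrow> g = 0" using perm_of_inject_eq[of g 0] by (simp add: perm_of_zero)
    ultimately show ?thesis using sum_num_syt_character[of "perm_of g" n] True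
      by (simp add: lookup_sum gcoeff_char_elem gcoeff_scalar)
  next
    case False
    then show ?thesis by (auto simp: lookup_sum gcoeff_char_elem gcoeff_scalar)
  qed
qed

text \<open>
  Central elements are combinations of characters, and a character takes equal values at a permutation
  and at its inverse.
\<close>

lemma central_inverse_coeff:
  assumes "central n x" shows "gcoeff x (- g) = gcoeff x g"
proof -
  obtain c where "x = (\<Sum>\<kappa>\<in>partitions_of n. scalar (c \<kappa>) * char_elem n \<kappa>)" using central_expansion[OF assms] .
  then show ?thesis by (simp add: lookup_sum char_elem_uminus)
qed

section \<open>Young symmetrizers and the idempotents of the centre\<close>

text \<open>
  The Young subgroup of the colouring \<open>c\<close> of \<open>{..<n}\<close>.
\<close>

definition stab :: "nat \<Rightarrow> (nat \<Rightarrow> 'a) \<Rightarrow> fperm set" where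
  "stab n c = {g \<in> Sn n. \<forall>i<n. c (perm_of g i) = c i}"

definition symmetrizer :: "nat \<Rightarrow> (nat \<Rightarrow> 'a) \<Rightarrow> galg" where
  "symmetrizer n c = (\<Sum>g\<in>stab n c. gsingle g 1)"

definition fsign :: "fperm \<Rightarrow> complex" where
  "fsign g = of_int (sign (perm_of g))"

definition antisymmetrizer :: "nat \<Rightarrow> (nat \<Rightarrow> 'a) \<Rightarrow> galg" where
  "antisymmetrizer n c = (\<Sum>g\<in>stab n c. gsingle g (fsign g))"

lemma fsign_add: "fsign (g + h) = fsign g * fsign h"
  by (simp add: fsign_def perm_of_add sign_compose permutation_perm_of)

lemma fsign_uminus: "fsign (- g) = fsign g"
  by (simp add: fsign_def perm_of_uminus sign_inverse permutation_perm_of)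

lemma fsign_0: "fsign 0 = 1" by (simp add: fsign_def perm_of_zero)

lemma fsign_sq: "fsign g * fsign g = 1"
  by (simp add: fsign_add[symmetric, of g "- g"] fsign_0 flip: fsign_uminus[of g])
    (simp add: fsign_def flip: of_int_mult)

lemma stab_Sn: "g \<in> stab n c \<Longrightarrow> g \<in> Sn n" by (simp add: stab_def)
lemma finite_stab [simp]: "finite (stab n c)"
  by (rule finite_subset[OF _ finite_Sn[of n]]) (auto simp: stab_def)
lemma stab_0: "0 \<in> stab n c" by (simp add: stab_def perm_of_zero)
lemma stab_add: "g \<in> stab n c \<Longrightarrow> h \<in> stab n c \<Longrightarrow> g + h \<in> stab n c"
  using Sn_perm_of[of h n] by (auto simp: stab_def perm_of_add Sn_add)
lemma stab_uminus: "g \<in> stab n c \<Longrightarrow> - g \<in> stab n c"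
proof -
  assume g: "g \<in> stab n c"
  have "c (perm_of (- g) i) = c i" if i: "i < n" for i
  proof -
    have "perm_of (- g) i < n" using g i by (intro Sn_perm_of Sn_uminus stab_Sn[of g n c])
    then have "c (perm_of g (perm_of (- g) i)) = c (perm_of (- g) i)" using g by (simp add: stab_def)
    moreover have "perm_of g (perm_of (- g) i) = i"
      using perm_of_add[of g "- g"] by (simp add: perm_of_zero fun_eq_iff)
    ultimately show ?thesis by simp
  qed
  then show ?thesis using g Sn_uminus by (auto simp: stab_def)
qed
lemma stab_diff: "g \<in> stab n c \<Longrightarrow> h \<in> stab n c \<Longrightarrow> g - h \<in> stab n c"
  using stab_add[OF _ stab_uminus] by (metis add_uminus_conv_diff)
lemma stab_uminus_iff: "- g \<in> stab n c \<longleftrightarrow> g \<in> stab n c"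
  using stab_uminus[of g n c] stab_uminus[of "- g" n c] by auto

lemma stab_cong: "(\<And>i. i < n \<Longrightarrow> c i = d i) \<Longrightarrow> stab n c = stab n d"
  using Sn_perm_of[of _ n] by (auto simp: stab_def)

lemma symmetrizer_Sn_algebra: "symmetrizer n c \<in> Sn_algebra n"
  unfolding symmetrizer_def by (intro Sn_algebra_sum Sn_algebra_single) (rule stab_Sn)
lemma antisymmetrizer_Sn_algebra: "antisymmetrizer n c \<in> Sn_algebra n"
  unfolding antisymmetrizer_def by (intro Sn_algebra_sum Sn_algebra_single) (rule stab_Sn)

lemma symmetrizer_mult_single:
  assumes t: "t \<in> stab n c" shows "symmetrizer n c * gsingle t 1 = symmetrizer n c"
  and "gsingle t 1 * symmetrizer n c = symmetrizer n c"
proof -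
  have "symmetrizer n c * gsingle t 1 = (\<Sum>g\<in>stab n c. gsingle (g + t) 1)"
    by (simp add: symmetrizer_def sum_distrib_right mult_single)
  also have "\<dots> = symmetrizer n c" unfolding symmetrizer_def
    by (rule sum.reindex_bij_witness[of _ "\<lambda>g. g - t" "\<lambda>g. g + t"])
      (auto intro: stab_add stab_diff t)
  finally show "symmetrizer n c * gsingle t 1 = symmetrizer n c" .
  have "gsingle t 1 * symmetrizer n c = (\<Sum>g\<in>stab n c. gsingle (t + g) 1)"
    by (simp add: symmetrizer_def sum_distrib_left mult_single)
  also have "\<dots> = symmetrizer n c" unfolding symmetrizer_def
    by (rule sum.reindex_bij_witness[of _ "\<lambda>g. - t + g" "\<lambda>g. t + g"])
      (auto intro: stab_add stab_uminus t)
  finally show "gsingle t 1 * symmetrizer n c = symmetrizer n c" .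
qed

lemma antisymmetrizer_mult_single:
  assumes t: "t \<in> stab n c" shows "antisymmetrizer n c * gsingle t 1 = scalar (fsign t) * antisymmetrizer n c"
  and "gsingle t 1 * antisymmetrizer n c = scalar (fsign t) * antisymmetrizer n c"
proof -
  have s: "fsign (g + t) * fsign t = fsign g" "fsign t * fsign (t + g) = fsign g" for g
    using fsign_sq[of t] unfolding fsign_add
    by (simp only: mult.assoc mult_1_right, simp only: mult.assoc[symmetric] mult_1_left)
  have "antisymmetrizer n c * gsingle t 1 = (\<Sum>g\<in>stab n c. gsingle (g + t) (fsign t * fsign (g + t)))"
    by (simp add: antisymmetrizer_def sum_distrib_right mult_single s(1) mult.commute[of "fsign t"])
  also have "\<dots> = (\<Sum>g\<in>stab n c. gsingle g (fsign t * fsign g))"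
    by (rule sum.reindex_bij_witness[of _ "\<lambda>g. g - t" "\<lambda>g. g + t"])
      (auto intro: stab_add stab_diff t)
  finally show "antisymmetrizer n c * gsingle t 1 = scalar (fsign t) * antisymmetrizer n c"
    by (simp add: antisymmetrizer_def sum_distrib_left scalar_def mult_single)
  have "gsingle t 1 * antisymmetrizer n c = (\<Sum>g\<in>stab n c. gsingle (t + g) (fsign t * fsign (t + g)))"
    by (simp add: antisymmetrizer_def sum_distrib_left mult_single s)
  also have "\<dots> = (\<Sum>g\<in>stab n c. gsingle g (fsign t * fsign g))"
    by (rule sum.reindex_bij_witness[of _ "\<lambda>g. - t + g" "\<lambda>g. t + g"])
      (auto intro: stab_add stab_uminus t)
  finally show "gsingle t 1 * antisymmetrizer n c = scalar (fsign t) * antisymmetrizer n c"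
    by (simp add: antisymmetrizer_def sum_distrib_left scalar_def mult_single)
qed

text \<open>
  The transposition \<open>t\<close> of \<open>i\<close> and \<open>j\<close> lies in both Young subgroups. Inserting \<open>t\<^sup>2 = 1\<close> between the
  factors reproduces the product with the opposite sign.
\<close>

lemma clash_annihilates:
  assumes "i < n" "j < n" "i \<noteq> j" "c i = c j" "d i = d j"
  shows "symmetrizer n c * antisymmetrizer n d = 0" "antisymmetrizer n d * symmetrizer n c = 0"
proof -
  define t where "t = Abs_fperm (transpose i j)"
  have perm_of_t: "perm_of t = transpose i j" by (simp add: t_def Abs_fperm_inverse permutation_swap_id)
  have t: "t \<in> stab n c" "t \<in> stab n d"
    using assms by (auto simp: stab_def Sn_def perm_of_t permutes_swap_id transpose_def)
  have tt: "gsingle t 1 * gsingle t 1 = 1"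
  proof -
    have "perm_of (t + t) = perm_of 0" by (simp add: perm_of_add perm_of_t perm_of_zero)
    then have "t + t = 0" by (simp only: perm_of_inject_eq)
    then show ?thesis by (simp add: mult_single)
  qed
  have s: "fsign t = -1" using assms by (simp add: fsign_def perm_of_t sign_swap_id)
  have neg: "x = 0" if "x = scalar (-1) * x" for x
  proof (rule poly_mapping_eqI)
    fix g have "gcoeff x g = gcoeff (scalar (-1) * x) g" using that by simp
    then show "gcoeff x g = gcoeff 0 g" by simp
  qed
  have "symmetrizer n c * antisymmetrizer n d =
      (symmetrizer n c * gsingle t 1) * (gsingle t 1 * antisymmetrizer n d)"
    using tt by (simp add: mult.assoc) (simp add: mult.assoc[symmetric])
  also have "\<dots> = scalar (-1) * (symmetrizer n c * antisymmetrizer n d)"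
    unfolding symmetrizer_mult_single(1)[OF t(1)] antisymmetrizer_mult_single(2)[OF t(2)] s
    by (rule scalar_mult_left_commute)
  finally show "symmetrizer n c * antisymmetrizer n d = 0" by (rule neg)
  have "antisymmetrizer n d * symmetrizer n c =
      (antisymmetrizer n d * gsingle t 1) * (gsingle t 1 * symmetrizer n c)"
    using tt by (simp add: mult.assoc) (simp add: mult.assoc[symmetric])
  also have "\<dots> = scalar (-1) * (antisymmetrizer n d * symmetrizer n c)"
    unfolding symmetrizer_mult_single(2)[OF t(1)] antisymmetrizer_mult_single(1)[OF t(2)] s
    by (rule mult.assoc)
  finally show "antisymmetrizer n d * symmetrizer n c = 0" by (rule neg)
qed

lemma conj_stab:
  assumes g: "g \<in> Sn n"
  shows "bij_betw (\<lambda>h. g + h - g) (stab n c) (stab n (c \<circ> perm_of (- g)))"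
proof (rule bij_betw_byWitness[where f' = "\<lambda>k. - g + k + g"])
  have inv: "perm_of (- g) (perm_of g i) = i" "perm_of g (perm_of (- g) i) = i" for i
    using perm_of_add[of "- g" g] perm_of_add[of g "- g"] by (simp_all add: perm_of_zero fun_eq_iff)
  have lt: "perm_of g i < n" "perm_of (- g) i < n" if "i < n" for i
    using that g by (auto intro: Sn_perm_of Sn_uminus)
  have aa: "perm_of (g + h) i = perm_of g (perm_of h i)" for g h i by (simp add: perm_of_add)
  show "\<forall>h\<in>stab n c. - g + (g + h - g) + g = h"
    "\<forall>k\<in>stab n (c \<circ> perm_of (- g)). g + (- g + k + g) - g = k"
    by (simp_all add: diff_conv_add_uminus add.assoc del: add_uminus_conv_diff)
  show "(\<lambda>h. g + h - g) ` stab n c \<subseteq> stab n (c \<circ> perm_of (- g))"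
  proof (intro image_subsetI)
    fix h assume h: "h \<in> stab n c"
    have "g + h + - g \<in> Sn n" using g stab_Sn[OF h] by (intro Sn_add Sn_uminus)
    moreover have "c (perm_of (- g) (perm_of (g + h + - g) i)) = c (perm_of (- g) i)" if "i < n" for i
      using h lt(2)[OF that] by (simp add: aa inv stab_def del: add_uminus_conv_diff)
    ultimately show "g + h - g \<in> stab n (c \<circ> perm_of (- g))" by (simp add: stab_def)
  qed
  show "(\<lambda>k. - g + k + g) ` stab n (c \<circ> perm_of (- g)) \<subseteq> stab n c"
  proof (intro image_subsetI)
    fix k assume k: "k \<in> stab n (c \<circ> perm_of (- g))"
    have "- g + k + g \<in> Sn n" using g stab_Sn[OF k] by (intro Sn_add Sn_uminus)
    moreover have "c (perm_of (- g + k + g) i) = c i" if "i < n" for i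
    proof -
      have "c (perm_of (- g) (perm_of k (perm_of g i))) = c (perm_of (- g) (perm_of g i))"
        using k lt(1)[OF that] by (simp add: stab_def)
      then show ?thesis by (simp add: aa inv)
    qed
    ultimately show "- g + k + g \<in> stab n c" by (simp add: stab_def)
  qed
qed

lemma single_symmetrizer:
  assumes g: "g \<in> Sn n"
  shows "gsingle g 1 * symmetrizer n c = symmetrizer n (c \<circ> perm_of (- g)) * gsingle g 1"
    "gsingle g 1 * antisymmetrizer n c = antisymmetrizer n (c \<circ> perm_of (- g)) * gsingle g 1"
proof -
  note re = sum.reindex_bij_betw[OF conj_stab[OF g, of c], symmetric]
  have s: "fsign (g + h - g) = fsign h" for h
    using fsign_sq[of g] by (simp add: fsign_add fsign_uminus diff_conv_add_uminus mult.assoc mult.left_commute[of "fsign g" "fsign h"] del: add_uminus_conv_diff)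
  have e: "g + h - g + g = g + h" for h by (simp add: add.assoc)
  have "symmetrizer n (c \<circ> perm_of (- g)) * gsingle g 1 = (\<Sum>h\<in>stab n c. gsingle (g + h - g) 1) * gsingle g 1"
    unfolding symmetrizer_def by (rule arg_cong[of _ _ "\<lambda>x. x * _"], rule re)
  also have "\<dots> = gsingle g 1 * symmetrizer n c"
    by (simp add: symmetrizer_def sum_distrib_left sum_distrib_right mult_single e)
  finally show "gsingle g 1 * symmetrizer n c = symmetrizer n (c \<circ> perm_of (- g)) * gsingle g 1" by simp
  have "antisymmetrizer n (c \<circ> perm_of (- g)) * gsingle g 1 = (\<Sum>h\<in>stab n c. gsingle (g + h - g) (fsign (g + h - g))) * gsingle g 1"
    unfolding antisymmetrizer_def by (rule arg_cong[of _ _ "\<lambda>x. x * _"], rule re)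
  also have "\<dots> = gsingle g 1 * antisymmetrizer n c"
    by (simp add: antisymmetrizer_def sum_distrib_left sum_distrib_right mult_single e s)
  finally show "gsingle g 1 * antisymmetrizer n c = antisymmetrizer n (c \<circ> perm_of (- g)) * gsingle g 1" by simp
qed

text \<open>
  Tableaux in the sense of Young symmetrizers: each cell of the diagram is labelled by one element of
  \<open>{..<n}\<close>. The function maps a label to its cell.
\<close>

definition numberings :: "nat \<Rightarrow> nat list \<Rightarrow> (nat \<Rightarrow> nat \<times> nat) set" where
  "numberings n \<kappa> = {\<phi> \<in> extensional {..<n}. bij_betw \<phi> {..<n} (diagram \<kappa>)}"

lemma finite_numberings: "finite (numberings n \<kappa>)"
proof (rule finite_subset)
  show "numberings n \<kappa> \<subseteq> {..<n} \<rightarrow>\<^sub>E diagram \<kappa>" by (auto simp: numberings_def PiE_def bij_betw_def)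
qed (intro finite_PiE, auto)

lemma numberings_nonempty: "\<kappa> \<in> partitions_of n \<Longrightarrow> numberings n \<kappa> \<noteq> {}"
proof -
  assume "\<kappa> \<in> partitions_of n"
  then have "card {..<n} = card (diagram \<kappa>)" by (simp add: card_diagram partitions_of_def)
  then obtain h where h: "bij_betw h {..<n} (diagram \<kappa>)"
    by (metis finite_diagram finite_lessThan finite_same_card_bij)
  have "bij_betw (restrict h {..<n}) {..<n} (diagram \<kappa>)"
    using h by (rule bij_betw_cong[THEN iffD1, rotated]) simp
  then have "restrict h {..<n} \<in> numberings n \<kappa>" by (simp add: numberings_def)
  then show ?thesis by blast
qed

text \<open>
  The Young symmetrizer of a numbering, summed over all numberings of the diagram. Relabelling permutes
  the summands, so this element is central.
\<close>

definition young :: "nat \<Rightarrow> nat list \<Rightarrow> galg" where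
  "young n \<kappa> = (\<Sum>\<phi>\<in>numberings n \<kappa>. symmetrizer n (fst \<circ> \<phi>) * antisymmetrizer n (snd \<circ> \<phi>))"

lemma symmetrizer_cong:
  "(\<And>i. i < n \<Longrightarrow> c i = d i) \<Longrightarrow> symmetrizer n c = symmetrizer n d"
  "(\<And>i. i < n \<Longrightarrow> c i = d i) \<Longrightarrow> antisymmetrizer n c = antisymmetrizer n d"
  using stab_cong[of n c d] by (simp_all add: symmetrizer_def antisymmetrizer_def)

lemma numberings_relabel:
  assumes "g \<in> Sn n" "\<phi> \<in> numberings n \<kappa>"
  shows "restrict (\<phi> \<circ> perm_of g) {..<n} \<in> numberings n \<kappa>"
proof -
  have "bij_betw (perm_of g) {..<n} {..<n}" using assms(1) by (simp add: Sn_def permutes_imp_bij)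
  then have "bij_betw (\<phi> \<circ> perm_of g) {..<n} (diagram \<kappa>)"
    using assms(2) by (intro bij_betw_trans) (auto simp: numberings_def)
  then have "bij_betw (restrict (\<phi> \<circ> perm_of g) {..<n}) {..<n} (diagram \<kappa>)"
    by (rule bij_betw_cong[THEN iffD1, rotated]) simp
  then show ?thesis by (simp add: numberings_def)
qed

lemma numberings_relabel_inverse:
  assumes "g \<in> Sn n" "\<phi> \<in> numberings n \<kappa>"
  shows "restrict (restrict (\<phi> \<circ> perm_of (- g)) {..<n} \<circ> perm_of g) {..<n} = \<phi>"
proof (rule extensionalityI)
  show "\<phi> \<in> extensional {..<n}" using assms by (simp add: numberings_def)
  fix i assume i: "i \<in> {..<n}"
  have "perm_of (- g) (perm_of g i) = i" using perm_of_add[of "- g" g] by (simp add: perm_of_zero fun_eq_iff)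
  then show "restrict (restrict (\<phi> \<circ> perm_of (- g)) {..<n} \<circ> perm_of g) {..<n} i = \<phi> i"
    using i Sn_perm_of[OF assms(1), of i] by simp
qed simp

lemma young_Sn_algebra: "young n \<kappa> \<in> Sn_algebra n"
  unfolding young_def by (intro Sn_algebra_sum Sn_algebra_mult symmetrizer_Sn_algebra antisymmetrizer_Sn_algebra)

lemma central_young: "central n (young n \<kappa>)"
  unfolding central_def
proof (intro conjI young_Sn_algebra ballI)
  fix g assume g: "g \<in> Sn n"
  let ?R = "\<lambda>\<phi> :: nat \<Rightarrow> nat \<times> nat. symmetrizer n (fst \<circ> \<phi>)"
  let ?C = "\<lambda>\<phi> :: nat \<Rightarrow> nat \<times> nat. antisymmetrizer n (snd \<circ> \<phi>)"
  let ?r = "\<lambda>\<phi>. restrict (\<phi> \<circ> perm_of (- g)) {..<n} :: nat \<Rightarrow> nat \<times> nat"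
  have "gsingle g 1 * (?R \<phi> * ?C \<phi>) = ?R (?r \<phi>) * ?C (?r \<phi>) * gsingle g 1" for \<phi>
  proof -
    have "gsingle g 1 * (?R \<phi> * ?C \<phi>) = symmetrizer n (fst \<circ> \<phi> \<circ> perm_of (- g)) * (gsingle g 1 * ?C \<phi>)"
      by (simp only: mult.assoc[symmetric] single_symmetrizer(1)[OF g])
    also have "\<dots> = symmetrizer n (fst \<circ> \<phi> \<circ> perm_of (- g)) * antisymmetrizer n (snd \<circ> \<phi> \<circ> perm_of (- g)) * gsingle g 1"
      by (simp only: single_symmetrizer(2)[OF g] mult.assoc)
    also have "symmetrizer n (fst \<circ> \<phi> \<circ> perm_of (- g)) = ?R (?r \<phi>)" by (rule symmetrizer_cong) simp
    also have "antisymmetrizer n (snd \<circ> \<phi> \<circ> perm_of (- g)) = ?C (?r \<phi>)" by (rule symmetrizer_cong) simp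
    finally show ?thesis .
  qed
  then have "gsingle g 1 * young n \<kappa> = (\<Sum>\<phi>\<in>numberings n \<kappa>. ?R (?r \<phi>) * ?C (?r \<phi>)) * gsingle g 1"
    unfolding young_def sum_distrib_left sum_distrib_right by (intro sum.cong refl)
  also have "(\<Sum>\<phi>\<in>numberings n \<kappa>. ?R (?r \<phi>) * ?C (?r \<phi>)) = young n \<kappa>"
    unfolding young_def
    by (rule sum.reindex_bij_witness[of _ "\<lambda>\<phi>. restrict (\<phi> \<circ> perm_of g) {..<n}" ?r])
      (use numberings_relabel_inverse[OF g] numberings_relabel_inverse[OF Sn_uminus[OF g]]
        numberings_relabel[OF g] numberings_relabel[OF Sn_uminus[OF g]] in auto)
  finally show "gsingle g 1 * young n \<kappa> = young n \<kappa> * gsingle g 1" .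
qed

lemma symmetrizer_antisymmetrizer_reverse:
  "gcoeff (symmetrizer n c * antisymmetrizer n d) (- k) = gcoeff (antisymmetrizer n d * symmetrizer n c) k"
proof -
  have "gcoeff (symmetrizer n c * antisymmetrizer n d) (- k) =
      (\<Sum>g\<in>stab n c. \<Sum>h\<in>stab n d. if g + h = - k then fsign h else 0)"
    unfolding symmetrizer_def antisymmetrizer_def sum_product
    by (simp add: mult_single lookup_sum lookup_single when_def)
  also have "\<dots> = (\<Sum>g\<in>stab n c. \<Sum>h\<in>stab n d. if h + g = k then fsign h else 0)"
  proof (rule sum.reindex_bij_witness[of _ uminus uminus])
    fix g assume "g \<in> stab n c"
    show "(\<Sum>h\<in>stab n d. if h + - g = k then fsign h else 0) = (\<Sum>h\<in>stab n d. if g + h = - k then fsign h else 0)"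
    proof (rule sum.reindex_bij_witness[of _ uminus uminus])
      fix h
      have "g + - h = - k \<longleftrightarrow> h + - g = k" by (metis minus_add minus_minus)
      then show "(if g + - h = - k then fsign (- h) else 0) = (if h + - g = k then fsign h else 0)"
        by (simp only: fsign_uminus)
    qed (auto simp: stab_uminus)
  qed (auto simp: stab_uminus)
  also have "\<dots> = (\<Sum>h\<in>stab n d. \<Sum>g\<in>stab n c. if h + g = k then fsign h else 0)"
    by (rule sum.swap)
  also have "\<dots> = gcoeff (antisymmetrizer n d * symmetrizer n c) k"
    unfolding symmetrizer_def antisymmetrizer_def sum_product
    by (simp add: mult_single lookup_sum lookup_single when_def)
  finally show ?thesis .
qed

text \<open>
  The inversion \<open>g \<mapsto> - g\<close> fixes a central element and reverses the order of the two factors.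
\<close>

lemma young_alt: "young n \<kappa> = (\<Sum>\<phi>\<in>numberings n \<kappa>. antisymmetrizer n (snd \<circ> \<phi>) * symmetrizer n (fst \<circ> \<phi>))"
proof (rule poly_mapping_eqI)
  fix k
  have "gcoeff (young n \<kappa>) k = gcoeff (young n \<kappa>) (- k)" by (rule central_inverse_coeff[OF central_young, symmetric])
  also have "\<dots> = gcoeff (\<Sum>\<phi>\<in>numberings n \<kappa>. antisymmetrizer n (snd \<circ> \<phi>) * symmetrizer n (fst \<circ> \<phi>)) k"
    by (simp only: young_def lookup_sum symmetrizer_antisymmetrizer_reverse)
  finally show "gcoeff (young n \<kappa>) k =
    gcoeff (\<Sum>\<phi>\<in>numberings n \<kappa>. antisymmetrizer n (snd \<circ> \<phi>) * symmetrizer n (fst \<circ> \<phi>)) k" .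
qed

text \<open>
  The unit is a product of a row permutation and a column permutation in exactly one way, because only
  the unit preserves all rows and all columns.
\<close>

lemma young_coeff_0: assumes "\<kappa> \<in> partitions_of n" shows "gcoeff (young n \<kappa>) 0 \<noteq> 0"
proof -
  have "gcoeff (symmetrizer n (fst \<circ> \<phi>) * antisymmetrizer n (snd \<circ> \<phi>)) 0 = 1" if \<phi>: "\<phi> \<in> numberings n \<kappa>" for \<phi>
  proof -
    have triv: "g = 0" if "g \<in> stab n (fst \<circ> \<phi>)" "g \<in> stab n (snd \<circ> \<phi>)" for g
    proof -
      have "perm_of g i = i" if "i < n" for i
      proof -
        have "\<phi> (perm_of g i) = \<phi> i"
          using \<open>g \<in> stab n (fst \<circ> \<phi>)\<close> \<open>g \<in> stab n (snd \<circ> \<phi>)\<close> that by (simp add: stab_def prod_eq_iff)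
        moreover have "perm_of g i < n" using that \<open>g \<in> stab n (fst \<circ> \<phi>)\<close> by (intro Sn_perm_of stab_Sn)
        ultimately show ?thesis using \<phi> that by (auto simp: numberings_def bij_betw_def inj_on_def)
      qed
      moreover have "perm_of g i = i" if "\<not> i < n" for i
        using stab_Sn[OF \<open>g \<in> stab n (fst \<circ> \<phi>)\<close>] that by (auto simp: Sn_def permutes_def)
      ultimately have "perm_of g = perm_of 0" unfolding perm_of_zero by (intro ext) (metis id_apply)
      then show ?thesis by (simp only: perm_of_inject_eq)
    qed
    have "gcoeff (symmetrizer n (fst \<circ> \<phi>) * antisymmetrizer n (snd \<circ> \<phi>)) 0 =
      (\<Sum>g\<in>stab n (fst \<circ> \<phi>). \<Sum>h\<in>stab n (snd \<circ> \<phi>). if g + h = 0 then fsign h else 0)"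
      unfolding symmetrizer_def antisymmetrizer_def sum_product
      by (simp add: mult_single lookup_sum lookup_single when_def)
    also have "\<dots> = (\<Sum>g\<in>stab n (fst \<circ> \<phi>). if g = 0 then 1 else 0)"
    proof (rule sum.cong[OF refl])
      fix g assume g: "g \<in> stab n (fst \<circ> \<phi>)"
      have "(\<Sum>h\<in>stab n (snd \<circ> \<phi>). if g + h = 0 then fsign h else 0) =
          (\<Sum>h\<in>stab n (snd \<circ> \<phi>). if h = - g then fsign h else 0)"
        by (intro sum.cong refl) (simp add: add_eq_0_iff eq_commute[of _ "- g"])
      also have "\<dots> = (if - g \<in> stab n (snd \<circ> \<phi>) then fsign (- g) else 0)" by (simp add: sum.delta)
      also have "\<dots> = (if g = 0 then 1 else 0)"
        using triv[OF g] stab_0 by (auto simp: stab_uminus_iff fsign_uminus fsign_0)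
      finally show "(\<Sum>h\<in>stab n (snd \<circ> \<phi>). if g + h = 0 then fsign h else 0) = (if g = 0 then 1 else 0)" .
    qed
    also have "\<dots> = 1" by (simp add: sum.delta stab_0)
    finally show ?thesis .
  qed
  then have "gcoeff (young n \<kappa>) 0 = of_nat (card (numberings n \<kappa>))"
    by (simp add: young_def lookup_sum)
  then show ?thesis using numberings_nonempty[OF assms] finite_numberings by auto
qed

lemma card_fibres: "finite A \<Longrightarrow> finite C \<Longrightarrow> f ` A \<subseteq> C \<Longrightarrow> card A = (\<Sum>c\<in>C. card {x \<in> A. f x = c})"
  using sum.group[of A C f "\<lambda>_. 1 :: nat"] by simp

text \<open>
  Among the labels with \<open>T i < k\<close> a column contains at most \<open>k\<close>, and not more than its height. The
  first \<open>k\<close> rows of the diagram contain exactly the smaller of these two numbers.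
\<close>

lemma column_injective_dominance:
  assumes \<kappa>: "is_partition \<kappa>" and \<phi>: "\<phi> \<in> numberings n \<kappa>"
    and inj: "\<And>i j. i < n \<Longrightarrow> j < n \<Longrightarrow> i \<noteq> j \<Longrightarrow> T i = T j \<Longrightarrow> snd (\<phi> i) \<noteq> snd (\<phi> j)"
  shows "card {i. i < n \<and> T i < k} \<le> sum_list (take k \<kappa>)"
proof -
  let ?A = "{i. i < n \<and> T i < k}" and ?B = "{x \<in> diagram \<kappa>. fst x < k}" and ?C = "snd ` diagram \<kappa>"
  have b: "bij_betw \<phi> {..<n} (diagram \<kappa>)" using \<phi> by (simp add: numberings_def)
  have in_diag: "\<phi> i \<in> diagram \<kappa>" if "i < n" for i using b that by (auto simp: bij_betw_def)
  have col: "card {i \<in> ?A. snd (\<phi> i) = c} \<le> card {x \<in> ?B. snd x = c}" for c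
  proof (cases "k > 0 \<and> (k - 1, c) \<in> diagram \<kappa>")
    case True
    have "inj_on T {i \<in> ?A. snd (\<phi> i) = c}" using inj by (fastforce simp: inj_on_def)
    then have "card {i \<in> ?A. snd (\<phi> i) = c} \<le> card {..<k}" by (rule card_inj_on_le) auto
    also have "card {..<k} = card ((\<lambda>r. (r, c)) ` {..<k})" by (simp add: card_image inj_on_def)
    also have "\<dots> \<le> card {x \<in> ?B. snd x = c}"
    proof (rule card_mono)
      have "(r, c) \<in> diagram \<kappa>" if "r < k" for r
        using True that by (intro diagram_upper[OF \<kappa>, of "k - 1" c r]) auto
      then show "(\<lambda>r. (r, c)) ` {..<k} \<subseteq> {x \<in> ?B. snd x = c}" by auto
    qed simp
    finally show ?thesis .
  next
    case False
    have "fst x < k \<or> k = 0" if "x \<in> diagram \<kappa>" "snd x = c" for x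
    proof (rule ccontr)
      assume n: "\<not> (fst x < k \<or> k = 0)"
      have "(fst x, c) \<in> diagram \<kappa>" using that by auto
      then have "(k - 1, c) \<in> diagram \<kappa>" using n by (intro diagram_upper[OF \<kappa> \<open>(fst x, c) \<in> diagram \<kappa>\<close>]) auto
      then show False using False n by simp
    qed
    then have "\<phi> ` {i \<in> ?A. snd (\<phi> i) = c} \<subseteq> {x \<in> ?B. snd x = c}" using in_diag by fastforce
    moreover have "inj_on \<phi> {i \<in> ?A. snd (\<phi> i) = c}"
      using b by (auto simp: bij_betw_def intro: inj_on_subset)
    ultimately show ?thesis by (intro card_inj_on_le[of \<phi>]) auto
  qed
  have "card ?A = (\<Sum>c\<in>?C. card {i \<in> ?A. snd (\<phi> i) = c})"
    using in_diag by (intro card_fibres) auto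
  also have "\<dots> \<le> (\<Sum>c\<in>?C. card {x \<in> ?B. snd x = c})" by (intro sum_mono col)
  also have "\<dots> = card ?B" by (intro card_fibres[symmetric]) auto
  also have "\<dots> = sum_list (take k \<kappa>)" by (rule card_diagram_rows)
  finally show ?thesis .
qed

lemma card_rows_numbering:
  assumes "\<phi> \<in> numberings n \<kappa>"
  shows "card {i. i < n \<and> fst (\<phi> i) < k} = sum_list (take k \<kappa>)"
proof -
  have b: "bij_betw \<phi> {..<n} (diagram \<kappa>)" using assms by (simp add: numberings_def)
  then have im: "\<phi> ` {..<n} = diagram \<kappa>" and inj: "inj_on \<phi> {..<n}" by (auto simp: bij_betw_def)
  have "card (\<phi> ` {i. i < n \<and> fst (\<phi> i) < k}) = card {i. i < n \<and> fst (\<phi> i) < k}"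
    by (rule card_image, rule inj_on_subset[OF inj]) auto
  moreover have "\<phi> ` {i. i < n \<and> fst (\<phi> i) < k} = {x \<in> diagram \<kappa>. fst x < k}"
    unfolding im[symmetric] by auto
  ultimately show ?thesis by (simp only: card_diagram_rows)
qed

lemma numberings_nonzero_dominates:
  assumes "is_partition \<kappa>" "\<phi> \<in> numberings n \<kappa>" "\<psi> \<in> numberings n \<rho>"
    and "symmetrizer n (fst \<circ> \<psi>) * antisymmetrizer n (snd \<circ> \<phi>) \<noteq> 0"
  shows "dominates \<kappa> \<rho>"
  unfolding dominates_def
proof
  fix k
  have "card {i. i < n \<and> fst (\<psi> i) < k} \<le> sum_list (take k \<kappa>)"
    using assms(4) clash_annihilates(1)[of _ n _ "fst \<circ> \<psi>" "snd \<circ> \<phi>"]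
    by (intro column_injective_dominance[OF assms(1,2)]) auto
  then show "sum_list (take k \<rho>) \<le> sum_list (take k \<kappa>)" by (simp add: card_rows_numbering[OF assms(3)])
qed

text \<open>
  Moving the central factor between the row and the column part of the other one, each summand takes
  the form of a product of \<open>R\<^sub>\<phi> C\<^sub>\<psi>\<close> and \<open>R\<^sub>\<psi> C\<^sub>\<phi>\<close>. If neither of these is zero, then the two partitions dominate each
  other.
\<close>

lemma young_mult_zero:
  assumes "\<kappa> \<in> partitions_of n" "\<rho> \<in> partitions_of n" "\<kappa> \<noteq> \<rho>"
  shows "young n \<kappa> * young n \<rho> = 0"
proof -
  have P: "is_partition \<kappa>" "is_partition \<rho>" using assms by (auto simp: partitions_of_def)
  let ?R = "\<lambda>\<phi> :: nat \<Rightarrow> nat \<times> nat. symmetrizer n (fst \<circ> \<phi>)"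
  let ?C = "\<lambda>\<phi> :: nat \<Rightarrow> nat \<times> nat. antisymmetrizer n (snd \<circ> \<phi>)"
  have zero: "?R \<phi> * (?C \<psi> * ?R \<psi>) * ?C \<phi> = 0" if "\<phi> \<in> numberings n \<kappa>" "\<psi> \<in> numberings n \<rho>" for \<phi> \<psi>
  proof -
    have "?R \<phi> * ?C \<psi> = 0 \<or> ?R \<psi> * ?C \<phi> = 0"
      using numberings_nonzero_dominates[OF P(2) that(2,1)] numberings_nonzero_dominates[OF P(1) that]
        dominates_antisym[OF P] assms(3) by blast
    moreover have "?R \<phi> * (?C \<psi> * ?R \<psi>) * ?C \<phi> = (?R \<phi> * ?C \<psi>) * (?R \<psi> * ?C \<phi>)"
      by (simp only: mult.assoc)
    ultimately show ?thesis by auto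
  qed
  have "?R \<phi> * ?C \<phi> * young n \<rho> = 0" if \<phi>: "\<phi> \<in> numberings n \<kappa>" for \<phi>
  proof -
    have "?R \<phi> * ?C \<phi> * young n \<rho> = ?R \<phi> * young n \<rho> * ?C \<phi>"
      by (simp only: mult.assoc central_commute[OF central_young antisymmetrizer_Sn_algebra, of n \<rho> "snd \<circ> \<phi>"])
    also have "\<dots> = (\<Sum>\<psi>\<in>numberings n \<rho>. ?R \<phi> * (?C \<psi> * ?R \<psi>) * ?C \<phi>)"
      by (simp only: young_alt sum_distrib_left sum_distrib_right)
    also have "\<dots> = 0" using zero[OF \<phi>] by (intro sum.neutral) blast
    finally show ?thesis .
  qed
  then show ?thesis
    by (subst young_def) (simp add: sum_distrib_right)
qed

lemma mcoeff_frobenius: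
  assumes "x \<in> Sn_algebra n"
  shows "mcoeff (frobenius n x) M = (\<Sum>T\<in>fillings {..<n} id M. gcoeff (x * symmetrizer n T) 0)"
proof -
  have fin: "finite (fillings {..<n} id M :: (nat \<Rightarrow> nat) set)" by (intro finite_fillings) simp
  have sym: "gcoeff (symmetrizer n T) g = (if g \<in> stab n T then 1 else 0)" for T :: "nat \<Rightarrow> nat" and g
    by (simp add: symmetrizer_def lookup_sum lookup_single when_def)
  have cnt: "of_nat (card (fillings {..<n} (perm_of g) M :: (nat \<Rightarrow> nat) set)) =
      (\<Sum>T\<in>fillings {..<n} id M. if g \<in> stab n T then 1 else 0 :: complex)" if "g \<in> Sn n" for g
  proof -
    have "fillings {..<n} (perm_of g) M = {T \<in> fillings {..<n} id M. g \<in> stab n T}" for M :: "nat multiset"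
      using that by (auto simp: fillings_def stab_def)
    then show ?thesis using fin by (simp add: sum.If_cases Int_def)
  qed
  have "mcoeff (frobenius n x) M = (\<Sum>g\<in>Sn n. gcoeff x g * of_nat (card (fillings {..<n} (perm_of g) M :: (nat \<Rightarrow> nat) set)))"
    by (simp add: frobenius_def perm_series_def mcoeff_fix_series)
  also have "\<dots> = (\<Sum>g\<in>Sn n. \<Sum>T\<in>fillings {..<n} id M. gcoeff x g * (if g \<in> stab n T then 1 else 0))"
    by (intro sum.cong refl) (simp only: cnt sum_distrib_left)
  also have "\<dots> = (\<Sum>T\<in>fillings {..<n} id M. \<Sum>g\<in>Sn n. gcoeff x g * (if g \<in> stab n T then 1 else 0))"
    by (rule sum.swap)
  also have "\<dots> = (\<Sum>T\<in>fillings {..<n} id M. gcoeff (x * symmetrizer n T) 0)"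
    by (simp only: gcoeff_mult_0[OF assms] sym stab_uminus_iff)
  finally show ?thesis .
qed

lemma frobenius_young_top_dominates:
  assumes \<kappa>: "\<kappa> \<in> partitions_of n" and nz: "mcoeff (frobenius n (young n \<kappa>)) (top_content \<rho>) \<noteq> 0"
  shows "dominates \<kappa> \<rho>"
proof -
  have P: "is_partition \<kappa>" using \<kappa> by (simp add: partitions_of_def)
  obtain T where T: "T \<in> fillings {..<n} id (top_content \<rho>)" and "gcoeff (young n \<kappa> * symmetrizer n T) 0 \<noteq> 0"
    using nz unfolding mcoeff_frobenius[OF young_Sn_algebra] by (rule sum.not_neutral_contains_not_neutral)
  then have "young n \<kappa> * symmetrizer n T \<noteq> 0" by auto
  then have "(\<Sum>\<phi>\<in>numberings n \<kappa>. symmetrizer n (fst \<circ> \<phi>) * antisymmetrizer n (snd \<circ> \<phi>) * symmetrizer n T) \<noteq> 0"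
    unfolding young_def sum_distrib_right .
  then obtain \<phi> where \<phi>: "\<phi> \<in> numberings n \<kappa>"
    and "symmetrizer n (fst \<circ> \<phi>) * antisymmetrizer n (snd \<circ> \<phi>) * symmetrizer n T \<noteq> 0"
    by (rule sum.not_neutral_contains_not_neutral)
  then have nz': "antisymmetrizer n (snd \<circ> \<phi>) * symmetrizer n T \<noteq> 0" by (auto simp: mult.assoc)
  show ?thesis unfolding dominates_def
  proof
    fix k
    have "sum_list (take k \<rho>) = size (filter_mset (\<lambda>v. v < k) (top_content \<rho>))"
      by (simp add: top_content_def filter_mset_image_mset filter_mset_mset_set card_diagram_rows)
    also have "top_content \<rho> = image_mset T (mset_set {..<n})" using T by (simp add: fillings_def)
    also have "size (filter_mset (\<lambda>v. v < k) (image_mset T (mset_set {..<n}))) = card {i. i < n \<and> T i < k}"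
      by (simp add: filter_mset_image_mset filter_mset_mset_set)
    also have "\<dots> \<le> sum_list (take k \<kappa>)"
      using nz' clash_annihilates(2)[of _ n _ T "snd \<circ> \<phi>"]
      by (intro column_injective_dominance[OF P \<phi>]) auto
    finally show "sum_list (take k \<rho>) \<le> sum_list (take k \<kappa>)" .
  qed
qed

text \<open>
  At a maximal \<open>\<rho>\<close> that violates the conclusion only one Schur function contributes to the coefficient at
  \<open>top_content \<rho>\<close>.
\<close>

lemma schur_combination_triangular:
  assumes low: "\<And>\<rho>. \<rho> \<in> partitions_of n \<Longrightarrow>
      mcoeff (\<Sum>\<kappa>\<in>partitions_of n. msmult (a \<kappa>) (schur \<kappa>)) (top_content \<rho>) \<noteq> 0 \<Longrightarrow> dominates \<mu> \<rho>"
    and \<kappa>: "\<kappa> \<in> partitions_of n" "a \<kappa> \<noteq> 0"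
  shows "dominates \<mu> \<kappa>"
proof (rule ccontr)
  assume "\<not> dominates \<mu> \<kappa>"
  define S where "S = {\<kappa> \<in> partitions_of n. a \<kappa> \<noteq> 0 \<and> \<not> dominates \<mu> \<kappa>}"
  have "finite S" "S \<noteq> {}" using \<kappa> \<open>\<not> dominates \<mu> \<kappa>\<close> by (auto simp: S_def)
  then obtain \<rho> where \<rho>: "\<rho> \<in> S" and max: "\<And>\<tau>. \<tau> \<in> S \<Longrightarrow> dominance_rank \<tau> \<le> dominance_rank \<rho>"
    using Max_in[of "dominance_rank ` S"] Max_ge[of "dominance_rank ` S"]
    by (metis (no_types, lifting) empty_is_image finite_imageI imageE imageI)
  have zero: "a \<tau> * mcoeff (schur \<tau>) (top_content \<rho>) = 0" if \<tau>: "\<tau> \<in> partitions_of n - {\<rho>}" for \<tau>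
  proof (rule ccontr)
    assume *: "a \<tau> * mcoeff (schur \<tau>) (top_content \<rho>) \<noteq> 0"
    then have d: "dominates \<tau> \<rho>" using \<tau> schur_top_dominates[of \<tau> n \<rho>] by auto
    then have "dominance_rank \<rho> < dominance_rank \<tau>"
      using \<tau> \<rho> by (intro dominance_rank_less[of _ n]) (auto simp: S_def)
    then have "\<tau> \<notin> S" using max[of \<tau>] by auto
    then have "dominates \<mu> \<tau>" using * \<tau> by (auto simp: S_def)
    then have "dominates \<mu> \<rho>" using d unfolding dominates_def by (meson order_trans)
    then show False using \<rho> by (simp add: S_def)
  qed
  have "mcoeff (\<Sum>\<kappa>\<in>partitions_of n. msmult (a \<kappa>) (schur \<kappa>)) (top_content \<rho>) =
      (\<Sum>\<tau>\<in>partitions_of n. a \<tau> * mcoeff (schur \<tau>) (top_content \<rho>))" by simp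
  also have "\<dots> = (\<Sum>\<tau>\<in>{\<rho>}. a \<tau> * mcoeff (schur \<tau>) (top_content \<rho>))"
    using \<rho> zero by (intro sum.mono_neutral_right) (auto simp: S_def)
  also have "\<dots> \<noteq> 0" using \<rho> mcoeff_schur_top[of \<rho>] by (simp add: S_def)
  finally have "dominates \<mu> \<rho>" using low[of \<rho>] \<rho> by (simp add: S_def)
  then show False using \<rho> by (simp add: S_def)
qed

text \<open>
  Both families are orthogonal for the trace form \<open>gcoeff (x * y) 0\<close>, and the Young elements are
  triangular with respect to the characters in the dominance order. An orthogonal family that is triangular over
  an orthogonal basis is diagonal.
\<close>

lemma young_proportional:
  assumes "\<kappa> \<in> partitions_of n"
  shows "\<exists>c. c \<noteq> 0 \<and> young n \<kappa> = scalar c * char_elem n \<kappa>"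
  using assms
proof (induction "dominance_rank \<kappa>" arbitrary: \<kappa> rule: less_induct)
  case (less \<kappa>)
  obtain c where c: "young n \<kappa> = (\<Sum>\<rho>\<in>partitions_of n. scalar (c \<rho>) * char_elem n \<rho>)"
    using central_expansion[OF central_young] .
  have "frobenius n (young n \<kappa>) = (\<Sum>\<rho>\<in>partitions_of n. msmult (c \<rho> * fact n) (schur \<rho>))"
    unfolding c by (simp add: frobenius_sum frobenius_scalar_mult frobenius_char_elem)
  then have dom: "dominates \<kappa> \<rho>" if "\<rho> \<in> partitions_of n" "c \<rho> \<noteq> 0" for \<rho>
    using schur_combination_triangular[of n "\<lambda>\<rho>. c \<rho> * fact n" \<kappa> \<rho>] frobenius_young_top_dominates[OF less.prems] that
    by simp
  have zero: "c \<rho> = 0" if \<rho>: "\<rho> \<in> partitions_of n" "\<rho> \<noteq> \<kappa>" for \<rho>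
  proof (rule ccontr)
    assume "c \<rho> \<noteq> 0"
    then have "dominance_rank \<rho> < dominance_rank \<kappa>"
      using dom \<rho> less.prems by (intro dominance_rank_less[of _ n]) auto
    then obtain d where d: "d \<noteq> 0" "young n \<rho> = scalar d * char_elem n \<rho>" using less.hyps \<rho> by blast
    \<comment> \<open>the trace pairing with \<open>young n \<rho>\<close> isolates the coefficient \<open>c \<rho>\<close>\<close>
    have "0 = gcoeff (young n \<kappa> * young n \<rho>) 0"
      using young_mult_zero[OF less.prems \<rho>(1)] \<rho>(2) by simp
    also have "\<dots> = d * gcoeff (young n \<kappa> * char_elem n \<rho>) 0"
      by (simp add: d(2) scalar_mult_left_commute)
    also have "gcoeff (young n \<kappa> * char_elem n \<rho>) 0 = (\<Sum>\<tau>\<in>partitions_of n. c \<tau> * gcoeff (char_elem n \<tau> * char_elem n \<rho>) 0)"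
      unfolding c by (simp add: sum_distrib_right lookup_sum mult.assoc)
    also have "\<dots> = (\<Sum>\<tau>\<in>partitions_of n. if \<tau> = \<rho> then c \<rho> * fact n else 0)"
      using \<rho> by (intro sum.cong refl) (simp add: char_elem_orthogonality)
    also have "\<dots> = c \<rho> * fact n" using \<rho> by (simp add: sum.delta)
    finally show False using d(1) \<open>c \<rho> \<noteq> 0\<close> by simp
  qed
  have "young n \<kappa> = (\<Sum>\<rho>\<in>{\<kappa>}. scalar (c \<rho>) * char_elem n \<rho>)"
    unfolding c using less.prems zero by (intro sum.mono_neutral_right) auto
  then have y: "young n \<kappa> = scalar (c \<kappa>) * char_elem n \<kappa>" by simp
  moreover have "c \<kappa> \<noteq> 0" using young_coeff_0[OF less.prems] y by auto
  ultimately show ?case by blast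
qed

lemma scalar_mult_eq_0D: "c \<noteq> 0 \<Longrightarrow> scalar c * x = 0 \<Longrightarrow> x = 0"
  using scalar_mult_cancel[of c x 0] by simp

lemma char_elem_mult_zero:
  assumes "\<kappa> \<in> partitions_of n" "\<rho> \<in> partitions_of n" "\<kappa> \<noteq> \<rho>"
  shows "char_elem n \<kappa> * char_elem n \<rho> = 0"
proof -
  obtain c where c: "c \<noteq> 0" "young n \<kappa> = scalar c * char_elem n \<kappa>" using young_proportional[OF assms(1)] by blast
  obtain d where d: "d \<noteq> 0" "young n \<rho> = scalar d * char_elem n \<rho>" using young_proportional[OF assms(2)] by blast
  have "scalar c * (scalar d * (char_elem n \<kappa> * char_elem n \<rho>)) = 0"
    using young_mult_zero[OF assms] unfolding c(2) d(2) by (simp only: mult.assoc scalar_mult_left_commute[of "char_elem n \<kappa>"])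
  then have "scalar d * (char_elem n \<kappa> * char_elem n \<rho>) = 0" by (rule scalar_mult_eq_0D[OF c(1)])
  then show ?thesis by (rule scalar_mult_eq_0D[OF d(1)])
qed

text \<open>
  Multiply the expansion of the unit \<open>n! = \<Sum>\<^sub>\<rho> f\<^sup>\<rho> \<chi>\<^sup>\<rho>\<close> by \<open>\<chi>\<^sup>\<kappa>\<close>; the terms with \<open>\<rho> \<noteq> \<kappa>\<close> vanish.
\<close>

lemma char_elem_square:
  assumes "\<kappa> \<in> partitions_of n"
  shows "num_syt \<kappa> \<noteq> 0" "char_elem n \<kappa> * char_elem n \<kappa> = scalar (fact n / of_nat (num_syt \<kappa>)) * char_elem n \<kappa>"
proof -
  have "scalar (fact n) * char_elem n \<kappa> = (\<Sum>\<rho>\<in>partitions_of n. scalar (of_nat (num_syt \<rho>)) * (char_elem n \<rho> * char_elem n \<kappa>))"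
    by (simp add: sum_num_syt_char_elem[symmetric] sum_distrib_right mult.assoc)
  also have "\<dots> = (\<Sum>\<rho>\<in>{\<kappa>}. scalar (of_nat (num_syt \<rho>)) * (char_elem n \<rho> * char_elem n \<kappa>))"
    using assms char_elem_mult_zero by (intro sum.mono_neutral_right) auto
  finally have eq: "scalar (fact n) * char_elem n \<kappa> = scalar (of_nat (num_syt \<kappa>)) * (char_elem n \<kappa> * char_elem n \<kappa>)" by simp
  have "char_elem n \<kappa> \<noteq> 0" using char_elem_orthogonality[OF assms assms] by auto
  then have "scalar (fact n) * char_elem n \<kappa> \<noteq> 0" using scalar_mult_cancel[of "fact n" "char_elem n \<kappa>" 0] by auto
  then show nz: "num_syt \<kappa> \<noteq> 0" unfolding eq by (cases "num_syt \<kappa>") auto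
  have "scalar (of_nat (num_syt \<kappa>)) * (scalar (fact n / of_nat (num_syt \<kappa>)) * char_elem n \<kappa>) = scalar (fact n) * char_elem n \<kappa>"
    using nz by (simp add: mult.assoc[symmetric] scalar_mult)
  from trans[OF this eq] have "scalar (of_nat (num_syt \<kappa>)) * (char_elem n \<kappa> * char_elem n \<kappa>) =
      scalar (of_nat (num_syt \<kappa>)) * (scalar (fact n / of_nat (num_syt \<kappa>)) * char_elem n \<kappa>)" by (rule sym)
  from scalar_mult_cancel[OF _ this]
  show "char_elem n \<kappa> * char_elem n \<kappa> = scalar (fact n / of_nat (num_syt \<kappa>)) * char_elem n \<kappa>"
    using nz by simp
qed

text \<open>
  The elements \<open>char_elem n \<kappa>\<close> are orthogonal idempotents up to the factors \<open>n! / f\<^sup>\<kappa>\<close>, and they are mapped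
  to \<open>n! s\<^sub>\<kappa>\<close>. Hence the Schur functions multiply as the class product prescribes.
\<close>

theorem frobenius_mult:
  assumes "central n x" "central n y"
  shows "frobenius n (x * y) = class_prod n (frobenius n x) (frobenius n y)"
proof -
  obtain a where a: "x = (\<Sum>\<kappa>\<in>partitions_of n. scalar (a \<kappa>) * char_elem n \<kappa>)" using central_expansion[OF assms(1)] .
  obtain b where b: "y = (\<Sum>\<kappa>\<in>partitions_of n. scalar (b \<kappa>) * char_elem n \<kappa>)" using central_expansion[OF assms(2)] .
  have chx: "frobenius n (\<Sum>\<kappa>\<in>partitions_of n. scalar (c \<kappa>) * char_elem n \<kappa>) = (\<Sum>\<kappa>\<in>partitions_of n. msmult (c \<kappa> * fact n) (schur \<kappa>))" for c
    by (simp add: frobenius_sum frobenius_scalar_mult frobenius_char_elem)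
  have summand: "(scalar (a \<kappa>) * char_elem n \<kappa>) * (scalar (b \<rho>) * char_elem n \<rho>) =
      (if \<rho> = \<kappa> then scalar (a \<kappa> * b \<kappa> * (fact n / of_nat (num_syt \<kappa>))) * char_elem n \<kappa> else 0)"
    if "\<kappa> \<in> partitions_of n" "\<rho> \<in> partitions_of n" for \<kappa> \<rho>
  proof -
    have eq: "(scalar (a \<kappa>) * char_elem n \<kappa>) * (scalar (b \<rho>) * char_elem n \<rho>) = scalar (a \<kappa>) * (scalar (b \<rho>) * (char_elem n \<kappa> * char_elem n \<rho>))"
      by (simp only: mult.assoc scalar_mult_left_commute[of "char_elem n \<kappa>"])
    show ?thesis
    proof (cases "\<rho> = \<kappa>")
      case True
      then show ?thesis
        unfolding eq by (simp only: char_elem_square(2)[OF that(1)] mult.assoc[symmetric] scalar_mult if_True simp_thms)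
    next
      case False
      then show ?thesis unfolding eq using char_elem_mult_zero[OF that] by simp
    qed
  qed
  have "x * y = (\<Sum>\<kappa>\<in>partitions_of n. \<Sum>\<rho>\<in>partitions_of n.
      if \<rho> = \<kappa> then scalar (a \<kappa> * b \<kappa> * (fact n / of_nat (num_syt \<kappa>))) * char_elem n \<kappa> else 0)"
    unfolding a b sum_product by (intro sum.cong refl summand)
  also have "\<dots> = (\<Sum>\<kappa>\<in>partitions_of n. scalar (a \<kappa> * b \<kappa> * (fact n / of_nat (num_syt \<kappa>))) * char_elem n \<kappa>)"
    by (intro sum.cong refl) (simp add: sum.delta)
  finally have "frobenius n (x * y) = (\<Sum>\<kappa>\<in>partitions_of n. msmult (a \<kappa> * b \<kappa> * (fact n / of_nat (num_syt \<kappa>)) * fact n) (schur \<kappa>))"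
    by (simp only: chx)
  also have "\<dots> = class_prod n (frobenius n x) (frobenius n y)"
    unfolding a b chx class_prod_combination by (simp add: mult_ac)
  finally show ?thesis .
qed

section \<open>Sums over injections\<close>

text \<open>
  The permutation \<open>w\<close> of \<open>X\<close> is transported to the image of \<open>\<iota>\<close> and extended by the identity.
\<close>

definition push :: "'a set \<Rightarrow> ('a \<Rightarrow> 'b) \<Rightarrow> ('a \<Rightarrow> 'a) \<Rightarrow> 'b \<Rightarrow> 'b" where
  "push X \<iota> w v = (if v \<in> \<iota> ` X then \<iota> (w (inv_into X \<iota> v)) else v)"

lemma push_apply: "inj_on \<iota> X \<Longrightarrow> x \<in> X \<Longrightarrow> push X \<iota> w (\<iota> x) = \<iota> (w x)"
  by (simp add: push_def)

lemma push_outside: "v \<notin> \<iota> ` X \<Longrightarrow> push X \<iota> w v = v"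
  by (simp add: push_def)

lemma push_bij:
  assumes "inj_on \<iota> X" "bij_betw w X X"
  shows "bij_betw (push X \<iota> w) (\<iota> ` X) (\<iota> ` X)"
proof -
  have b: "bij_betw \<iota> X (\<iota> ` X)" using assms(1) by (simp add: bij_betw_def)
  have "bij_betw (\<iota> \<circ> w \<circ> inv_into X \<iota>) (\<iota> ` X) (\<iota> ` X)"
    by (rule bij_betw_trans[OF bij_betw_inv_into[OF b]], rule bij_betw_trans[OF assms(2) b])
  then show ?thesis
    by (rule bij_betw_cong[THEN iffD1, rotated]) (simp add: push_def)
qed

lemma push_permutes:
  assumes "inj_on \<iota> X" "bij_betw w X X" "\<iota> ` X \<subseteq> Y"
  shows "push X \<iota> w permutes Y"
proof (rule permutes_subset[OF _ assms(3)])
  show "push X \<iota> w permutes \<iota> ` X"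
    using push_bij[OF assms(1,2)] push_outside by (rule bij_imp_permutes)
qed

lemma push_comp_fun:
  assumes "inj_on j U" "inj_on \<alpha> X" "\<alpha> ` X \<subseteq> U" "\<And>x. x \<in> X \<Longrightarrow> \<iota> x = j (\<alpha> x)"
    and w: "\<And>x. x \<in> X \<Longrightarrow> w x \<in> X"
  shows "push X \<iota> w = push U j (push X \<alpha> w)"
proof
  fix v
  have inj: "inj_on \<iota> X"
  proof (rule inj_onI)
    fix x y assume "x \<in> X" "y \<in> X" "\<iota> x = \<iota> y"
    then have "\<alpha> x = \<alpha> y" using assms(1,3,4) by (auto dest: inj_onD)
    then show "x = y" using assms(2) \<open>x \<in> X\<close> \<open>y \<in> X\<close> by (auto dest: inj_onD)
  qed
  show "push X \<iota> w v = push U j (push X \<alpha> w) v"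
  proof (cases "v \<in> \<iota> ` X")
    case True
    then obtain x where x: "x \<in> X" "v = \<iota> x" by blast
    then have "push U j (push X \<alpha> w) v = j (push X \<alpha> w (\<alpha> x))"
      using assms(1,3,4) by (auto simp: push_apply)
    also have "\<dots> = \<iota> (w x)"
      using push_apply[OF assms(2) x(1)] assms(4)[OF w[OF x(1)]] by simp
    also have "\<dots> = push X \<iota> w v" unfolding x(2) by (rule push_apply[OF inj x(1), symmetric])
    finally show ?thesis by (rule sym)
  next
    case False
    show ?thesis
    proof (cases "v \<in> j ` U")
      case True
      then obtain u where u: "u \<in> U" "v = j u" by blast
      then have "u \<notin> \<alpha> ` X" using False assms(4) by auto
      then show ?thesis using False u assms(1) by (simp add: push_apply push_outside)
    next
      case False': False
      then show ?thesis using False by (simp add: push_outside)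
    qed
  qed
qed

lemma push_compose:
  assumes "inj_on j U" "\<And>u. u \<in> U \<Longrightarrow> b u \<in> U"
  shows "push U j a \<circ> push U j b = push U j (a \<circ> b)"
proof
  fix v show "(push U j a \<circ> push U j b) v = push U j (a \<circ> b) v"
    using assms by (cases "v \<in> j ` U") (auto simp: push_apply push_outside)
qed

definition injections :: "'a set \<Rightarrow> nat \<Rightarrow> ('a \<Rightarrow> nat) set" where
  "injections X n = {\<iota> \<in> X \<rightarrow>\<^sub>E {..<n}. inj_on \<iota> X}"

lemma finite_injections: "finite X \<Longrightarrow> finite (injections X n)"
  by (rule finite_subset[of _ "X \<rightarrow>\<^sub>E {..<n}"]) (auto simp: injections_def intro: finite_PiE)

lemma card_injections:
  assumes "finite X" shows "card (injections X n) = (\<Prod>i<card X. n - i)"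
  using card_inj_on_subset_funcset[OF assms finite_lessThan[of n] subset_refl]
  by (simp add: injections_def atLeast0LessThan)

lemma injectionsD:
  "\<iota> \<in> injections X n \<Longrightarrow> inj_on \<iota> X" "\<iota> \<in> injections X n \<Longrightarrow> \<iota> ` X \<subseteq> {..<n}"
  "\<iota> \<in> injections X n \<Longrightarrow> \<iota> \<in> extensional X"
  by (auto simp: injections_def PiE_def)

lemma injectionsI: "inj_on \<iota> X \<Longrightarrow> \<iota> ` X \<subseteq> {..<n} \<Longrightarrow> restrict \<iota> X \<in> injections X n"
  by (auto simp: injections_def inj_on_def)

definition pushed :: "'a set \<Rightarrow> ('a \<Rightarrow> 'a) \<Rightarrow> ('a \<Rightarrow> nat) \<Rightarrow> fperm" where
  "pushed X w \<iota> = Abs_fperm (push X \<iota> w)"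

lemma perm_of_pushed:
  assumes "bij_betw w X X" "\<iota> \<in> injections X n"
  shows "perm_of (pushed X w \<iota>) = push X \<iota> w" "pushed X w \<iota> \<in> Sn n"
proof -
  have p: "push X \<iota> w permutes {..<n}"
    using assms injectionsD by (intro push_permutes) blast+
  then have "permutation (push X \<iota> w)" using permutation_permutes by blast
  then show a: "perm_of (pushed X w \<iota>) = push X \<iota> w" by (simp add: pushed_def Abs_fperm_inverse)
  then show "pushed X w \<iota> \<in> Sn n" using p by (simp add: Sn_def)
qed

definition injection_sum :: "'a set \<Rightarrow> ('a \<Rightarrow> 'a) \<Rightarrow> nat \<Rightarrow> galg" where
  "injection_sum X w n = (\<Sum>\<iota>\<in>injections X n. gsingle (pushed X w \<iota>) 1)"

lemma bij_betw_memD: "bij_betw w X X \<Longrightarrow> x \<in> X \<Longrightarrow> w x \<in> X"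
  by (auto simp: bij_betw_def)

text \<open>
  The sum depends on the conjugacy class of the permutation alone.
\<close>

lemma injection_sum_transport:
  assumes \<phi>: "bij_betw \<phi> X Y" and comm: "\<And>x. x \<in> X \<Longrightarrow> \<phi> (w x) = w' (\<phi> x)" and w: "\<And>x. x \<in> X \<Longrightarrow> w x \<in> X"
  shows "injection_sum X w n = injection_sum Y w' n"
proof -
  define \<psi> where "\<psi> = inv_into X \<phi>"
  have \<psi>: "bij_betw \<psi> Y X" unfolding \<psi>_def by (rule bij_betw_inv_into[OF \<phi>])
  have \<psi>\<phi>: "\<psi> (\<phi> x) = x" if "x \<in> X" for x using that \<phi> by (simp add: \<psi>_def bij_betw_inv_into_left)
  have \<phi>\<psi>: "\<phi> (\<psi> y) = y" if "y \<in> Y" for y using that \<phi> by (simp add: \<psi>_def bij_betw_inv_into_right)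
  have \<phi>Y: "\<phi> x \<in> Y" if "x \<in> X" for x using that \<phi> by (auto simp: bij_betw_def)
  have \<psi>X: "\<psi> y \<in> X" if "y \<in> Y" for y using that \<psi> by (auto simp: bij_betw_def)
  have inj: "inj_on \<phi> X" "inj_on \<psi> Y" using \<phi> \<psi> by (auto simp: bij_betw_def)
  have img: "\<phi> ` X = Y" "\<psi> ` Y = X" using \<phi> \<psi> by (auto simp: bij_betw_def)
  show ?thesis unfolding injection_sum_def
  proof (rule sum.reindex_bij_witness[of _ "\<lambda>\<iota>. restrict (\<iota> \<circ> \<phi>) X" "\<lambda>\<iota>. restrict (\<iota> \<circ> \<psi>) Y"])
    fix \<iota> assume \<iota>: "\<iota> \<in> injections X n"
    have "\<iota> \<in> extensional X" using \<iota> by (rule injectionsD)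
    then show "restrict (restrict (\<iota> \<circ> \<psi>) Y \<circ> \<phi>) X = \<iota>"
      using \<psi>\<phi> \<phi>Y by (intro extensionalityI[of _ X]) auto
    have "inj_on (\<iota> \<circ> \<psi>) Y" using injectionsD(1)[OF \<iota>] inj img by (intro comp_inj_on) auto
    moreover have "(\<iota> \<circ> \<psi>) ` Y \<subseteq> {..<n}" using injectionsD(2)[OF \<iota>] img by (auto simp: image_comp[symmetric])
    ultimately show in_Y: "restrict (\<iota> \<circ> \<psi>) Y \<in> injections Y n" by (rule injectionsI)
    have "push X \<iota> w = push Y (restrict (\<iota> \<circ> \<psi>) Y) (push X \<phi> w)"
      using injectionsD(1)[OF in_Y] inj img w \<psi>\<phi> \<phi>Y by (intro push_comp_fun) auto
    also have "\<dots> = push Y (restrict (\<iota> \<circ> \<psi>) Y) w'"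
    proof
      fix v
      have "push X \<phi> w y = w' y" if "y \<in> Y" for y
        using push_apply[OF inj(1) \<psi>X[OF that], of w] comm[OF \<psi>X[OF that]] \<phi>\<psi>[OF that] by simp
      moreover have "inv_into Y (restrict (\<iota> \<circ> \<psi>) Y) v \<in> Y" if "v \<in> restrict (\<iota> \<circ> \<psi>) Y ` Y"
        using that by (rule inv_into_into)
      ultimately show "push Y (restrict (\<iota> \<circ> \<psi>) Y) (push X \<phi> w) v = push Y (restrict (\<iota> \<circ> \<psi>) Y) w' v"
        unfolding push_def[of Y] by presburger
    qed
    finally show "gsingle (pushed Y w' (restrict (\<iota> \<circ> \<psi>) Y)) 1 = gsingle (pushed X w \<iota>) 1"
      by (simp only: pushed_def)
  next
    fix \<iota> assume \<iota>: "\<iota> \<in> injections Y n"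
    have "\<iota> \<in> extensional Y" using \<iota> by (rule injectionsD)
    then show "restrict (restrict (\<iota> \<circ> \<phi>) X \<circ> \<psi>) Y = \<iota>"
      using \<phi>\<psi> \<psi>X by (intro extensionalityI[of _ Y]) auto
    have "inj_on (\<iota> \<circ> \<phi>) X" using injectionsD(1)[OF \<iota>] inj img by (intro comp_inj_on) auto
    moreover have "(\<iota> \<circ> \<phi>) ` X \<subseteq> {..<n}" using injectionsD(2)[OF \<iota>] img by (auto simp: image_comp[symmetric])
    ultimately show "restrict (\<iota> \<circ> \<phi>) X \<in> injections X n" by (rule injectionsI)
  qed
qed

text \<open>
  Conjugation by \<open>g\<close> replaces an injection \<open>\<iota>\<close> by \<open>g \<circ> \<iota>\<close>, which only permutes the summands.
\<close>

lemma central_injection_sum: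
  assumes w: "bij_betw w X X"
  shows "central n (injection_sum X w n)"
  unfolding central_def
proof (intro conjI ballI)
  show "injection_sum X w n \<in> Sn_algebra n"
    unfolding injection_sum_def by (intro Sn_algebra_sum Sn_algebra_single perm_of_pushed(2)[OF w])
  fix g assume g: "g \<in> Sn n"
  have inv: "perm_of (- g) (perm_of g i) = i" "perm_of g (perm_of (- g) i) = i" for i
    using perm_of_add[of "- g" g] perm_of_add[of g "- g"] by (simp_all add: perm_of_zero fun_eq_iff)
  have move: "restrict (perm_of h \<circ> \<iota>) X \<in> injections X n" if "h \<in> Sn n" "\<iota> \<in> injections X n" for h \<iota>
  proof (rule injectionsI)
    have "inj (perm_of h)" using that(1) permutes_inj by (auto simp: Sn_def)
    then show "inj_on (perm_of h \<circ> \<iota>) X"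
      using injectionsD(1)[OF that(2)] by (intro comp_inj_on) (auto intro: inj_on_subset)
    show "(perm_of h \<circ> \<iota>) ` X \<subseteq> {..<n}" using injectionsD(2)[OF that(2)] Sn_perm_of[OF that(1)] by fastforce
  qed
  have conj: "g + pushed X w \<iota> = pushed X w (restrict (perm_of g \<circ> \<iota>) X) + g" if \<iota>: "\<iota> \<in> injections X n" for \<iota>
  proof -
    let ?\<iota>' = "restrict (perm_of g \<circ> \<iota>) X"
    have inj: "inj_on \<iota> X" "inj_on ?\<iota>' X" using injectionsD(1) \<iota> move[OF g \<iota>] by blast+
    have "perm_of g (push X \<iota> w v) = push X ?\<iota>' w (perm_of g v)" for v
    proof (cases "v \<in> \<iota> ` X")
      case True
      then obtain x where x: "x \<in> X" "v = \<iota> x" by blast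
      then have "push X ?\<iota>' w (?\<iota>' x) = ?\<iota>' (w x)" using inj by (intro push_apply)
      then show ?thesis using x inj bij_betw_memD[OF w] by (simp add: push_apply)
    next
      case False
      then have "perm_of g v \<notin> ?\<iota>' ` X"
      proof (rule contrapos_nn)
        assume "perm_of g v \<in> ?\<iota>' ` X"
        then obtain x where "x \<in> X" "perm_of g v = perm_of g (\<iota> x)" by auto
        then have "v = \<iota> x" using inv(1) by metis
        then show "v \<in> \<iota> ` X" using \<open>x \<in> X\<close> by blast
      qed
      then show ?thesis using False by (simp add: push_outside)
    qed
    then have "perm_of (g + pushed X w \<iota>) = perm_of (pushed X w ?\<iota>' + g)"
      by (simp add: perm_of_add perm_of_pushed(1)[OF w \<iota>] perm_of_pushed(1)[OF w move[OF g \<iota>]] fun_eq_iff)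
    then show ?thesis by (simp only: perm_of_inject_eq)
  qed
  have recover: "restrict (perm_of (- h) \<circ> restrict (perm_of h \<circ> \<iota>) X) X = \<iota>" if "\<iota> \<in> injections X n" "\<And>i. perm_of (- h) (perm_of h i) = i" for \<iota> h
    using injectionsD(3)[OF that(1)] that(2) by (intro extensionalityI[of _ X]) auto
  have "gsingle g 1 * injection_sum X w n = (\<Sum>\<iota>\<in>injections X n. gsingle (pushed X w (restrict (perm_of g \<circ> \<iota>) X) + g) 1)"
    unfolding injection_sum_def sum_distrib_left by (intro sum.cong refl) (simp add: mult_single conj)
  also have "\<dots> = (\<Sum>\<iota>\<in>injections X n. gsingle (pushed X w \<iota> + g) 1)"
    by (rule sum.reindex_bij_witness[of _ "\<lambda>\<iota>. restrict (perm_of (- g) \<circ> \<iota>) X" "\<lambda>\<iota>. restrict (perm_of g \<circ> \<iota>) X"])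
      (use recover[of _ g] recover[of _ "- g"] inv move[OF g] move[OF Sn_uminus[OF g]] in auto)
  also have "\<dots> = injection_sum X w n * gsingle g 1"
    by (simp add: injection_sum_def sum_distrib_right mult_single)
  finally show "gsingle g 1 * injection_sum X w n = injection_sum X w n * gsingle g 1" .
qed

lemma fix_series_id: "finite X \<Longrightarrow> (\<And>x. x \<in> X \<Longrightarrow> w x = x) \<Longrightarrow> fix_series X w = psum 1 ^ card X"
proof (induction X rule: finite_induct)
  case (insert x X)
  have "fix_series ({x} \<union> X) w = fix_series {x} w * fix_series X w"
    using insert by (intro fix_series_disjoint_Un) auto
  also have "fix_series {x} w = fix_series {..<1} (\<lambda>j. Suc j mod 1)"
    using insert.prems by (intro fix_series_transport[of "\<lambda>_. 0"]) (auto simp: bij_betw_def)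
  also have "\<dots> = psum 1" by (rule fix_series_cycle) simp
  finally show ?case using insert by simp
qed (simp add: fix_series_empty)

lemma perm_series_pushed:
  assumes "finite X" "bij_betw w X X" "\<iota> \<in> injections X n"
  shows "perm_series n (push X \<iota> w) = fix_series X w * psum 1 ^ (n - card X)"
proof -
  have inj: "inj_on \<iota> X" and sub: "\<iota> ` X \<subseteq> {..<n}" using injectionsD assms(3) by blast+
  have "fix_series (\<iota> ` X \<union> ({..<n} - \<iota> ` X)) (push X \<iota> w) =
      fix_series (\<iota> ` X) (push X \<iota> w) * fix_series ({..<n} - \<iota> ` X) (push X \<iota> w)"
    using assms(1) bij_betw_memD[OF push_bij[OF inj assms(2)]]
    by (intro fix_series_disjoint_Un) (auto simp: push_outside)
  also have "fix_series (\<iota> ` X) (push X \<iota> w) = fix_series X w"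
    using inj bij_betw_memD[OF assms(2)] by (intro fix_series_transport[symmetric, of \<iota>]) (auto simp: bij_betw_def push_apply)
  also have "fix_series ({..<n} - \<iota> ` X) (push X \<iota> w) = psum 1 ^ card ({..<n} - \<iota> ` X)"
    by (intro fix_series_id) (auto simp: push_outside)
  also have "card ({..<n} - \<iota> ` X) = n - card X"
    using sub assms(1) inj by (simp add: card_Diff_subset card_image)
  finally show ?thesis using sub by (simp add: perm_series_def Un_absorb1)
qed

lemma row_rotation_bij: "bij_betw (row_rotation \<kappa>) (diagram \<kappa>) (diagram \<kappa>)"
proof -
  have "inj_on (row_rotation \<kappa>) (diagram \<kappa>)"
  proof (rule inj_onI)
    fix c d assume c: "c \<in> diagram \<kappa>" and d: "d \<in> diagram \<kappa>" and eq: "row_rotation \<kappa> c = row_rotation \<kappa> d"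
    obtain i j i' j' where cd: "c = (i, j)" "d = (i', j')" by (cases c, cases d)
    have "i = i'" using eq by (simp add: row_rotation_def cd)
    moreover have "j < \<kappa> ! i" "j' < \<kappa> ! i'" using c d by (auto simp: diagram_def cd)
    moreover have "snd (row_rotation \<kappa> c) = snd (row_rotation \<kappa> d)" using eq by simp
    then have "Suc j mod \<kappa> ! i = Suc j' mod \<kappa> ! i'" by (simp add: row_rotation_def cd)
    ultimately show "c = d" by (simp add: cd mod_Suc split: if_splits)
  qed
  moreover have "row_rotation \<kappa> ` diagram \<kappa> \<subseteq> diagram \<kappa>" using row_rotation_in by blast
  ultimately show ?thesis unfolding bij_betw_def by (simp add: endo_inj_surj)
qed

definition cycle_sum :: "nat list \<Rightarrow> nat \<Rightarrow> galg" where
  "cycle_sum \<kappa> n = injection_sum (diagram \<kappa>) (row_rotation \<kappa>) n"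

lemma central_cycle_sum: "central n (cycle_sum \<kappa> n)"
  unfolding cycle_sum_def by (rule central_injection_sum[OF row_rotation_bij])

text \<open>
  Each of the \<open>(n)\<^sub>m\<close> injections contributes a permutation with the cycle type \<open>\<kappa>\<close> enlarged by
  \<open>n - m\<close> fixed points, where \<open>m\<close> is the size of \<open>\<kappa>\<close>.
\<close>

lemma frobenius_cycle_sum:
  assumes "is_partition \<kappa>" shows "frobenius n (cycle_sum \<kappa> n) = fps_nth (p_hat \<kappa>) n"
proof -
  let ?X = "diagram \<kappa>" and ?w = "row_rotation \<kappa>"
  have psums: "fix_series ?X ?w = psums \<kappa>"
    using assms by (intro fix_series_row_rotation) (auto simp: is_partition_def intro: gr0I)
  have "frobenius n (cycle_sum \<kappa> n) = (\<Sum>\<iota>\<in>injections ?X n. psums \<kappa> * psum 1 ^ (n - sum_list \<kappa>))"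
    unfolding cycle_sum_def injection_sum_def frobenius_sum
  proof (rule sum.cong[OF refl])
    fix \<iota> assume \<iota>: "\<iota> \<in> injections ?X n"
    have "frobenius n (gsingle (pushed ?X ?w \<iota>) 1) = perm_series n (push ?X \<iota> ?w)"
      using perm_of_pushed[OF row_rotation_bij \<iota>] by (simp add: frobenius_single)
    then show "frobenius n (gsingle (pushed ?X ?w \<iota>) 1) = psums \<kappa> * psum 1 ^ (n - sum_list \<kappa>)"
      using perm_series_pushed[OF _ row_rotation_bij \<iota>] by (simp add: psums card_diagram)
  qed
  also have "\<dots> = of_nat (\<Prod>i<sum_list \<kappa>. n - i) * (psums \<kappa> * psum 1 ^ (n - sum_list \<kappa>))"
    by (simp add: card_injections card_diagram)
  also have "\<dots> = fps_nth (p_hat \<kappa>) n"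
  proof (cases "sum_list \<kappa> \<le> n")
    case True then show ?thesis by (simp add: p_hat_def mult.assoc)
  next
    case False
    then have "(\<Prod>i<sum_list \<kappa>. n - i) = 0" by (intro prod_zero) (auto intro!: bexI[of _ n])
    then show ?thesis using False by (simp only: p_hat_def fps_nth_Abs_fps if_False of_nat_0 mult_zero_left)
  qed
  finally show ?thesis .
qed

section \<open>Overlap patterns\<close>

text \<open>
  The ways in which the images of an injection of \<open>X\<close> and an injection of \<open>Y\<close> can meet are the partial
  bijections between \<open>X\<close> and \<open>Y\<close>.
\<close>

definition overlaps :: "'a set \<Rightarrow> 'b set \<Rightarrow> ('a \<times> 'b) set set" where
  "overlaps X Y = {\<pi>. \<pi> \<subseteq> X \<times> Y \<and> (\<forall>(x, y)\<in>\<pi>. \<forall>(x', y')\<in>\<pi>. x = x' \<longleftrightarrow> y = y')}"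

lemma overlapsD: "\<pi> \<in> overlaps X Y \<Longrightarrow> (x, y) \<in> \<pi> \<Longrightarrow> (x', y') \<in> \<pi> \<Longrightarrow> x = x' \<longleftrightarrow> y = y'"
  unfolding overlaps_def by fast

lemma finite_overlaps: "finite X \<Longrightarrow> finite Y \<Longrightarrow> finite (overlaps X Y)"
  by (rule finite_subset[of _ "Pow (X \<times> Y)"]) (auto simp: overlaps_def)

text \<open>
  The union of \<open>X\<close> and \<open>Y\<close> in which the pairs of \<open>\<pi>\<close> are identified. Identified elements are represented
  by their copy in \<open>X\<close>, and \<open>glue \<pi>\<close> is the resulting embedding of \<open>Y\<close>.
\<close>

definition glued :: "'a set \<Rightarrow> 'b set \<Rightarrow> ('a \<times> 'b) set \<Rightarrow> ('a + 'b) set" where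
  "glued X Y \<pi> = Inl ` X \<union> Inr ` (Y - Range \<pi>)"

definition glue :: "('a \<times> 'b) set \<Rightarrow> 'b \<Rightarrow> 'a + 'b" where
  "glue \<pi> y = (if y \<in> Range \<pi> then Inl (SOME x. (x, y) \<in> \<pi>) else Inr y)"

lemma glue_eq: assumes "\<pi> \<in> overlaps X Y" "(x, y) \<in> \<pi>" shows "glue \<pi> y = Inl x"
proof -
  have "(SOME x. (x, y) \<in> \<pi>, y) \<in> \<pi>" using assms(2) by (rule someI)
  then have "(SOME x. (x, y) \<in> \<pi>) = x" using assms by (fastforce simp: overlaps_def)
  then show ?thesis using assms(2) by (auto simp: glue_def)
qed

lemma glue_Inr: "y \<notin> Range \<pi> \<Longrightarrow> glue \<pi> y = Inr y" by (simp add: glue_def)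

lemma glue_InrD: "glue \<pi> y = Inr z \<Longrightarrow> y = z"
  unfolding glue_def by (cases "y \<in> Range \<pi>") simp_all

lemma glue_Inl_iff: assumes "\<pi> \<in> overlaps X Y" shows "glue \<pi> y = Inl x \<longleftrightarrow> (x, y) \<in> \<pi>"
proof
  assume *: "glue \<pi> y = Inl x"
  then have "y \<in> Range \<pi>" using glue_Inr[of y \<pi>] by auto
  then obtain x' where "(x', y) \<in> \<pi>" by blast
  then show "(x, y) \<in> \<pi>" using glue_eq[OF assms] * by fastforce
qed (rule glue_eq[OF assms])

lemma glue_inj: assumes "\<pi> \<in> overlaps X Y" shows "inj_on (glue \<pi>) Y"
proof (rule inj_onI)
  fix y y' assume eq: "glue \<pi> y = glue \<pi> y'"
  show "y = y'"
  proof (cases "glue \<pi> y")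
    case (Inl x)
    moreover from this have "glue \<pi> y' = Inl x" unfolding eq .
    ultimately have "(x, y) \<in> \<pi>" "(x, y') \<in> \<pi>" by (simp_all only: glue_Inl_iff[OF assms])
    from overlapsD[OF assms this] show ?thesis by simp
  next
    case (Inr z)
    have "y = z" by (rule glue_InrD[OF Inr])
    moreover have "y' = z" by (rule glue_InrD[OF Inr[unfolded eq]])
    ultimately show ?thesis by simp
  qed
qed

lemma glue_in: assumes "\<pi> \<in> overlaps X Y" "y \<in> Y" shows "glue \<pi> y \<in> glued X Y \<pi>"
proof (cases "y \<in> Range \<pi>")
  case True
  then obtain x where x: "(x, y) \<in> \<pi>" by blast
  then have "x \<in> X" using assms(1) by (auto simp: overlaps_def)
  then show ?thesis using glue_eq[OF assms(1) x] by (simp add: glued_def)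
next
  case False then show ?thesis using assms(2) by (simp add: glued_def glue_Inr)
qed

definition glued_perm :: "'a set \<Rightarrow> ('a \<Rightarrow> 'a) \<Rightarrow> 'b set \<Rightarrow> ('b \<Rightarrow> 'b) \<Rightarrow> ('a \<times> 'b) set \<Rightarrow> 'a + 'b \<Rightarrow> 'a + 'b" where
  "glued_perm X w Y v \<pi> = push X Inl w \<circ> push Y (glue \<pi>) v"

lemma glued_perm_bij:
  assumes "bij_betw w X X" "bij_betw v Y Y" "\<pi> \<in> overlaps X Y"
  shows "bij_betw (push X Inl w) (glued X Y \<pi>) (glued X Y \<pi>)"
    "bij_betw (push Y (glue \<pi>) v) (glued X Y \<pi>) (glued X Y \<pi>)"
    "bij_betw (glued_perm X w Y v \<pi>) (glued X Y \<pi>) (glued X Y \<pi>)"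
proof -
  show a: "bij_betw (push X Inl w) (glued X Y \<pi>) (glued X Y \<pi>)"
    by (rule permutes_imp_bij, rule push_permutes[OF _ assms(1)]) (auto simp: glued_def)
  show b: "bij_betw (push Y (glue \<pi>) v) (glued X Y \<pi>) (glued X Y \<pi>)"
    using glue_in[OF assms(3)]
    by (intro permutes_imp_bij push_permutes[OF glue_inj[OF assms(3)] assms(2)]) auto
  show "bij_betw (glued_perm X w Y v \<pi>) (glued X Y \<pi>) (glued X Y \<pi>)"
    unfolding glued_perm_def by (rule bij_betw_trans[OF b a])
qed

definition overlap_of :: "'a set \<Rightarrow> 'b set \<Rightarrow> ('a \<Rightarrow> nat) \<Rightarrow> ('b \<Rightarrow> nat) \<Rightarrow> ('a \<times> 'b) set" where
  "overlap_of X Y \<iota> \<theta> = {(x, y). x \<in> X \<and> y \<in> Y \<and> \<iota> x = \<theta> y}"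

lemma overlap_of_in:
  assumes "inj_on \<iota> X" "inj_on \<theta> Y" shows "overlap_of X Y \<iota> \<theta> \<in> overlaps X Y"
proof -
  have "x = x' \<longleftrightarrow> y = y'" if "(x, y) \<in> overlap_of X Y \<iota> \<theta>" "(x', y') \<in> overlap_of X Y \<iota> \<theta>" for x y x' y'
  proof -
    have eq: "\<iota> x = \<theta> y" "\<iota> x' = \<theta> y'" "x \<in> X" "x' \<in> X" "y \<in> Y" "y' \<in> Y"
      using that by (auto simp: overlap_of_def)
    have "x = x' \<longleftrightarrow> \<iota> x = \<iota> x'" using inj_on_eq_iff[OF assms(1) eq(3,4)] by simp
    also have "\<dots> \<longleftrightarrow> y = y'" unfolding eq(1,2) using inj_on_eq_iff[OF assms(2) eq(5,6)] by simp
    finally show ?thesis .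
  qed
  then show ?thesis by (auto simp: overlaps_def overlap_of_def)
qed

text \<open>
  A pair of injections is the same as its overlap pattern together with an injection of the glued set.
\<close>

lemma injection_pairs_bij:
  fixes X :: "'a set" and Y :: "'b set" and n :: nat
  defines "f \<equiv> \<lambda>(\<iota>, \<theta>). (overlap_of X Y \<iota> \<theta>, restrict (case_sum \<iota> \<theta>) (glued X Y (overlap_of X Y \<iota> \<theta>)))"
    and "g \<equiv> \<lambda>(\<pi>, j). (restrict (j \<circ> Inl) X, restrict (j \<circ> glue \<pi>) Y)"
  shows "\<And>a. a \<in> injections X n \<times> injections Y n \<Longrightarrow> g (f a) = a"
    "\<And>a. a \<in> injections X n \<times> injections Y n \<Longrightarrow> f a \<in> (SIGMA \<pi>:overlaps X Y. injections (glued X Y \<pi>) n)"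
    "\<And>b. b \<in> (SIGMA \<pi>:overlaps X Y. injections (glued X Y \<pi>) n) \<Longrightarrow> f (g b) = b"
    "\<And>b. b \<in> (SIGMA \<pi>:overlaps X Y. injections (glued X Y \<pi>) n) \<Longrightarrow> g b \<in> injections X n \<times> injections Y n"
proof -
  fix a assume "a \<in> injections X n \<times> injections Y n"
  then obtain \<iota> \<theta> where a: "a = (\<iota>, \<theta>)" and \<iota>: "\<iota> \<in> injections X n" and \<theta>: "\<theta> \<in> injections Y n" by auto
  let ?\<pi> = "overlap_of X Y \<iota> \<theta>" and ?j = "case_sum \<iota> \<theta>"
  note inj = injectionsD(1)[OF \<iota>] injectionsD(1)[OF \<theta>]
  have \<pi>: "?\<pi> \<in> overlaps X Y" by (rule overlap_of_in[OF inj])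
  have glue: "?j (glue ?\<pi> y) = \<theta> y" if "y \<in> Y" for y
  proof (cases "y \<in> Range ?\<pi>")
    case True
    then obtain x where x: "(x, y) \<in> ?\<pi>" by blast
    then have "\<iota> x = \<theta> y" by (simp add: overlap_of_def)
    then show ?thesis using glue_eq[OF \<pi> x] by simp
  qed (simp add: glue_Inr)
  have "restrict (restrict ?j (glued X Y ?\<pi>) \<circ> Inl) X = \<iota>"
    using injectionsD(3)[OF \<iota>] by (intro extensionalityI[of _ X]) (auto simp: glued_def)
  moreover have "restrict (restrict ?j (glued X Y ?\<pi>) \<circ> glue ?\<pi>) Y = \<theta>"
    using injectionsD(3)[OF \<theta>] glue glue_in[OF \<pi>] by (intro extensionalityI[of _ Y]) auto
  ultimately show "g (f a) = a" by (simp add: a f_def g_def)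
  have "inj_on ?j (glued X Y ?\<pi>)"
  proof (rule inj_onI)
    fix s t assume s: "s \<in> glued X Y ?\<pi>" and t: "t \<in> glued X Y ?\<pi>" and eq: "?j s = ?j t"
    have cross: False if "x \<in> X" "y \<in> Y" "y \<notin> Range ?\<pi>" "\<iota> x = \<theta> y" for x y
      using that by (auto simp: overlap_of_def)
    show "s = t"
      using s t eq inj cross by (cases s; cases t) (auto simp: glued_def dest: inj_onD, metis+)
  qed
  moreover have "?j ` glued X Y ?\<pi> \<subseteq> {..<n}"
    using injectionsD(2)[OF \<iota>] injectionsD(2)[OF \<theta>] by (auto simp: glued_def)
  ultimately have "restrict ?j (glued X Y ?\<pi>) \<in> injections (glued X Y ?\<pi>) n" by (rule injectionsI)
  then show "f a \<in> (SIGMA \<pi>:overlaps X Y. injections (glued X Y \<pi>) n)" using \<pi> by (simp add: a f_def)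
next
  fix b assume "b \<in> (SIGMA \<pi>:overlaps X Y. injections (glued X Y \<pi>) n)"
  then obtain \<pi> j where b: "b = (\<pi>, j)" and \<pi>: "\<pi> \<in> overlaps X Y" and j: "j \<in> injections (glued X Y \<pi>) n" by auto
  let ?U = "glued X Y \<pi>"
  have injj: "inj_on j ?U" and jn: "j ` ?U \<subseteq> {..<n}" using injectionsD j by blast+
  let ?\<iota> = "restrict (j \<circ> Inl) X" and ?\<theta> = "restrict (j \<circ> glue \<pi>) Y"
  have InlU: "Inl x \<in> ?U" if "x \<in> X" for x using that by (simp add: glued_def)
  have "inj_on (j \<circ> Inl) X" using InlU by (intro comp_inj_on inj_on_subset[OF injj]) auto
  then have \<iota>: "?\<iota> \<in> injections X n" using jn InlU by (intro injectionsI) auto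
  have "inj_on (j \<circ> glue \<pi>) Y"
    using glue_in[OF \<pi>] by (intro comp_inj_on inj_on_subset[OF injj] glue_inj[OF \<pi>]) auto
  then have \<theta>: "?\<theta> \<in> injections Y n" using jn glue_in[OF \<pi>] by (intro injectionsI) auto
  show "g b \<in> injections X n \<times> injections Y n" using \<iota> \<theta> by (simp add: b g_def)
  have "(x, y) \<in> overlap_of X Y ?\<iota> ?\<theta> \<longleftrightarrow> (x, y) \<in> \<pi>" for x y
  proof -
    have "(x, y) \<in> overlap_of X Y ?\<iota> ?\<theta> \<longleftrightarrow> x \<in> X \<and> y \<in> Y \<and> j (Inl x) = j (glue \<pi> y)"
      by (auto simp: overlap_of_def)
    also have "\<dots> \<longleftrightarrow> x \<in> X \<and> y \<in> Y \<and> Inl x = glue \<pi> y"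
      using inj_on_eq_iff[OF injj] InlU glue_in[OF \<pi>] by blast
    also have "\<dots> \<longleftrightarrow> (x, y) \<in> \<pi>"
      using glue_Inl_iff[OF \<pi>, of y x] \<pi> by (auto simp: overlaps_def)
    finally show ?thesis .
  qed
  then have eq: "overlap_of X Y ?\<iota> ?\<theta> = \<pi>" by auto
  have "restrict (case_sum ?\<iota> ?\<theta>) ?U = j"
  proof (rule extensionalityI[of _ ?U])
    show "j \<in> extensional ?U" by (rule injectionsD(3)[OF j])
    show "restrict (case_sum ?\<iota> ?\<theta>) ?U s = j s" if "s \<in> ?U" for s
      using that by (auto simp: glued_def glue_Inr)
  qed simp
  then show "f (g b) = b" by (simp add: b f_def g_def eq)
qed

text \<open>
  For a fixed overlap pattern the product of the two pushed permutations is itself pushed from one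
  permutation of the glued set, and this permutation does not depend on \<open>n\<close>.
\<close>

theorem injection_sum_mult:
  assumes fin: "finite X" "finite Y" and w: "bij_betw w X X" and v: "bij_betw v Y Y"
  shows "injection_sum X w n * injection_sum Y v n =
    (\<Sum>\<pi>\<in>overlaps X Y. injection_sum (glued X Y \<pi>) (glued_perm X w Y v \<pi>) n)"
proof -
  have "injection_sum X w n * injection_sum Y v n =
      (\<Sum>(\<iota>, \<theta>)\<in>injections X n \<times> injections Y n. gsingle (pushed X w \<iota> + pushed Y v \<theta>) 1)"
    unfolding injection_sum_def sum_product sum.cartesian_product by (simp add: mult_single)
  also have "\<dots> = (\<Sum>(\<pi>, j)\<in>(SIGMA \<pi>:overlaps X Y. injections (glued X Y \<pi>) n).
      gsingle (pushed (glued X Y \<pi>) (glued_perm X w Y v \<pi>) j) 1)"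
  proof (rule sum.reindex_bij_witness[symmetric, OF injection_pairs_bij(3,4,1,2)])
    fix b assume bin: "b \<in> (SIGMA \<pi>:overlaps X Y. injections (glued X Y \<pi>) n)"
    then obtain \<pi> j where b: "b = (\<pi>, j)" and \<pi>: "\<pi> \<in> overlaps X Y" and j: "j \<in> injections (glued X Y \<pi>) n" by auto
    let ?U = "glued X Y \<pi>"
    let ?\<iota> = "restrict (j \<circ> Inl) X" and ?\<theta> = "restrict (j \<circ> glue \<pi>) Y"
    have inj: "inj_on j ?U" by (rule injectionsD(1)[OF j])
    have "?\<iota> \<in> injections X n" "?\<theta> \<in> injections Y n"
      using injection_pairs_bij(4)[OF bin] by (simp_all add: b)
    note ap = perm_of_pushed(1)[OF w this(1)] perm_of_pushed(1)[OF v this(2)]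
    have "push X ?\<iota> w = push ?U j (push X Inl w)"
      using bij_betw_memD[OF w] by (intro push_comp_fun inj) (auto simp: glued_def)
    moreover have "push Y ?\<theta> v = push ?U j (push Y (glue \<pi>) v)"
      using bij_betw_memD[OF v] glue_in[OF \<pi>] by (intro push_comp_fun inj glue_inj[OF \<pi>]) auto
    ultimately have "push X ?\<iota> w \<circ> push Y ?\<theta> v = push ?U j (glued_perm X w Y v \<pi>)"
      using push_compose[OF inj bij_betw_memD[OF glued_perm_bij(2)[OF w v \<pi>]]]
      by (simp only: glued_perm_def)
    then have "perm_of (pushed X w ?\<iota> + pushed Y v ?\<theta>) = perm_of (pushed ?U (glued_perm X w Y v \<pi>) j)"
      by (simp only: perm_of_add ap perm_of_pushed(1)[OF glued_perm_bij(3)[OF w v \<pi>] j])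
    then have "pushed X w ?\<iota> + pushed Y v ?\<theta> = pushed ?U (glued_perm X w Y v \<pi>) j"
      by (simp only: perm_of_inject_eq)
    then show "(case case b of (\<pi>, j) \<Rightarrow> (restrict (j \<circ> Inl) X, restrict (j \<circ> glue \<pi>) Y) of
        (\<iota>, \<theta>) \<Rightarrow> gsingle (pushed X w \<iota> + pushed Y v \<theta>) 1) =
      (case b of (\<pi>, j) \<Rightarrow> gsingle (pushed (glued X Y \<pi>) (glued_perm X w Y v \<pi>) j) 1)"
      by (simp add: b)
  qed
  also have "\<dots> = (\<Sum>\<pi>\<in>overlaps X Y. injection_sum (glued X Y \<pi>) (glued_perm X w Y v \<pi>) n)"
  proof -
    have "finite (glued X Y \<pi>)" for \<pi> :: "('a \<times> 'b) set" using fin by (simp add: glued_def)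
    then show ?thesis unfolding injection_sum_def
      using finite_overlaps[OF fin] by (subst sum.Sigma) (auto intro: finite_injections)
  qed
  finally show ?thesis .
qed

section \<open>The algebra spanned by the normalised power sums\<close>

text \<open>
  By \<open>cycle_type_exists\<close> the choice operator is applied to a satisfiable condition.
\<close>

definition overlap_type :: "nat list \<Rightarrow> nat list \<Rightarrow> ((nat \<times> nat) \<times> (nat \<times> nat)) set \<Rightarrow> nat list" where
  "overlap_type \<mu> \<nu> \<pi> = (SOME \<kappa>. \<kappa> \<in> partitions_of (card (glued (diagram \<mu>) (diagram \<nu>) \<pi>)) \<and>
     (\<exists>\<phi>. rotation_model \<kappa> \<phi> (glued (diagram \<mu>) (diagram \<nu>) \<pi>)
        (glued_perm (diagram \<mu>) (row_rotation \<mu>) (diagram \<nu>) (row_rotation \<nu>) \<pi>)))"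

lemma overlap_type:
  assumes "\<pi> \<in> overlaps (diagram \<mu>) (diagram \<nu>)"
  shows "overlap_type \<mu> \<nu> \<pi> \<in> partitions_of (card (glued (diagram \<mu>) (diagram \<nu>) \<pi>))"
    "\<exists>\<phi>. rotation_model (overlap_type \<mu> \<nu> \<pi>) \<phi> (glued (diagram \<mu>) (diagram \<nu>) \<pi>)
        (glued_perm (diagram \<mu>) (row_rotation \<mu>) (diagram \<nu>) (row_rotation \<nu>) \<pi>)"
proof -
  have "finite (glued (diagram \<mu>) (diagram \<nu>) \<pi>)" by (simp add: glued_def)
  from someI_ex[OF cycle_type_exists[OF this glued_perm_bij(3)[OF row_rotation_bij row_rotation_bij assms]]]
  show "overlap_type \<mu> \<nu> \<pi> \<in> partitions_of (card (glued (diagram \<mu>) (diagram \<nu>) \<pi>))"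
    "\<exists>\<phi>. rotation_model (overlap_type \<mu> \<nu> \<pi>) \<phi> (glued (diagram \<mu>) (diagram \<nu>) \<pi>)
        (glued_perm (diagram \<mu>) (row_rotation \<mu>) (diagram \<nu>) (row_rotation \<nu>) \<pi>)"
    unfolding overlap_type_def by blast+
qed

lemma cycle_sum_mult:
  "cycle_sum \<mu> n * cycle_sum \<nu> n = (\<Sum>\<pi>\<in>overlaps (diagram \<mu>) (diagram \<nu>). cycle_sum (overlap_type \<mu> \<nu> \<pi>) n)"
  unfolding cycle_sum_def injection_sum_mult[OF finite_diagram finite_diagram row_rotation_bij row_rotation_bij]
proof (rule sum.cong[OF refl])
  fix \<pi> assume \<pi>: "\<pi> \<in> overlaps (diagram \<mu>) (diagram \<nu>)"
  obtain \<phi> where "rotation_model (overlap_type \<mu> \<nu> \<pi>) \<phi> (glued (diagram \<mu>) (diagram \<nu>) \<pi>)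
        (glued_perm (diagram \<mu>) (row_rotation \<mu>) (diagram \<nu>) (row_rotation \<nu>) \<pi>)"
    using overlap_type(2)[OF \<pi>] by blast
  then show "injection_sum (glued (diagram \<mu>) (diagram \<nu>) \<pi>)
      (glued_perm (diagram \<mu>) (row_rotation \<mu>) (diagram \<nu>) (row_rotation \<nu>) \<pi>) n =
    injection_sum (diagram (overlap_type \<mu> \<nu> \<pi>)) (row_rotation (overlap_type \<mu> \<nu> \<pi>)) n"
    unfolding rotation_model_def
    by (intro injection_sum_transport[symmetric, of \<phi>] row_rotation_in) auto
qed

text \<open>
  Both \<open>X\<close> and \<open>Y\<close> embed into the glued set, and together they cover it.
\<close>

lemma card_glued_bounds:
  assumes fin: "finite X" "finite Y" and \<pi>: "\<pi> \<in> overlaps X Y"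
  shows "max (card X) (card Y) \<le> card (glued X Y \<pi>)" "card (glued X Y \<pi>) \<le> card X + card Y"
proof -
  have finU: "finite (glued X Y \<pi>)" using fin by (simp add: glued_def)
  have "card X \<le> card (glued X Y \<pi>)"
    using finU by (intro card_inj_on_le[of Inl]) (auto simp: glued_def)
  moreover have "card Y \<le> card (glued X Y \<pi>)"
    using finU glue_in[OF \<pi>] by (intro card_inj_on_le[OF glue_inj[OF \<pi>]]) auto
  ultimately show "max (card X) (card Y) \<le> card (glued X Y \<pi>)" by simp
  have "card (glued X Y \<pi>) \<le> card (Inl ` X :: ('a + 'b) set) + card (Inr ` (Y - Range \<pi>) :: ('a + 'b) set)"
    unfolding glued_def by (rule card_Un_le)
  also have "\<dots> \<le> card X + card Y"
    using fin by (intro add_mono card_image_le order_trans[OF card_image_le card_mono]) auto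
  finally show "card (glued X Y \<pi>) \<le> card X + card Y" .
qed

lemma p_hat_in_Lambda_hat: "is_partition \<mu> \<Longrightarrow> p_hat \<mu> \<in> Lambda_hat"
proof -
  assume \<mu>: "is_partition \<mu>"
  have "frobenius n x \<in> Lambda n" for n x
    unfolding frobenius_def
    by (intro mser.subspace_sum mser.subspace_scale subspace_Lambda perm_series_in_Lambda) (simp add: Sn_def)
  then show ?thesis unfolding Lambda_hat_def by (simp flip: frobenius_cycle_sum[OF \<mu>])
qed

lemma p_hat_class_prod:
  assumes "is_partition \<mu>" "is_partition \<nu>"
  shows "p_hat \<mu> \<otimes>\<^sub>c p_hat \<nu> = (\<Sum>\<pi>\<in>overlaps (diagram \<mu>) (diagram \<nu>). p_hat (overlap_type \<mu> \<nu> \<pi>))"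
proof (rule fps_ext)
  fix n
  have "fps_nth (p_hat \<mu> \<otimes>\<^sub>c p_hat \<nu>) n = class_prod n (frobenius n (cycle_sum \<mu> n)) (frobenius n (cycle_sum \<nu> n))"
    by (simp add: class_prod_hat_def frobenius_cycle_sum assms)
  also have "\<dots> = frobenius n (cycle_sum \<mu> n * cycle_sum \<nu> n)"
    by (rule frobenius_mult[OF central_cycle_sum central_cycle_sum, symmetric])
  also have "\<dots> = (\<Sum>\<pi>\<in>overlaps (diagram \<mu>) (diagram \<nu>). frobenius n (cycle_sum (overlap_type \<mu> \<nu> \<pi>) n))"
    by (simp only: cycle_sum_mult frobenius_sum)
  also have "\<dots> = (\<Sum>\<pi>\<in>overlaps (diagram \<mu>) (diagram \<nu>). fps_nth (p_hat (overlap_type \<mu> \<nu> \<pi>)) n)"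
    using overlap_type(1) by (intro sum.cong refl frobenius_cycle_sum) (auto simp: partitions_of_def)
  finally show "fps_nth (p_hat \<mu> \<otimes>\<^sub>c p_hat \<nu>) n =
      fps_nth (\<Sum>\<pi>\<in>overlaps (diagram \<mu>) (diagram \<nu>). p_hat (overlap_type \<mu> \<nu> \<pi>)) n"
    by (simp add: fps_sum_nth)
qed

lemma schur_coord_add:
  "F \<in> Lambda n \<Longrightarrow> G \<in> Lambda n \<Longrightarrow> schur_coord n (F + G) \<kappa> = schur_coord n F \<kappa> + schur_coord n G \<kappa>"
  unfolding schur_coord_def using Lambda_subset_span_schur[of n]
  by (subst mser.representation_add[OF independent_schur]) auto

lemma schur_coord_scale:
  "F \<in> Lambda n \<Longrightarrow> schur_coord n (msmult c F) \<kappa> = c * schur_coord n F \<kappa>"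
  unfolding schur_coord_def using Lambda_subset_span_schur[of n]
  by (subst mser.representation_scale[OF independent_schur]) auto

lemma class_prod_commute: "class_prod n F G = class_prod n G F"
  unfolding class_prod_coord by (intro sum.cong refl) (simp add: mult.commute)

lemma class_prod_hat_commute: "F \<otimes>\<^sub>c G = G \<otimes>\<^sub>c F"
  unfolding class_prod_hat_def using class_prod_commute by (metis (no_types))

lemma class_prod_hat_add:
  "F \<in> Lambda_hat \<Longrightarrow> F' \<in> Lambda_hat \<Longrightarrow> (F + F') \<otimes>\<^sub>c G = F \<otimes>\<^sub>c G + F' \<otimes>\<^sub>c G"
  by (rule fps_ext) (simp add: class_prod_hat_def class_prod_coord Lambda_hat_def schur_coord_add
      distrib_right add_divide_distrib mser.scale_left_distrib sum.distrib)

lemma class_prod_hat_scale: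
  "F \<in> Lambda_hat \<Longrightarrow> hat_smult c F \<otimes>\<^sub>c G = hat_smult c (F \<otimes>\<^sub>c G)"
  by (rule fps_ext) (simp add: class_prod_hat_def hat_smult_def class_prod_coord Lambda_hat_def schur_coord_scale
      mser.scale_sum_right mult.assoc)

lemma class_prod_hat_0: "0 \<otimes>\<^sub>c G = 0"
proof -
  have "0 \<in> Lambda_hat" by (simp add: Lambda_hat_def Lambda_def)
  from class_prod_hat_scale[OF this, of 0 G] show ?thesis by simp
qed

lemma subspace_Lambda_hat: "hat.subspace Lambda_hat"
  by (rule hat.subspaceI)
    (auto simp: Lambda_hat_def hat_smult_def intro: mser.subspace_0 mser.subspace_add mser.subspace_scale subspace_Lambda)

lemma p_hat_span_subset: "p_hat_span \<subseteq> Lambda_hat"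
  unfolding p_hat_span_def by (rule hat.span_minimal) (auto intro: p_hat_in_Lambda_hat subspace_Lambda_hat)

text \<open>
  Products of the generators are known. Linearity in the first factor extends this to all of the span,
  and commutativity moves the argument to the second factor.
\<close>

lemma p_hat_span_closed:
  assumes F: "F \<in> p_hat_span" and G: "G \<in> p_hat_span"
  shows "F \<otimes>\<^sub>c G \<in> p_hat_span"
proof -
  have sub: "hat.subspace p_hat_span" unfolding p_hat_span_def by (rule hat.subspace_span)
  have extend: "F \<otimes>\<^sub>c G \<in> p_hat_span"
    if gen: "\<And>\<mu>. is_partition \<mu> \<Longrightarrow> p_hat \<mu> \<otimes>\<^sub>c G \<in> p_hat_span" and F: "F \<in> p_hat_span" for F G
  proof -
    let ?P = "{F \<in> Lambda_hat. F \<otimes>\<^sub>c G \<in> p_hat_span}"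
    have "hat.subspace ?P"
      by (rule hat.subspaceI)
        (auto simp: class_prod_hat_0 class_prod_hat_add class_prod_hat_scale
          intro: hat.subspace_0 hat.subspace_add hat.subspace_scale sub subspace_Lambda_hat)
    then have "p_hat_span \<subseteq> ?P"
      using gen p_hat_in_Lambda_hat unfolding p_hat_span_def by (intro hat.span_minimal) auto
    then show ?thesis using F by blast
  qed
  have base: "p_hat \<mu> \<otimes>\<^sub>c p_hat \<nu> \<in> p_hat_span" if "is_partition \<mu>" "is_partition \<nu>" for \<mu> \<nu>
    unfolding p_hat_class_prod[OF that] p_hat_span_def
    using overlap_type(1) by (intro hat.span_sum hat.span_base) (auto simp: partitions_of_def)
  show ?thesis
  proof (rule extend[OF _ F])
    fix \<mu> assume \<mu>: "is_partition \<mu>"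
    have "G \<otimes>\<^sub>c p_hat \<mu> \<in> p_hat_span" by (rule extend[OF base[OF _ \<mu>] G])
    then show "p_hat \<mu> \<otimes>\<^sub>c G \<in> p_hat_span" by (simp only: class_prod_hat_commute)
  qed
qed

text \<open>
  In degree \<open>n\<close> this is the image of the identity permutation, whose Schur coefficients are the numbers
  \<open>f\<^sup>\<kappa>\<close>; they cancel the denominators of the class product.
\<close>

lemma p_hat_Nil_unit:
  assumes "F \<in> Lambda_hat" shows "p_hat [] \<otimes>\<^sub>c F = F"
proof (rule fps_ext)
  fix n
  have F: "fps_nth F n \<in> Lambda n" using assms by (simp add: Lambda_hat_def)
  have "fps_nth (p_hat []) n = perm_series n id"
    using fix_series_id[of "{..<n}" id] by (simp add: p_hat_def psums_def perm_series_def)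
  then have "fps_nth (p_hat [] \<otimes>\<^sub>c F) n = class_prod n (\<Sum>\<kappa>\<in>partitions_of n. msmult (of_nat (num_syt \<kappa>)) (schur \<kappa>))
      (\<Sum>\<kappa>\<in>partitions_of n. msmult (schur_coord n (fps_nth F n) \<kappa>) (schur \<kappa>))"
    by (simp add: class_prod_hat_def perm_series_id schur_expansion[OF F])
  also have "\<dots> = (\<Sum>\<kappa>\<in>partitions_of n. msmult (schur_coord n (fps_nth F n) \<kappa>) (schur \<kappa>))"
    unfolding class_prod_combination using char_elem_square(1) by (intro sum.cong refl) simp
  also have "\<dots> = fps_nth F n" by (rule schur_expansion[OF F])
  finally show "fps_nth (p_hat [] \<otimes>\<^sub>c F) n = fps_nth F n" .
qed

lemma p_hat_span_comm_subalgebra: "is_comm_subalgebra p_hat_span"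
  unfolding is_comm_subalgebra_def
proof (intro conjI)
  show "p_hat_span \<subseteq> Lambda_hat" by (rule p_hat_span_subset)
  show "hat.subspace p_hat_span" unfolding p_hat_span_def by (rule hat.subspace_span)
  have "p_hat [] \<in> p_hat_span"
    unfolding p_hat_span_def by (intro hat.span_base) (simp add: is_partition_def)
  then show "\<exists>e\<in>p_hat_span. \<forall>F\<in>Lambda_hat. e \<otimes>\<^sub>c F = F \<and> F \<otimes>\<^sub>c e = F"
    using p_hat_Nil_unit class_prod_hat_commute by metis
  show "\<forall>F\<in>p_hat_span. \<forall>G\<in>p_hat_span. F \<otimes>\<^sub>c G \<in> p_hat_span" using p_hat_span_closed by blast
  show "\<forall>F\<in>p_hat_span. \<forall>G\<in>p_hat_span. F \<otimes>\<^sub>c G = G \<otimes>\<^sub>c F" using class_prod_hat_commute by blast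
qed

text \<open>
  The structure constants \<open>d\<^sup>\<kappa>\<^sub>\<mu>\<^sub>\<nu>\<close>.
\<close>

definition overlap_count :: "nat list \<Rightarrow> nat list \<Rightarrow> nat list \<Rightarrow> nat" where
  "overlap_count \<mu> \<nu> \<kappa> = card {\<pi> \<in> overlaps (diagram \<mu>) (diagram \<nu>). overlap_type \<mu> \<nu> \<pi> = \<kappa>}"

lemma overlap_count_nonzero_iff:
  "overlap_count \<mu> \<nu> \<kappa> \<noteq> 0 \<longleftrightarrow> \<kappa> \<in> overlap_type \<mu> \<nu> ` overlaps (diagram \<mu>) (diagram \<nu>)"
  using finite_overlaps[of "diagram \<mu>" "diagram \<nu>"] by (auto simp: overlap_count_def card_eq_0_iff)

theorem theorem3p2:
  shows "is_comm_subalgebra p_hat_span \<and>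
    (\<exists>d :: nat list \<Rightarrow> nat list \<Rightarrow> nat list \<Rightarrow> nat.
      \<forall>\<mu> \<nu>. is_partition \<mu> \<and> is_partition \<nu> \<longrightarrow>
        finite {\<kappa>. is_partition \<kappa> \<and> d \<mu> \<nu> \<kappa> \<noteq> 0} \<and>
        p_hat \<mu> \<otimes>\<^sub>c p_hat \<nu> =
          (\<Sum>\<kappa> | is_partition \<kappa> \<and> d \<mu> \<nu> \<kappa> \<noteq> 0. hat_smult (of_nat (d \<mu> \<nu> \<kappa>)) (p_hat \<kappa>)) \<and>
        (\<forall>\<kappa>. is_partition \<kappa> \<and> d \<mu> \<nu> \<kappa> \<noteq> 0 \<longrightarrow>
          max (sum_list \<mu>) (sum_list \<nu>) \<le> sum_list \<kappa> \<and>
          sum_list \<kappa> \<le> sum_list \<mu> + sum_list \<nu>))"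
proof (intro conjI p_hat_span_comm_subalgebra exI[of _ overlap_count] allI impI)
  fix \<mu> \<nu> assume *: "is_partition \<mu> \<and> is_partition \<nu>"
  let ?O = "overlaps (diagram \<mu>) (diagram \<nu>)"
  have finO: "finite ?O" by (intro finite_overlaps) auto
  have supp: "{\<kappa>. is_partition \<kappa> \<and> overlap_count \<mu> \<nu> \<kappa> \<noteq> 0} = overlap_type \<mu> \<nu> ` ?O"
    unfolding overlap_count_nonzero_iff using overlap_type(1) by (auto simp: partitions_of_def)
  show "finite {\<kappa>. is_partition \<kappa> \<and> overlap_count \<mu> \<nu> \<kappa> \<noteq> 0}" unfolding supp using finO by simp
  have "p_hat \<mu> \<otimes>\<^sub>c p_hat \<nu> = (\<Sum>\<pi>\<in>?O. p_hat (overlap_type \<mu> \<nu> \<pi>))"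
    using * by (intro p_hat_class_prod) auto
  also have "\<dots> = (\<Sum>\<kappa>\<in>overlap_type \<mu> \<nu> ` ?O. \<Sum>\<pi> | \<pi> \<in> ?O \<and> overlap_type \<mu> \<nu> \<pi> = \<kappa>. p_hat (overlap_type \<mu> \<nu> \<pi>))"
    using finO by (rule sum.image_gen)
  also have "\<dots> = (\<Sum>\<kappa>\<in>overlap_type \<mu> \<nu> ` ?O. hat_smult (of_nat (overlap_count \<mu> \<nu> \<kappa>)) (p_hat \<kappa>))"
  proof (rule sum.cong[OF refl])
    fix \<kappa>
    have "(\<Sum>\<pi> | \<pi> \<in> ?O \<and> overlap_type \<mu> \<nu> \<pi> = \<kappa>. p_hat (overlap_type \<mu> \<nu> \<pi>)) =
        (\<Sum>\<pi> | \<pi> \<in> ?O \<and> overlap_type \<mu> \<nu> \<pi> = \<kappa>. p_hat \<kappa>)" by (intro sum.cong refl) auto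
    then show "(\<Sum>\<pi> | \<pi> \<in> ?O \<and> overlap_type \<mu> \<nu> \<pi> = \<kappa>. p_hat (overlap_type \<mu> \<nu> \<pi>)) =
        hat_smult (of_nat (overlap_count \<mu> \<nu> \<kappa>)) (p_hat \<kappa>)"
      by (simp only: hat.sum_constant_scale overlap_count_def)
  qed
  finally show "p_hat \<mu> \<otimes>\<^sub>c p_hat \<nu> = (\<Sum>\<kappa> | is_partition \<kappa> \<and> overlap_count \<mu> \<nu> \<kappa> \<noteq> 0.
      hat_smult (of_nat (overlap_count \<mu> \<nu> \<kappa>)) (p_hat \<kappa>))" unfolding supp .
next
  fix \<mu> \<nu> \<kappa>
  assume "is_partition \<kappa> \<and> overlap_count \<mu> \<nu> \<kappa> \<noteq> 0"
  then obtain \<pi> where \<pi>: "\<pi> \<in> overlaps (diagram \<mu>) (diagram \<nu>)" and \<kappa>: "\<kappa> = overlap_type \<mu> \<nu> \<pi>"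
    unfolding overlap_count_nonzero_iff by blast
  have "sum_list \<kappa> = card (glued (diagram \<mu>) (diagram \<nu>) \<pi>)"
    using overlap_type(1)[OF \<pi>] by (simp add: \<kappa> partitions_of_def)
  then show "max (sum_list \<mu>) (sum_list \<nu>) \<le> sum_list \<kappa>" "sum_list \<kappa> \<le> sum_list \<mu> + sum_list \<nu>"
    using card_glued_bounds[OF finite_diagram finite_diagram \<pi>] by (simp_all add: card_diagram)
qed

end
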